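(* Let $x\in\mathbb{R}\setminus\{0\}$, and let $k\in(0,1)$ be the unique number with $|x|=\dfrac{K(k')}{K(k)}$, where $k'=\sqrt{1-k^2}$. Then $$T_2(ix)=\frac43\,\operatorname{sign}(x)\,K(k')\left[\left[1-\frac2\pi K(k')E(k)\right]\left[3E(k)+(k^2-2)K(k)\right]-\frac2\pi K(k')K(k)\left[(1-k^2)\left[K(k)-E(k)\right]-E(k)\right]\right],$$ and, for each choice of the sign $\pm$, $$T_2\left(\frac{\pm1+ix}{2}\right)=\frac23\,\operatorname{sign}(x)\,K(k')\Big[\left(6E(k)+K(k)(4k^2-5)\right)\left[1-\frac2\pi K(k')\left(E(k)+K(k)(k^2-1)\right)\right]$$ $$-\frac2\pi K(k')K(k)\left[(1-2k^2)E(k)+(4k^2-1)(1-k^2)K(k)\right]\Big].$$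
   Context: For $\tau\in\mathbb{C}$ with $\operatorname{Im}\tau\neq0$ define the (conditionally convergent) lattice sum $$T_2(\tau)=\operatorname{Im}\tau\ \sum^{e}_{(m,n)\in\mathbb{Z}^2\setminus\{(0,0)\}}\frac{m+n\overline{\tau}}{(m+n\tau)^3},$$ where $\sum^{e}$ denotes Eisenstein summation, $$\sum^{e}_{m,n}:=\lim_{M_2\to\infty}\sum_{n=-M_2}^{M_2}\left(\lim_{M_1\to\infty}\sum_{m=-M_1}^{M_1}\right),$$ the term $(m,n)=(0,0)$ being omitted. The complete elliptic integrals of the first and second kind with modulus $k\in(0,1)$ are $$K(k)=\int_0^1\frac{dt}{\sqrt{(1-t^2)(1-k^2t^2)}},\qquad E(k)=\int_0^1\sqrt{\frac{1-k^2t^2}{1-t^2}}\,dt.$$ The map $k\mapsto K(k')/K(k)$, with $k'=\sqrt{1-k^2}$, is a decreasing bijection from $(0,1)$ onto $(0,\infty)$. *)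

theory Defs
  imports "HOL-Analysis.Analysis"
begin

definition eisenstein_sum :: "(int \<Rightarrow> int \<Rightarrow> complex) \<Rightarrow> complex" where
  "eisenstein_sum f =
     lim (\<lambda>M2::nat. \<Sum>n = - int M2..int M2. lim (\<lambda>M1::nat. \<Sum>m = - int M1..int M1. f m n))"

definition T2 :: "complex \<Rightarrow> complex" where
  "T2 \<tau> = of_real (Im \<tau>) *
     eisenstein_sum (\<lambda>m n. if (m, n) = (0, 0) then 0
        else (of_int m + of_int n * cnj \<tau>) / (of_int m + of_int n * \<tau>) ^ 3)"

text \<open>For \<open>0 < k < 1\<close> both integrands below are nonnegative and integrable on \<open>[0,1]\<close>, so the
  Henstock--Kurzweil integral agrees with the improper one. The value at the singular
  endpoint \<open>t = 1\<close> is \<open>0\<close>, by division by zero, and does not matter.\<close>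

definition elliptic_K :: "real \<Rightarrow> real" where
  "elliptic_K k = integral {0..1} (\<lambda>t. 1 / sqrt ((1 - t\<^sup>2) * (1 - k\<^sup>2 * t\<^sup>2)))"

definition elliptic_E :: "real \<Rightarrow> real" where
  "elliptic_E k = integral {0..1} (\<lambda>t. sqrt ((1 - k\<^sup>2 * t\<^sup>2) / (1 - t\<^sup>2)))"

end

theory Submission
  imports Defs "HOL-Complex_Analysis.Complex_Analysis"
begin

text \<open>
  Since \<open>m + n \<tau>\<^sup>* = (m + n \<tau>) - 2 \<i> n Im \<tau>\<close>, on the imaginary axis \<open>T2\<close> equals \<open>x d(x G)/dx\<close> with
  \<open>G x = G\<^sub>2(\<i>x)\<close>, and the inner sums turn \<open>G\<close> into the hyperbolic lattice sum
  \<open>\<pi>\<^sup>2/3 - \<pi>\<^sup>2 \<Sum> 1/sinh\<^sup>2 (n a)\<close>, \<open>a = \<pi>x\<close> (for \<open>(\<plusminus>1 + \<i>x)/2\<close> the sum of \<open>1/cosh\<^sup>2 ((n + 1/2) a)\<close> is added).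

  To evaluate these sums put \<open>H z = \<Sum> 1/sinh (z + n a)\<close>. The partial fraction
  \<open>1/(sinh u sinh v) = (coth u - coth v)/sinh (v - u)\<close> and telescoping give \<open>H\<^sup>2 = \<Sum> 1/sinh\<^sup>2 (z + n a) - C\<close>
  and \<open>H'\<^sup>2 = (H\<^sup>2 + al\<^sup>2) (H\<^sup>2 + ga\<^sup>2)\<close>. Inverting this equation along the segments \<open>(0, a/2]\<close> and
  \<open>[a/2, a/2 + \<i>\<pi>/2]\<close> yields \<open>K(k') = al a/2\<close>, \<open>K(k) = al \<pi>/2\<close> and \<open>E(k)\<close> for \<open>k = ga/al\<close>, hence all
  sums in terms of \<open>K\<close>, \<open>E\<close>, \<open>k\<close>. The derivative follows from the chain rule and
  \<open>d(K(k')/K(k))/dk = - \<pi>/(2 k (1 - k\<^sup>2) K(k)\<^sup>2)\<close>, a form of the Legendre relation.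
\<close>

section \<open>Complete elliptic integrals and the Legendre relation\<close>

text \<open>A derivative in x appears because d/dx of (m + n i x)^-2 is -2 i n (m + n i x)^-3, the
  very factor left over when the numerator is split; summing over m first leaves terms that decay
  exponentially in n. The differential equation fixes H' only up to sign, so most of the work on the
  two segments goes into signs. On the real one every term of the series of H' is negative. On the
  vertical one both the sign and the order ga < al are forced by the equation itself. The vertical
  segment also carries the integral of the second kind: H is bounded there, and H^2 + C has a
  primitive that vanishes at both ends. The sums of squares at three special points are three
  unknowns, and al^2, ga^2 and E(k) give three relations for them; the remaining sum of 1/sinh^2 (n
  a) follows by duplication. The modulus ga/al is matched with the given k only afterwards, by
  injectivity of K(k')/K(k).\<close>

lemma integral_substitution_unit_interval:
  fixes \<phi> \<phi>' f G :: "real \<Rightarrow> real"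
  assumes cd: "c < d" and cont: "continuous_on {c..d} \<phi>"
    and der: "\<And>x. c < x \<Longrightarrow> x < d \<Longrightarrow> (\<phi> has_real_derivative \<phi>' x) (at x)"
    and pos: "\<And>x. c < x \<Longrightarrow> x < d \<Longrightarrow> \<phi>' x > 0"
    and ends: "\<phi> c = 0" "\<phi> d = 1"
    and G: "continuous_on {c..d} G" "\<And>x. c < x \<Longrightarrow> x < d \<Longrightarrow> \<phi>' x * f (\<phi> x) = G x"
    and G_nonneg: "\<And>x. c < x \<Longrightarrow> x < d \<Longrightarrow> 0 \<le> G x"
  shows "integral {0..1} f = integral {c..d} G"
proof -
  have mono: "\<phi> x < \<phi> y" if "c \<le> x" "x < y" "y \<le> d" for x y
  proof (rule DERIV_pos_imp_increasing_open[OF that(2)])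
    show "\<exists>D. DERIV \<phi> z :> D \<and> 0 < D" if "x < z" "z < y" for z
      using that \<open>c \<le> x\<close> \<open>y \<le> d\<close> der[of z] pos[of z] by (intro exI[of _ "\<phi>' z"]) auto
    show "continuous_on {x..y} \<phi>"
      by (rule continuous_on_subset[OF cont]) (use that in auto)
  qed
  have img: "\<phi> ` {c<..<d} = {0<..<1}"
  proof (intro equalityI subsetI)
    fix y assume "y \<in> \<phi> ` {c<..<d}"
    then obtain x where x: "c < x" "x < d" "y = \<phi> x" by auto
    then show "y \<in> {0<..<1}" using mono[of c x] mono[of x d] ends cd by auto
  next
    fix y :: real assume y: "y \<in> {0<..<1}"
    obtain x where x: "c \<le> x" "x \<le> d" "\<phi> x = y"
      using IVT'[of \<phi> c y d] ends cd y cont by auto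
    then have "x \<noteq> c" "x \<noteq> d" using ends y by auto
    then show "y \<in> \<phi> ` {c<..<d}" using x by auto
  qed
  have inj: "inj_on \<phi> {c<..<d}"
  proof (rule inj_onI)
    fix x y assume "x \<in> {c<..<d}" "y \<in> {c<..<d}" "\<phi> x = \<phi> y"
    then show "x = y" using mono[of x y] mono[of y x] by (cases x y rule: linorder_cases) auto
  qed
  \<comment> \<open>\<open>f\<close> may blow up at an end of the unit interval. Absolute
    integrability is therefore taken from the continuous pull-back \<open>G\<close>, and the change
    of variables is made between open intervals; the end points are null.\<close>
  have Gint: "G absolutely_integrable_on {c..d}"
    by (rule absolutely_integrable_continuous_real) (rule G)
  have Gint': "G absolutely_integrable_on {c<..<d}"
    by (rule set_integrable_subset[OF Gint]) auto
  have Gcong: "\<bar>\<phi>' x\<bar> * f (\<phi> x) = G x" if "x \<in> {c<..<d}" for x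
    using that G(2)[of x] pos[of x] by auto
  have "(\<lambda>x. \<bar>\<phi>' x\<bar> * f (\<phi> x)) absolutely_integrable_on {c<..<d} \<and>
      integral {c<..<d} (\<lambda>x. \<bar>\<phi>' x\<bar> * f (\<phi> x)) = integral {c<..<d} G"
  proof
    show "(\<lambda>x. \<bar>\<phi>' x\<bar> * f (\<phi> x)) absolutely_integrable_on {c<..<d}"
      using Gint' by (subst set_integrable_cong[OF refl refl Gcong]) auto
    show "integral {c<..<d} (\<lambda>x. \<bar>\<phi>' x\<bar> * f (\<phi> x)) = integral {c<..<d} G"
      by (rule integral_cong) (rule Gcong)
  qed
  moreover have "(\<phi> has_real_derivative \<phi>' x) (at x within {c<..<d})" if "x \<in> {c<..<d}" for x
    by (rule has_field_derivative_at_within[OF der]) (use that in auto)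
  ultimately have "integral (\<phi> ` {c<..<d}) f = integral {c<..<d} G"
    using has_absolute_integral_change_of_variables_1'[of "{c<..<d}" \<phi> \<phi>' f "integral {c<..<d} G", OF _ _ inj]
    by auto
  then show ?thesis
    by (simp add: img integral_open_interval_real)
qed

abbreviation \<Delta> :: "real \<Rightarrow> real \<Rightarrow> real" where
  "\<Delta> k \<theta> \<equiv> sqrt (1 - k\<^sup>2 * (sin \<theta>)\<^sup>2)"

lemma Delta_sq_pos: "0 < 1 - k\<^sup>2 * (sin \<theta>)\<^sup>2" if "0 < k" "k < 1" for k \<theta> :: real
proof -
  have "k\<^sup>2 * (sin \<theta>)\<^sup>2 \<le> k\<^sup>2 * 1"
    by (intro mult_left_mono) (auto simp: abs_square_le_1)
  also have "\<dots> < 1" using that by (simp add: power_less_one_iff abs_square_less_1)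
  finally show ?thesis by simp
qed

lemma Delta_pos: "0 < \<Delta> k \<theta>" if "0 < k" "k < 1"
  using Delta_sq_pos[OF that] by simp

text \<open>The substitution t = sin \<theta> removes the singularity at t = 1 and leaves an
  integrand that is smooth in the modulus, ready for differentiation under the integral
  sign.\<close>

lemma elliptic_K_trig:
  assumes "0 < k" "k < 1"
  shows "elliptic_K k = integral {0..pi/2} (\<lambda>\<theta>. 1 / \<Delta> k \<theta>)"
  unfolding elliptic_K_def
proof (rule integral_substitution_unit_interval[where \<phi> = sin and \<phi>' = cos])
  show "continuous_on {0..pi/2} (\<lambda>\<theta>. 1 / \<Delta> k \<theta>)"
    using Delta_pos[OF assms] by (intro continuous_intros) (auto simp: less_le)
  fix x :: real assume x: "0 < x" "x < pi/2"
  show c: "0 < cos x" using x by (intro cos_gt_zero_pi) auto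
  have "1 - (sin x)\<^sup>2 = (cos x)\<^sup>2" by (simp add: cos_squared_eq)
  then show "cos x * (1 / sqrt ((1 - (sin x)\<^sup>2) * (1 - k\<^sup>2 * (sin x)\<^sup>2))) = 1 / \<Delta> k x"
    using c by (simp add: real_sqrt_mult)
  show "0 \<le> 1 / \<Delta> k x" using Delta_pos[OF assms, of x] by simp
qed (auto intro!: continuous_intros derivative_eq_intros)

lemma elliptic_E_trig:
  assumes "0 < k" "k < 1"
  shows "elliptic_E k = integral {0..pi/2} (\<Delta> k)"
  unfolding elliptic_E_def
proof (rule integral_substitution_unit_interval[where \<phi> = sin and \<phi>' = cos])
  show "continuous_on {0..pi/2} (\<Delta> k)"
    by (intro continuous_intros)
  fix x :: real assume x: "0 < x" "x < pi/2"
  show c: "0 < cos x" using x by (intro cos_gt_zero_pi) auto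
  have "1 - (sin x)\<^sup>2 = (cos x)\<^sup>2" by (simp add: cos_squared_eq)
  then show "cos x * sqrt ((1 - k\<^sup>2 * (sin x)\<^sup>2) / (1 - (sin x)\<^sup>2)) = \<Delta> k x"
    using c by (simp add: real_sqrt_divide)
  show "0 \<le> \<Delta> k x" using Delta_pos[OF assms, of x] by simp
qed (auto intro!: continuous_intros derivative_eq_intros)

lemma continuous_on_Delta_powers:
  assumes "U \<subseteq> {0<..<1}"
  shows "continuous_on (U \<times> cbox 0 (pi/2)) (\<lambda>(x, t). x * (sin t)\<^sup>2 / \<Delta> x t ^ n)"
proof -
  have "\<Delta> (fst p) (snd p) \<noteq> 0" if "p \<in> U \<times> cbox 0 (pi/2)" for p
    using that assms Delta_pos[of "fst p" "snd p"] by (auto simp: less_le)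
  then show ?thesis
    unfolding case_prod_beta by (intro continuous_intros) auto
qed

lemma Delta_has_derivative:
  assumes "0 < k" "k < 1"
  shows "((\<lambda>k. \<Delta> k t) has_real_derivative - (k * (sin t)\<^sup>2 / \<Delta> k t)) (at k)"
proof -
  have "((\<lambda>k. 1 - k\<^sup>2 * (sin t)\<^sup>2) has_real_derivative - (2 * k * (sin t)\<^sup>2)) (at k)"
  proof -
    have "((\<lambda>k. k\<^sup>2) has_real_derivative 2 * k) (at k)"
      using DERIV_pow[of 2 k UNIV] by simp
    from DERIV_diff[OF DERIV_const[of 1] DERIV_cmult_right[OF this, of "(sin t)\<^sup>2"]]
    show ?thesis by simp
  qed
  from DERIV_chain2[OF DERIV_real_sqrt[OF Delta_sq_pos[OF assms, of t]] this]
  show ?thesis by (rule DERIV_cong) (use Delta_pos[OF assms, of t] in \<open>simp only: divide_inverse, simp\<close>)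
qed

lemma continuous_on_Delta_inverse:
  assumes "0 < k" "k < 1"
  shows "continuous_on A (\<lambda>\<theta>. 1 / \<Delta> k \<theta> ^ n)"
proof (rule continuous_on_divide[OF continuous_on_const continuous_on_power])
  show "continuous_on A (\<Delta> k)" by (intro continuous_intros)
  show "\<forall>\<theta>\<in>A. \<Delta> k \<theta> ^ n \<noteq> 0" using Delta_pos[OF assms] by (metis less_irrefl power_not_zero)
qed

text \<open>The function k^2 sin cos / \<Delta> vanishes at both 0 and pi/2, and its derivative is
  \<Delta> - (1 - k^2)/\<Delta>^3.\<close>

lemma integral_Delta_cubed:
  assumes "0 < k" "k < 1"
  shows "integral {0..pi/2} (\<lambda>\<theta>. 1 / \<Delta> k \<theta> ^ 3) = elliptic_E k / (1 - k\<^sup>2)"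
proof -
  define F where "F = (\<lambda>\<theta>. k\<^sup>2 * (sin \<theta> * cos \<theta> / \<Delta> k \<theta>))"
  have "((\<lambda>\<theta>. \<Delta> k \<theta> - (1 - k\<^sup>2) * (1 / \<Delta> k \<theta> ^ 3)) has_integral F (pi/2) - F 0) {0..pi/2}"
  proof (rule fundamental_theorem_of_calculus)
    fix x
    define D where "D = \<Delta> k x"
    have D: "D > 0" "D\<^sup>2 = 1 - k\<^sup>2 * (sin x)\<^sup>2"
      using Delta_pos[OF assms, of x] Delta_sq_pos[OF assms, of x] by (auto simp: D_def)
    have s: "k\<^sup>2 * (sin x)\<^sup>2 = 1 - D\<^sup>2" and c: "k\<^sup>2 * (cos x)\<^sup>2 = k\<^sup>2 - (1 - D\<^sup>2)"
      using D by (simp_all add: cos_squared_eq algebra_simps)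
    have dD: "(\<Delta> k has_real_derivative - (k\<^sup>2 * sin x * cos x / D)) (at x)"
      using Delta_sq_pos[OF assms, of x] unfolding D_def
      by (auto intro!: derivative_eq_intros simp: divide_simps)
    have "(F has_real_derivative
        k\<^sup>2 * (((cos x * cos x - sin x * sin x) * D - sin x * cos x * (- (k\<^sup>2 * sin x * cos x / D))) / (D * D))) (at x)"
    proof -
      have sc: "((\<lambda>\<theta>. sin \<theta> * cos \<theta>) has_real_derivative cos x * cos x - sin x * sin x) (at x)"
        by (auto intro!: derivative_eq_intros)
      show ?thesis
        using DERIV_cmult[OF DERIV_divide[OF sc dD], of "k\<^sup>2"] D(1) unfolding F_def D_def by simp
    qed
    also have "k\<^sup>2 * (((cos x * cos x - sin x * sin x) * D - sin x * cos x * (- (k\<^sup>2 * sin x * cos x / D))) / (D * D))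
      = ((k\<^sup>2 * (cos x)\<^sup>2 - k\<^sup>2 * (sin x)\<^sup>2) * D\<^sup>2 + (k\<^sup>2 * (sin x)\<^sup>2) * (k\<^sup>2 * (cos x)\<^sup>2)) / D ^ 3"
      using D(1) by (simp add: field_simps power2_eq_square power3_eq_cube)
    also have "\<dots> = D - (1 - k\<^sup>2) * (1 / D ^ 3)"
      unfolding s c using D(1) by (simp add: field_simps power2_eq_square power3_eq_cube)
    finally show "(F has_vector_derivative (\<Delta> k x - (1 - k\<^sup>2) * (1 / \<Delta> k x ^ 3))) (at x within {0..pi/2})"
      by (simp add: D_def has_real_derivative_iff_has_vector_derivative has_vector_derivative_at_within)
  qed simp
  then have 1: "integral {0..pi/2} (\<lambda>\<theta>. \<Delta> k \<theta> - (1 - k\<^sup>2) * (1 / \<Delta> k \<theta> ^ 3)) = 0"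
    by (simp add: F_def integral_unique)
  have i1: "\<Delta> k integrable_on {0..pi/2}" by (intro integrable_continuous_real continuous_intros)
  have i2: "(\<lambda>\<theta>. 1 / \<Delta> k \<theta> ^ 3) integrable_on {0..pi/2}"
    by (intro integrable_continuous_real continuous_on_Delta_inverse assms)
  have "integral {0..pi/2} (\<lambda>\<theta>. \<Delta> k \<theta> - (1 - k\<^sup>2) * (1 / \<Delta> k \<theta> ^ 3))
     = integral {0..pi/2} (\<Delta> k) - (1 - k\<^sup>2) * integral {0..pi/2} (\<lambda>\<theta>. 1 / \<Delta> k \<theta> ^ 3)"
    by (intro integral_unique has_integral_diff has_integral_mult_right integrable_integral i1 i2)
  moreover have "1 - k\<^sup>2 > 0" using assms by (simp add: abs_square_less_1)
  ultimately show ?thesis using 1 elliptic_E_trig[OF assms] by (simp add: field_simps)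
qed

text \<open>Since k^2 sin^2 = 1 - \<Delta>^2, the differentiated integrand splits into multiples of
  1/\<Delta>^3 and 1/\<Delta>, whose integrals are E/(1 - k^2) and K.\<close>

lemma elliptic_K_has_derivative:
  assumes "0 < k" "k < 1"
  shows "(elliptic_K has_real_derivative
    (elliptic_E k - (1 - k\<^sup>2) * elliptic_K k) / (k * (1 - k\<^sup>2))) (at k)"
proof -
  have "((\<lambda>k. integral (cbox 0 (pi/2)) (\<lambda>t. 1 / \<Delta> k t)) has_real_derivative
      integral (cbox 0 (pi/2)) (\<lambda>t. k * (sin t)\<^sup>2 / \<Delta> k t ^ 3)) (at k within {0<..<1})"
  proof (rule leibniz_rule_field_derivative)
    fix x t :: real assume "x \<in> {0<..<1}"
    then have x: "0 < x" "x < 1" by auto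
    show "((\<lambda>x. 1 / \<Delta> x t) has_real_derivative (x * (sin t)\<^sup>2 / \<Delta> x t ^ 3)) (at x within {0<..<1})"
      using Delta_pos[OF x, of t]
      by (auto intro!: derivative_eq_intros Delta_has_derivative[OF x, THEN has_field_derivative_at_within] simp: field_simps power3_eq_cube)
  next
    fix x :: real assume "x \<in> {0<..<1}"
    then show "(\<lambda>t. 1 / \<Delta> x t) integrable_on cbox 0 (pi/2)"
      using continuous_on_Delta_inverse[of x _ 1] by (intro integrable_continuous) auto
  qed (use assms continuous_on_Delta_powers in auto)
  then have 1: "((\<lambda>k. integral {0..pi/2} (\<lambda>t. 1 / \<Delta> k t)) has_real_derivative
      integral {0..pi/2} (\<lambda>t. k * (sin t)\<^sup>2 / \<Delta> k t ^ 3)) (at k)"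
    using assms by (simp add: at_within_open[of k "{0<..<1}"])
  have i1: "(\<lambda>t. 1 / \<Delta> k t ^ 3) integrable_on {0..pi/2}" "(\<lambda>t. 1 / \<Delta> k t) integrable_on {0..pi/2}"
    using continuous_on_Delta_inverse[OF assms, of _ 1]
    by (auto intro!: integrable_continuous_real continuous_on_Delta_inverse assms)
  have "integral {0..pi/2} (\<lambda>t. k * (sin t)\<^sup>2 / \<Delta> k t ^ 3)
      = integral {0..pi/2} (\<lambda>t. (1 / \<Delta> k t ^ 3 - 1 / \<Delta> k t) * (1 / k))"
  proof (rule integral_cong)
    fix t :: real
    define D where "D = \<Delta> k t"
    have D: "D > 0" "D\<^sup>2 = 1 - k\<^sup>2 * (sin t)\<^sup>2"
      using Delta_pos[OF assms, of t] Delta_sq_pos[OF assms, of t] by (auto simp: D_def)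
    have "k * (sin t)\<^sup>2 = (1 - D\<^sup>2) / k" using D assms by (simp add: power2_eq_square)
    then have "k * (sin t)\<^sup>2 / D ^ 3 = (1 / D ^ 3 - 1 / D) * (1 / k)"
      using D(1) assms by (simp add: field_simps power2_eq_square power3_eq_cube)
    then show "k * (sin t)\<^sup>2 / \<Delta> k t ^ 3 = (1 / \<Delta> k t ^ 3 - 1 / \<Delta> k t) * (1 / k)"
      by (simp add: D_def)
  qed
  also have "\<dots> = (elliptic_E k / (1 - k\<^sup>2) - elliptic_K k) * (1 / k)"
    unfolding integral_mult_left by (subst integral_diff[OF i1])
       (simp add: integral_Delta_cubed[OF assms] elliptic_K_trig[OF assms])
  also have "\<dots> = (elliptic_E k - (1 - k\<^sup>2) * elliptic_K k) / (k * (1 - k\<^sup>2))"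
  proof -
    have "1 - k\<^sup>2 > 0" using assms by (simp add: abs_square_less_1)
    then show ?thesis using assms by (simp add: field_simps)
  qed
  finally have 2: "((\<lambda>k. integral {0..pi/2} (\<lambda>t. 1 / \<Delta> k t)) has_real_derivative
    (elliptic_E k - (1 - k\<^sup>2) * elliptic_K k) / (k * (1 - k\<^sup>2))) (at k)" using 1 by simp
  show ?thesis
    by (rule has_field_derivative_transform_within_open[OF 2, of "{0<..<1}"])
      (use assms elliptic_K_trig in auto)
qed

lemma elliptic_E_has_derivative:
  assumes "0 < k" "k < 1"
  shows "(elliptic_E has_real_derivative (elliptic_E k - elliptic_K k) / k) (at k)"
proof -
  have "((\<lambda>k. integral (cbox 0 (pi/2)) (\<Delta> k)) has_real_derivative
      integral (cbox 0 (pi/2)) (\<lambda>t. - (k * (sin t)\<^sup>2 / \<Delta> k t ^ 1))) (at k within {0<..<1})"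
  proof (rule leibniz_rule_field_derivative)
    fix x t :: real assume "x \<in> {0<..<1}"
    then have x: "0 < x" "x < 1" by auto
    show "((\<lambda>x. \<Delta> x t) has_real_derivative - (x * (sin t)\<^sup>2 / \<Delta> x t ^ 1)) (at x within {0<..<1})"
      using Delta_has_derivative[OF x, of t, THEN has_field_derivative_at_within] by simp
  next
    show "continuous_on ({0<..<1} \<times> cbox 0 (pi/2)) (\<lambda>(x, t). - (x * (sin t)\<^sup>2 / \<Delta> x t ^ 1))"
      using continuous_on_minus[OF continuous_on_Delta_powers[of "{0<..<1}" 1]]
      by (simp add: case_prod_beta)
  next
    fix x :: real
    show "(\<Delta> x) integrable_on cbox 0 (pi/2)"
      by (intro integrable_continuous continuous_intros)
  qed (use assms in auto)
  then have 1: "((\<lambda>k. integral {0..pi/2} (\<Delta> k)) has_real_derivative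
      integral {0..pi/2} (\<lambda>t. - (k * (sin t)\<^sup>2 / \<Delta> k t))) (at k)"
    using assms by (simp add: at_within_open[of k "{0<..<1}"])
  have i1: "\<Delta> k integrable_on {0..pi/2}" "(\<lambda>t. 1 / \<Delta> k t) integrable_on {0..pi/2}"
    using continuous_on_Delta_inverse[OF assms, of _ 1]
    by (intro integrable_continuous_real continuous_intros, intro integrable_continuous_real) simp
  have "integral {0..pi/2} (\<lambda>t. - (k * (sin t)\<^sup>2 / \<Delta> k t))
      = integral {0..pi/2} (\<lambda>t. (\<Delta> k t - 1 / \<Delta> k t) * (1 / k))"
  proof (rule integral_cong)
    fix t :: real
    define D where "D = \<Delta> k t"
    have D: "D > 0" "D\<^sup>2 = 1 - k\<^sup>2 * (sin t)\<^sup>2"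
      using Delta_pos[OF assms, of t] Delta_sq_pos[OF assms, of t] by (auto simp: D_def)
    have "k * (sin t)\<^sup>2 = (1 - D\<^sup>2) / k" using D assms by (simp add: power2_eq_square)
    then have "- (k * (sin t)\<^sup>2 / D) = (D - 1 / D) * (1 / k)"
      using D(1) assms by (simp add: field_simps power2_eq_square)
    then show "- (k * (sin t)\<^sup>2 / \<Delta> k t) = (\<Delta> k t - 1 / \<Delta> k t) * (1 / k)"
      by (simp add: D_def)
  qed
  also have "\<dots> = (elliptic_E k - elliptic_K k) * (1 / k)"
    unfolding integral_mult_left by (subst integral_diff[OF i1])
       (simp add: elliptic_E_trig[OF assms] elliptic_K_trig[OF assms])
  finally have 2: "((\<lambda>k. integral {0..pi/2} (\<Delta> k)) has_real_derivative
    (elliptic_E k - elliptic_K k) / k) (at k)" using 1 by simp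
  show ?thesis
    by (rule has_field_derivative_transform_within_open[OF 2, of "{0<..<1}"])
      (use assms elliptic_E_trig in auto)
qed

lemma complementary_modulus:
  fixes k :: real
  assumes "0 < k" "k < 1"
  shows "0 < sqrt (1 - k\<^sup>2)" "sqrt (1 - k\<^sup>2) < 1" "(sqrt (1 - k\<^sup>2))\<^sup>2 = 1 - k\<^sup>2"
    "sqrt (1 - (sqrt (1 - k\<^sup>2))\<^sup>2) = k"
proof -
  have "k\<^sup>2 < 1" using assms by (simp add: abs_square_less_1)
  then show "0 < sqrt (1 - k\<^sup>2)" "sqrt (1 - k\<^sup>2) < 1" "(sqrt (1 - k\<^sup>2))\<^sup>2 = 1 - k\<^sup>2"
    "sqrt (1 - (sqrt (1 - k\<^sup>2))\<^sup>2) = k"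
    using assms by auto
qed

lemma complementary_modulus_has_derivative:
  fixes k :: real
  assumes "0 < k" "k < 1"
  shows "((\<lambda>k. sqrt (1 - k\<^sup>2)) has_real_derivative - (k / sqrt (1 - k\<^sup>2))) (at k)"
  using complementary_modulus[OF assms] assms
  by (auto intro!: derivative_eq_intros simp: divide_simps)

lemma elliptic_K_complementary_has_derivative:
  assumes "0 < k" "k < 1" and k': "k' = sqrt (1 - k\<^sup>2)"
  shows "((\<lambda>k. elliptic_K (sqrt (1 - k\<^sup>2))) has_real_derivative
    - (elliptic_E k' - k\<^sup>2 * elliptic_K k') / (k * (1 - k\<^sup>2))) (at k)"
proof -
  note c = complementary_modulus[OF assms(1,2), folded k']
  have "(elliptic_K has_real_derivative (elliptic_E k' - k\<^sup>2 * elliptic_K k') / (k' * k\<^sup>2)) (at k')"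
    using elliptic_K_has_derivative[OF c(1,2)] c(3) by simp
  from DERIV_chain'[OF complementary_modulus_has_derivative[OF assms(1,2)], of elliptic_K, folded k', OF this]
  show ?thesis
  proof (rule DERIV_cong)
    have eq: "1 - k\<^sup>2 = k' * k'" using c(3) by (simp add: power2_eq_square)
    show "(elliptic_E k' - k\<^sup>2 * elliptic_K k') / (k' * k\<^sup>2) * - (k / k') = - (elliptic_E k' - k\<^sup>2 * elliptic_K k') / (k * (1 - k\<^sup>2))" using c(1) assms(1)
      unfolding eq by (simp add: field_simps power2_eq_square)
  qed
qed

lemma elliptic_E_complementary_has_derivative:
  assumes "0 < k" "k < 1" and k': "k' = sqrt (1 - k\<^sup>2)"
  shows "((\<lambda>k. elliptic_E (sqrt (1 - k\<^sup>2))) has_real_derivative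
    - (elliptic_E k' - elliptic_K k') * k / (1 - k\<^sup>2)) (at k)"
proof -
  note c = complementary_modulus[OF assms(1,2), folded k']
  from DERIV_chain'[OF complementary_modulus_has_derivative[OF assms(1,2)], of elliptic_E, folded k',
     OF elliptic_E_has_derivative[OF c(1,2)]]
  show ?thesis
  proof (rule DERIV_cong)
    have eq: "1 - k\<^sup>2 = k' * k'" using c(3) by (simp add: power2_eq_square)
    show "(elliptic_E k' - elliptic_K k') / k' * - (k / k') = - (elliptic_E k' - elliptic_K k') * k / (1 - k\<^sup>2)" using c(1) assms(1)
      unfolding eq by (simp add: field_simps power2_eq_square)
  qed
qed

text \<open>These come from k' \<le> \<Delta> \<le> 1 and |cos| \<le> \<Delta> \<le> |cos| + k'
  under the integral. They are made for the limit k -> 0 in the Legendre relation: K(k') is bounded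
  there only by a multiple of 1/k, which K - E = O(k^2) compensates.\<close>

lemma elliptic_bounds:
  assumes "0 < k" "k < 1" and k': "k' = sqrt (1 - k\<^sup>2)"
  shows "pi / 2 \<le> elliptic_K k" "elliptic_K k \<le> pi / 2 / k'"
    "0 \<le> elliptic_K k - elliptic_E k" "elliptic_K k - elliptic_E k \<le> k\<^sup>2 * (pi / 2 / k')"
    "1 \<le> elliptic_E k" "elliptic_E k \<le> 1 + k' * (pi / 2)"
proof -
  note c = complementary_modulus[OF assms(1,2), folded k']
  note K = elliptic_K_trig[OF assms(1,2)] and E = elliptic_E_trig[OF assms(1,2)]
  have iK: "(\<lambda>t. 1 / \<Delta> k t) integrable_on {0..pi/2}"
    using continuous_on_Delta_inverse[OF assms(1,2), of _ 1] by (intro integrable_continuous_real) auto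
  have iE: "\<Delta> k integrable_on {0..pi/2}" by (intro integrable_continuous_real continuous_intros)
  have D1: "\<Delta> k t \<le> 1" for t by simp
  have D2: "k' \<le> \<Delta> k t" for t
  proof -
    have "k\<^sup>2 * (sin t)\<^sup>2 \<le> k\<^sup>2 * 1" by (intro mult_left_mono) (auto simp: abs_square_le_1)
    then show ?thesis unfolding k' by (intro real_sqrt_le_mono) simp
  qed
  have D3: "\<bar>cos t\<bar> \<le> \<Delta> k t" for t
  proof -
    have "k\<^sup>2 * (sin t)\<^sup>2 \<le> 1 * (sin t)\<^sup>2"
      using assms by (intro mult_right_mono) (auto simp: abs_square_le_1)
    then have "(cos t)\<^sup>2 \<le> 1 - k\<^sup>2 * (sin t)\<^sup>2" by (simp add: cos_squared_eq)
    from real_sqrt_le_mono[OF this] show ?thesis by simp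
  qed
  have D4: "\<Delta> k t \<le> \<bar>cos t\<bar> + k'" for t
  proof -
    have "1 - k\<^sup>2 * (sin t)\<^sup>2 = (cos t)\<^sup>2 + k'\<^sup>2 * (sin t)\<^sup>2"
      unfolding c(3) by (simp add: cos_squared_eq algebra_simps)
    also have "\<dots> \<le> (cos t)\<^sup>2 + k'\<^sup>2 * 1" by (intro add_left_mono mult_left_mono) (auto simp: abs_square_le_1)
    also have "\<dots> \<le> (\<bar>cos t\<bar> + k')\<^sup>2" using c(1) by (simp add: power2_sum)
    finally have "\<Delta> k t \<le> sqrt ((\<bar>cos t\<bar> + k')\<^sup>2)" by (rule real_sqrt_le_mono)
    also have "\<dots> = \<bar>cos t\<bar> + k'" using c(1) by simp
    finally show ?thesis .
  qed
  have const: "integral {0..pi/2} (\<lambda>_. r) = r * (pi/2)" for r :: real by simp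
  have Dp: "0 < \<Delta> k t" for t by (rule Delta_pos[OF assms(1,2)])
  have "integral {0..pi/2} (\<lambda>_. 1) \<le> elliptic_K k"
    unfolding K by (rule integral_le) (use iK Dp D1 in \<open>auto simp: divide_simps\<close>)
  then show "pi / 2 \<le> elliptic_K k" by simp
  have "elliptic_K k \<le> integral {0..pi/2} (\<lambda>_. 1 / k')"
    unfolding K by (rule integral_le) (use iK Dp D2 c(1) in \<open>auto intro!: frac_le\<close>)
  then show "elliptic_K k \<le> pi / 2 / k'" by simp
  have diff: "elliptic_K k - elliptic_E k = integral {0..pi/2} (\<lambda>t. 1 / \<Delta> k t - \<Delta> k t)"
    unfolding K E by (subst integral_diff[OF iK iE]) simp
  have eq: "1 / \<Delta> k t - \<Delta> k t = k\<^sup>2 * (sin t)\<^sup>2 / \<Delta> k t" for t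
  proof -
    have "(\<Delta> k t)\<^sup>2 = 1 - k\<^sup>2 * (sin t)\<^sup>2" using Delta_sq_pos[OF assms(1,2), of t] by simp
    then show ?thesis using Dp[of t] by (simp add: divide_simps power2_eq_square del: real_sqrt_mult_self)
  qed
  have i3: "(\<lambda>t. 1 / \<Delta> k t - \<Delta> k t) integrable_on {0..pi/2}" by (rule integrable_diff[OF iK iE])
  show "0 \<le> elliptic_K k - elliptic_E k"
    unfolding diff using Dp by (intro integral_nonneg i3) (auto simp: eq less_imp_le)
  have ic: "(\<lambda>_. k\<^sup>2 / k') integrable_on {0..pi/2}"
    by (rule integrable_continuous_real, rule continuous_on_const)
  have "elliptic_K k - elliptic_E k \<le> integral {0..pi/2} (\<lambda>_. k\<^sup>2 / k')"
    unfolding diff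
  proof (rule integral_le[OF i3 ic])
    fix t :: real
    have "k\<^sup>2 * (sin t)\<^sup>2 \<le> k\<^sup>2 * 1" by (intro mult_left_mono) (auto simp: abs_square_le_1)
    then show "1 / \<Delta> k t - \<Delta> k t \<le> k\<^sup>2 / k'" unfolding eq using D2 c(1) by (intro frac_le) auto
  qed
  then show "elliptic_K k - elliptic_E k \<le> k\<^sup>2 * (pi / 2 / k')" by (simp add: mult.commute)
  have cosint: "(cos has_integral (sin (pi/2) - sin 0)) {0..pi/2}"
    by (rule fundamental_theorem_of_calculus)
      (auto intro!: derivative_eq_intros simp flip: has_real_derivative_iff_has_vector_derivative)
  have "integral {0..pi/2} cos \<le> elliptic_E k" unfolding E
  proof (rule integral_le)
    show "cos x \<le> \<Delta> k x" for x using D3[of x] by linarith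
  qed (use cosint iE in auto)
  then show "1 \<le> elliptic_E k" using integral_unique[OF cosint] by simp
  have "elliptic_E k \<le> integral {0..pi/2} (\<lambda>t. cos t + k')" unfolding E
  proof (rule integral_le)
    show "\<Delta> k x \<le> cos x + k'" if "x \<in> {0..pi/2}" for x
      using D4[of x] cos_ge_zero[of x] that by auto
  qed (use cosint iE in \<open>auto intro!: integrable_add\<close>)
  also have "\<dots> = 1 + k' * (pi / 2)"
    using integral_unique[OF cosint] cosint by (subst integral_add) auto
  finally show "elliptic_E k \<le> 1 + k' * (pi / 2)" .
qed

text \<open>The four derivative formulas make the combination constant on (0, 1); its value is the
  limit at 0 from the right.\<close>

lemma legendre_relation:
  assumes "0 < k" "k < 1" and k': "k' = sqrt (1 - k\<^sup>2)"
  shows "elliptic_E k * elliptic_K k' + elliptic_E k' * elliptic_K k - elliptic_K k * elliptic_K k' = pi / 2"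
proof -
  define L where "L = (\<lambda>k. let k' = sqrt (1 - k\<^sup>2) in
    elliptic_E k * elliptic_K k' + elliptic_E k' * elliptic_K k - elliptic_K k * elliptic_K k')"
  have der: "(L has_real_derivative 0) (at k)" if k: "0 < k" "k < 1" for k
  proof -
    define k' where "k' = sqrt (1 - k\<^sup>2)"
    have p: "1 - k\<^sup>2 > 0" using k by (simp add: abs_square_less_1)
    note d = elliptic_K_complementary_has_derivative[OF k k'_def]
      elliptic_E_complementary_has_derivative[OF k k'_def]
      elliptic_K_has_derivative[OF k] elliptic_E_has_derivative[OF k]
    have "(L has_real_derivative
       (elliptic_E k * (- (elliptic_E k' - k\<^sup>2 * elliptic_K k') / (k * (1 - k\<^sup>2))) +
        (elliptic_E k - elliptic_K k) / k * elliptic_K k') +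
       (elliptic_E k' * ((elliptic_E k - (1 - k\<^sup>2) * elliptic_K k) / (k * (1 - k\<^sup>2))) +
        - (elliptic_E k' - elliptic_K k') * k / (1 - k\<^sup>2) * elliptic_K k) -
       (elliptic_K k * (- (elliptic_E k' - k\<^sup>2 * elliptic_K k') / (k * (1 - k\<^sup>2))) +
        (elliptic_E k - (1 - k\<^sup>2) * elliptic_K k) / (k * (1 - k\<^sup>2)) * elliptic_K k')) (at k)"
      unfolding L_def Let_def k'_def
      by (intro DERIV_diff DERIV_add DERIV_mult' d[unfolded k'_def])
    then show ?thesis
      by (rule DERIV_cong) (use p k in \<open>simp add: divide_simps, simp add: algebra_simps power2_eq_square\<close>)
  qed
  obtain c where c: "\<And>k. k \<in> {0<..<1} \<Longrightarrow> L k = c"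
    using has_field_derivative_zero_constant[of "{0<..<1}" L, OF _ has_field_derivative_at_within[OF der]]
    by auto
  have lim: "(L \<longlongrightarrow> c) (at_right 0)"
  proof (rule tendsto_eventually)
    have "eventually (\<lambda>k::real. k \<in> {0<..<1}) (at_right 0)"
      by (rule eventually_at_right_real) simp
    then show "eventually (\<lambda>k. L k = c) (at_right 0)" by eventually_elim (rule c)
  qed
  have ev: "eventually (\<lambda>k::real. 0 < k \<and> k < 1) (at_right 0)"
    using eventually_at_right_real[of 0 "1::real"] by simp
  have *: "\<bar>L k - pi / 2\<bar> \<le> (pi / 2 * (pi / 2 / sqrt (1 - k\<^sup>2)) * k + k * (pi / 2) * (pi / 2 / sqrt (1 - k\<^sup>2)))
      + (pi / 2 / sqrt (1 - k\<^sup>2) - pi / 2)" if k: "0 < k" "k < 1" for k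
  proof -
    define k' where "k' = sqrt (1 - k\<^sup>2)"
    note cm = complementary_modulus[OF k, folded k'_def]
    note b = elliptic_bounds[OF k k'_def] and b' = elliptic_bounds[OF cm(1,2) cm(4)[symmetric]]
    \<comment> \<open>Regrouped so that every summand tends to 0 with k: the first by K - E = O(k^2)
      against K(k') = O(1/k), the second by E(k') - 1 = O(k), the third by the two bounds on
      K.\<close>
    have "L k - pi/2 = - ((elliptic_K k - elliptic_E k) * elliptic_K k') + (elliptic_E k' - 1) * elliptic_K k
       + (elliptic_K k - pi/2)"
      by (simp add: L_def Let_def k'_def algebra_simps)
    moreover have "0 \<le> (elliptic_K k - elliptic_E k) * elliptic_K k'"
      using b b' pi_gt_zero by (intro mult_nonneg_nonneg) (linarith+)
    moreover have "(elliptic_K k - elliptic_E k) * elliptic_K k' \<le> (k\<^sup>2 * (pi / 2 / k')) * (pi / 2 / k)"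
      using b b' pi_gt_zero cm(1) by (intro mult_mono) (auto intro: order_trans[of 0 "pi/2"])
    moreover have "(k\<^sup>2 * (pi / 2 / k')) * (pi / 2 / k) = pi / 2 * (pi / 2 / k') * k"
      using k by (simp add: power2_eq_square)
    moreover have "0 \<le> (elliptic_E k' - 1) * elliptic_K k"
      using b b' pi_gt_zero by (intro mult_nonneg_nonneg) (linarith+)
    moreover have "(elliptic_E k' - 1) * elliptic_K k \<le> (k * (pi / 2)) * (pi / 2 / k')"
    proof (rule mult_mono)
      show "elliptic_E k' - 1 \<le> k * (pi / 2)" using b'(6) by simp
    qed (use b pi_gt_zero k in \<open>auto intro: order_trans[of 0 "pi/2"]\<close>)
    moreover have "0 \<le> elliptic_K k - pi / 2" "elliptic_K k - pi/2 \<le> pi / 2 / k' - pi / 2" using b by auto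
    ultimately show ?thesis unfolding k'_def by linarith
  qed
  have "((\<lambda>k. (pi / 2 * (pi / 2 / sqrt (1 - k\<^sup>2)) * k + k * (pi / 2) * (pi / 2 / sqrt (1 - k\<^sup>2)))
      + (pi / 2 / sqrt (1 - k\<^sup>2) - pi / 2)) \<longlongrightarrow>
      (pi / 2 * (pi / 2 / sqrt (1 - 0\<^sup>2)) * 0 + 0 * (pi / 2) * (pi / 2 / sqrt (1 - 0\<^sup>2)))
      + (pi / 2 / sqrt (1 - 0\<^sup>2) - pi / 2)) (at_right (0::real))"
    by (intro tendsto_intros) auto
  then have "((\<lambda>k. (pi / 2 * (pi / 2 / sqrt (1 - k\<^sup>2)) * k + k * (pi / 2) * (pi / 2 / sqrt (1 - k\<^sup>2)))
      + (pi / 2 / sqrt (1 - k\<^sup>2) - pi / 2)) \<longlongrightarrow> 0) (at_right (0::real))" by simp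
  then have "((\<lambda>k. L k - pi / 2) \<longlongrightarrow> 0) (at_right 0)"
    by (rule Lim_null_comparison[rotated]) (use ev in \<open>eventually_elim, use * in auto\<close>)
  then have "(L \<longlongrightarrow> pi / 2) (at_right 0)" by (simp add: LIM_zero_iff)
  with lim have "c = pi / 2" by (intro tendsto_unique[of "at_right 0" L]) auto
  then show ?thesis using c[of k] assms by (simp add: L_def Let_def)
qed

section \<open>The period ratio and its monotonicity\<close>

definition period_ratio :: "real \<Rightarrow> real" where
  "period_ratio k = elliptic_K (sqrt (1 - k\<^sup>2)) / elliptic_K k"

lemma elliptic_K_pos: "0 < elliptic_K k" if "0 < k" "k < 1"
  using elliptic_bounds(1)[OF that refl] pi_gt_zero by linarith

lemma period_ratio_has_derivative:
  assumes "0 < k" "k < 1"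
  shows "(period_ratio has_real_derivative - (pi / (2 * k * (1 - k\<^sup>2) * (elliptic_K k)\<^sup>2))) (at k)"
proof -
  define k' where "k' = sqrt (1 - k\<^sup>2)"
  have p: "1 - k\<^sup>2 > 0" "elliptic_K k > 0" using assms elliptic_K_pos by (auto simp: abs_square_less_1)
  have "(period_ratio has_real_derivative
     ((- (elliptic_E k' - k\<^sup>2 * elliptic_K k') / (k * (1 - k\<^sup>2))) * elliptic_K k -
      elliptic_K k' * ((elliptic_E k - (1 - k\<^sup>2) * elliptic_K k) / (k * (1 - k\<^sup>2))))
      / (elliptic_K k * elliptic_K k)) (at k)" (is "(_ has_real_derivative ?d) _")
    unfolding period_ratio_def [abs_def] k'_def
    using p by (intro DERIV_divide elliptic_K_complementary_has_derivative[OF assms refl] elliptic_K_has_derivative assms) auto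
  also have "?d = - ((elliptic_E k * elliptic_K k' + elliptic_E k' * elliptic_K k - elliptic_K k * elliptic_K k')
      / (k * (1 - k\<^sup>2) * (elliptic_K k)\<^sup>2))"
    using p assms by (simp add: divide_simps, simp add: algebra_simps power2_eq_square)
  also have "\<dots> = - (pi / (2 * k * (1 - k\<^sup>2) * (elliptic_K k)\<^sup>2))"
    unfolding legendre_relation[OF assms k'_def] by (simp add: mult.assoc)
  finally show ?thesis .
qed

text \<open>This recognises a modulus from its period ratio: the lattice sums produce a modulus
  \<open>ga / al\<close> whose ratio is known, and it must be the given one.\<close>

lemma period_ratio_inject:
  assumes "0 < k" "k < 1" "0 < l" "l < 1" "period_ratio k = period_ratio l"
  shows "k = l"
proof -
  have *: "period_ratio k > period_ratio l" if "0 < k" "k < l" "l < 1" for k l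
  proof (rule DERIV_neg_imp_decreasing[OF that(2)])
    fix z assume "k \<le> z" "z \<le> l"
    then have z: "0 < z" "z < 1" using that by auto
    then have "1 - z\<^sup>2 > 0" "elliptic_K z > 0" using elliptic_K_pos by (auto simp: abs_square_less_1)
    then show "\<exists>y. DERIV period_ratio z :> y \<and> y < 0"
      using period_ratio_has_derivative[OF z] z by (intro exI conjI) (assumption, simp)
  qed
  show ?thesis using *[of k l] *[of l k] assms by (cases k l rule: linorder_cases) auto
qed

section \<open>Sums over the integers\<close>

lemma has_sum_diff:
  fixes f g :: "'a \<Rightarrow> 'b :: topological_ab_group_add"
  assumes "(f has_sum A) S" "(g has_sum B) S"
  shows "((\<lambda>x. f x - g x) has_sum (A - B)) S"
  using has_sum_add[OF assms(1), of "\<lambda>x. - g x" "- B"] assms(2) by (simp add: has_sum_uminus)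

lemma has_sum_int_split:
  fixes f :: "int \<Rightarrow> 'a :: real_normed_vector"
  assumes "((\<lambda>n. f (int n)) has_sum A) UNIV" "((\<lambda>n. f (- int n - 1)) has_sum B) UNIV"
  shows "(f has_sum (A + B)) UNIV"
proof -
  have "(f has_sum A) (range int)"
    using assms(1) by (subst has_sum_reindex) (auto simp: o_def)
  moreover have "(f has_sum B) (range (\<lambda>n. - int n - 1))"
    using assms(2) by (subst has_sum_reindex) (auto simp: o_def inj_def)
  moreover have "range int \<inter> range (\<lambda>n. - int n - 1) = {}" by auto
  moreover have "x \<in> range int \<union> range (\<lambda>n. - int n - 1)" for x
  proof (cases "x \<ge> 0")
    case True
    then have "x = int (nat x)" by simp
    then show ?thesis by blast
  next
    case False
    then have "x = - int (nat (- x - 1)) - 1" by simp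
    then show ?thesis by blast
  qed
  then have "range int \<union> range (\<lambda>n. - int n - 1) = UNIV" by blast
  ultimately show ?thesis using has_sum_Un_disjoint by metis
qed

lemma sums_int_pairs:
  fixes f :: "int \<Rightarrow> 'a :: banach"
  assumes "f summable_on UNIV"
  shows "(\<lambda>n. f (int n) + f (- int n - 1)) sums infsum f UNIV"
proof -
  have "f summable_on range int" "f summable_on range (\<lambda>n. - int n - 1)"
    using assms by (auto intro: summable_on_subset_banach)
  then have "(\<lambda>n. f (int n)) summable_on UNIV" "(\<lambda>n. f (- int n - 1)) summable_on UNIV"
    by (simp_all add: summable_on_reindex inj_def o_def)
  then obtain A B where "((\<lambda>n. f (int n)) has_sum A) UNIV" "((\<lambda>n. f (- int n - 1)) has_sum B) UNIV"
    by (auto simp: summable_on_def)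
  then have "(\<lambda>n. f (int n) + f (- int n - 1)) sums (A + B)" "(f has_sum (A + B)) UNIV"
    by (auto intro: sums_add has_sum_imp_sums has_sum_int_split)
  then show ?thesis by (simp add: infsumI)
qed

lemma infsum_int_shift: "infsum (\<lambda>n. f (n + d)) (UNIV :: int set) = infsum f UNIV"
  by (rule infsum_reindex_bij_betw) (rule bij_betw_byWitness[where f' = "\<lambda>n. n - d"], auto)

lemma has_sum_int_shift: "((\<lambda>n. f (n + d)) has_sum S) (UNIV :: int set) \<longleftrightarrow> (f has_sum S) UNIV"
  by (rule has_sum_reindex_bij_betw) (rule bij_betw_byWitness[where f' = "\<lambda>n. n - d"], auto)

lemma infsum_int_reflect: "infsum (\<lambda>n. f (d - n)) (UNIV :: int set) = infsum f UNIV"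
  by (rule infsum_reindex_bij_betw) (rule bij_betw_byWitness[where f' = "\<lambda>n. d - n"], auto)

text \<open>Reindexing and negation commute with \<open>infsum\<close> even at its default value 0,
  so the sum equals its own negative.\<close>

lemma infsum_int_antisymmetric:
  fixes f :: "int \<Rightarrow> 'a :: {real_normed_vector}"
  assumes "\<And>n. f (d - n) = - f n"
  shows "infsum f UNIV = 0"
proof -
  have "infsum f UNIV = infsum (\<lambda>n. f (d - n)) UNIV" by (simp only: infsum_int_reflect)
  also have "\<dots> = - infsum f UNIV" by (simp add: assms infsum_uminus)
  finally have "infsum f UNIV + infsum f UNIV = 0" by (metis add.right_inverse)
  then show ?thesis by (metis scaleR_2 scaleR_eq_0_iff zero_neq_numeral)
qed

lemma has_sum_int_even_odd:
  fixes f :: "int \<Rightarrow> 'a :: real_normed_vector"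
  assumes "((\<lambda>n. f (2 * n)) has_sum A) UNIV" "((\<lambda>n. f (2 * n + 1)) has_sum B) UNIV"
  shows "(f has_sum (A + B)) UNIV"
proof -
  have "(f has_sum A) (range (\<lambda>n. 2 * n))"
    using assms(1) by (subst has_sum_reindex) (auto simp: o_def inj_def)
  moreover have "(f has_sum B) (range (\<lambda>n. 2 * n + 1))"
    using assms(2) by (subst has_sum_reindex) (auto simp: o_def inj_def)
  moreover have "range (\<lambda>n::int. 2 * n) \<inter> range (\<lambda>n. 2 * n + 1) = {}" by (auto; presburger)
  moreover have "x \<in> range (\<lambda>n::int. 2 * n) \<union> range (\<lambda>n. 2 * n + 1)" for x
  proof -
    have "x = 2 * (x div 2) \<or> x = 2 * (x div 2) + 1" by presburger
    then show ?thesis by blast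
  qed
  then have "range (\<lambda>n::int. 2 * n) \<union> range (\<lambda>n. 2 * n + 1) = UNIV" by blast
  ultimately show ?thesis using has_sum_Un_disjoint by metis
qed

lemma infsum_int_even_odd:
  fixes f :: "int \<Rightarrow> 'a :: banach"
  assumes "f summable_on UNIV"
  shows "infsum f UNIV = infsum (\<lambda>n. f (2 * n)) UNIV + infsum (\<lambda>n. f (2 * n + 1)) UNIV"
proof -
  have "f summable_on range (\<lambda>n. 2 * n)" "f summable_on range (\<lambda>n. 2 * n + 1)"
    using assms by (auto intro: summable_on_subset_banach)
  then have "(\<lambda>n. f (2 * n)) summable_on UNIV" "(\<lambda>n. f (2 * n + 1)) summable_on UNIV"
    by (simp_all add: summable_on_reindex inj_def o_def)
  then show ?thesis by (intro infsumI has_sum_int_even_odd has_sum_infsum)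
qed

lemma half_odd_nonzero: "of_int n + 1/2 \<noteq> (0::real)"
proof
  assume "of_int n + 1/2 = (0::real)"
  then have "of_int (2 * n + 1) = (0::real)" by simp
  then have "2 * n + 1 = 0" by (simp only: of_int_eq_0_iff)
  then show False by presburger
qed

lemma summable_on_int_power:
  fixes q :: real
  assumes "0 \<le> q" "q < 1"
  shows "(\<lambda>n::int. q ^ nat \<bar>n\<bar>) summable_on UNIV"
proof -
  have "(\<lambda>n. q ^ n) summable_on (UNIV :: nat set)"
    using assms by (intro summable_nonneg_imp_summable_on summable_geometric) auto
  then obtain A where A: "((\<lambda>n::nat. q ^ n) has_sum A) UNIV" by (auto simp: summable_on_def)
  have "((\<lambda>n. q ^ nat \<bar>int n\<bar>) has_sum A) UNIV" using A by simp
  moreover have "((\<lambda>n. q * q ^ n) has_sum (q * A)) (UNIV :: nat set)"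
    by (rule has_sum_cmult_right[OF A])
  then have "((\<lambda>n. q ^ nat \<bar>- int n - 1\<bar>) has_sum (q * A)) UNIV"
    by (rule has_sum_cong[THEN iffD1, rotated]) (simp add: nat_add_distrib abs_if flip: power_Suc)
  ultimately show ?thesis
    by (rule has_sum_imp_summable[OF has_sum_int_split[of "\<lambda>n. q ^ nat \<bar>n\<bar>"]])
qed

lemma summable_on_int_power_bound:
  fixes f :: "int \<Rightarrow> 'a :: banach" and q :: real
  assumes "0 \<le> q" "q < 1" "\<And>n. norm (f n) \<le> B * q ^ nat \<bar>n\<bar>"
  shows "(\<lambda>n. norm (f n)) summable_on UNIV" "f summable_on UNIV"
proof -
  show "(\<lambda>n. norm (f n)) summable_on UNIV"
  proof (rule summable_on_comparison_test[where f = "\<lambda>n. B * q ^ nat \<bar>n\<bar>"])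
    show "norm (f n) \<le> B * q ^ nat \<bar>n\<bar>" "0 \<le> norm (f n)" for n by (simp_all add: assms(3))
    show "(\<lambda>n::int. B * q ^ nat \<bar>n\<bar>) summable_on UNIV"
      by (intro summable_on_cmult_right summable_on_int_power assms)
  qed
  then show "f summable_on UNIV" by (rule abs_summable_summable)
qed

text \<open>Unit steps telescope towards both ends when n is paired with - n - 1. A step of size d
  is a sum of d shifted unit steps, and a negative step is the negative of a shifted positive
  one.\<close>

lemma has_sum_int_telescope:
  fixes g :: "int \<Rightarrow> 'a :: banach"
  assumes summable: "(\<lambda>n. g n - g (n + 1)) summable_on UNIV"
    and lim: "(\<lambda>n. g (int n)) \<longlonglongrightarrow> L" "(\<lambda>n. g (- int n)) \<longlonglongrightarrow> M"
  shows "((\<lambda>n. g n - g (n + of_int d)) has_sum of_int d *\<^sub>R (M - L)) UNIV"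
proof -
  have 1: "((\<lambda>n. g n - g (n + 1)) has_sum (M - L)) UNIV"
  proof -
    have s1: "int (Suc n) = int n + 1" and s2: "- int (Suc n) = - int n - 1" for n
      by simp_all
    have t1: "(\<lambda>n. g (int n) - g (int n + 1)) sums (g 0 - L)"
      using telescope_sums'[OF lim(1)] unfolding s1 by simp
    have t2: "(\<lambda>n. g (- int n - 1) - g (- int n - 1 + 1)) sums (M - g 0)"
      using telescope_sums[OF lim(2)] unfolding s2 by simp
    have "infsum (\<lambda>n. g n - g (n + 1)) UNIV = (g 0 - L) + (M - g 0)"
      by (rule sums_unique2[OF sums_int_pairs[OF summable] sums_add[OF t1 t2]])
    also have "\<dots> = M - L" by simp
    finally have "infsum (\<lambda>n. g n - g (n + 1)) UNIV = M - L" .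
    then show ?thesis using has_sum_infsum[OF summable] by (simp only:)
  qed
  have 2: "((\<lambda>n. g n - g (n + int d)) has_sum real d *\<^sub>R (M - L)) UNIV" for d :: nat
  proof (induction d)
    case (Suc d)
    have "((\<lambda>n. g (n + int d) - g (n + int d + 1)) has_sum (M - L)) UNIV"
      using 1 has_sum_int_shift[of "\<lambda>n. g n - g (n + 1)" "int d" "M - L"] by simp
    from has_sum_add[OF Suc.IH this] show ?case
      by (simp add: algebra_simps)
  qed simp
  show ?thesis
  proof (cases "d \<ge> 0")
    case True
    then obtain k where "d = int k" using nonneg_int_cases by blast
    then show ?thesis using 2[of k] by simp
  next
    case False
    then obtain k where k: "d = - int k" by (metis int_cases2 nle_le of_nat_0_le_iff neg_0_le_iff_le)
    have "((\<lambda>n. g (n - int k) - g n) has_sum real k *\<^sub>R (M - L)) UNIV"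
      using 2[of k] has_sum_int_shift[of "\<lambda>n. g n - g (n + int k)" "- int k"] by simp
    then have "((\<lambda>n. - (g n - g (n - int k))) has_sum real k *\<^sub>R (M - L)) UNIV" by simp
    then show ?thesis unfolding has_sum_uminus by (simp add: k)
  qed
qed

lemma has_sum_product:
  fixes f :: "'a \<Rightarrow> 'c :: {banach, real_normed_field}" and g :: "'b \<Rightarrow> 'c"
  assumes "(\<lambda>n. norm (f n)) summable_on A" "(\<lambda>n. norm (g n)) summable_on B"
  shows "((\<lambda>p. f (fst p) * g (snd p)) has_sum (infsum f A * infsum g B)) (A \<times> B)"
proof -
  define h where "h = (\<lambda>p. f (fst p) * g (snd p))"
  have "(\<lambda>p. norm (h p)) summable_on A \<times> B"
    unfolding Infinite_Sum.abs_summable_on_Sigma_iff using assms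
    by (auto intro!: summable_on_cmult_right summable_on_cmult_left
        simp: infsum_cmult_right' infsum_nonneg norm_mult h_def)
  then have s: "h summable_on A \<times> B" by (rule abs_summable_summable)
  have "infsum h (A \<times> B) = infsum (\<lambda>x. infsum (\<lambda>y. f x * g y) B) A"
    using infsum_Sigma_banach[OF s] by (simp add: h_def)
  also have "\<dots> = infsum (\<lambda>x. f x * infsum g B) A"
    by (intro infsum_cong infsum_cmult_right) (use assms abs_summable_summable in auto)
  also have "\<dots> = infsum f A * infsum g B"
    by (intro infsum_cmult_left) (use assms abs_summable_summable in auto)
  finally show ?thesis using s unfolding h_def by (metis has_sum_infsum)
qed

text \<open>Products of two lattice sums are regrouped by the difference of the indices, because
  along such a diagonal the partial fractions telescope.\<close>

lemma has_sum_int_convolution: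
  fixes f g :: "int \<Rightarrow> 'c :: {banach, real_normed_field}"
  assumes "(\<lambda>n. norm (f n)) summable_on UNIV" "(\<lambda>n. norm (g n)) summable_on UNIV"
    and "\<And>d. ((\<lambda>n. f n * g (n + d)) has_sum s d) UNIV"
  shows "(s has_sum (infsum f UNIV * infsum g UNIV)) UNIV"
proof (rule has_sum_SigmaD)
  have "bij_betw (\<lambda>p. (snd p, snd p + fst p)) UNIV (UNIV :: (int \<times> int) set)"
    by (rule bij_betw_byWitness[where f' = "\<lambda>p. (snd p - fst p, fst p)"]) auto
  from has_sum_reindex_bij_betw[OF this, of "\<lambda>p. f (fst p) * g (snd p)"] has_sum_product[OF assms(1,2)]
  show "((\<lambda>p. f (snd p) * g (snd p + fst p)) has_sum (infsum f UNIV * infsum g UNIV)) (UNIV \<times> UNIV)"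
    by simp
qed (use assms(3) in simp)

text \<open>Locally uniform convergence of holomorphic functions passes to the derivatives, so the
  majorant concerns the functions. The finite set \<open>F\<close> leaves room for terms with a pole
  on the boundary of \<open>S\<close>. The series is carried over to natural indices by
  \<open>int_decode\<close>.\<close>

lemma infsum_int_has_derivative:
  fixes f f' :: "int \<Rightarrow> complex \<Rightarrow> complex" and M :: "int \<Rightarrow> real"
  assumes S: "open S" "z \<in> S"
    and der: "\<And>n z. z \<in> S \<Longrightarrow> (f n has_field_derivative f' n z) (at z)"
    and M: "M summable_on UNIV" "finite F" "\<And>n z. n \<notin> F \<Longrightarrow> z \<in> S \<Longrightarrow> norm (f n z) \<le> M n"
    and f': "\<And>z. z \<in> S \<Longrightarrow> (\<lambda>n. f n z) summable_on UNIV" "\<And>z. z \<in> S \<Longrightarrow> (\<lambda>n. f' n z) summable_on UNIV"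
  shows "((\<lambda>z. infsum (\<lambda>n. f n z) UNIV) has_field_derivative infsum (\<lambda>n. f' n z) UNIV) (at z)"
proof -
  have dec: "(\<lambda>k. h (int_decode k)) sums infsum h UNIV" if "h summable_on UNIV" for h :: "int \<Rightarrow> 'b :: real_normed_vector"
  proof -
    have "((\<lambda>k. h (int_decode k)) has_sum infsum h UNIV) UNIV"
      using that has_sum_reindex_bij_betw[OF bij_int_decode, of h] by simp
    then show ?thesis by (rule has_sum_imp_sums)
  qed
  have ev: "eventually (\<lambda>k. int_decode k \<notin> F) sequentially"
  proof -
    have "finite (int_decode -` F)"
      using M(2) bij_int_decode by (intro finite_vimageI) (auto simp: bij_def)
    then have "eventually (\<lambda>k. k \<notin> int_decode -` F) cofinite" by (simp add: eventually_cofinite vimage_def)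
    then show ?thesis by (simp add: cofinite_eq_sequentially)
  qed
  \<comment> \<open>On \<open>F\<close> nothing is known about \<open>M\<close>, not even its
    sign.\<close>
  define h where "h = (\<lambda>k. \<bar>M (int_decode k)\<bar>)"
  have hs: "summable h"
  proof -
    have "(\<lambda>n. \<bar>M n\<bar>) summable_on UNIV"
      using M(1) summable_on_iff_abs_summable_on_real[of M UNIV] by simp
    from dec[OF this] show ?thesis unfolding h_def by (rule sums_summable)
  qed
  have "\<exists>g g'. \<forall>x \<in> S. ((\<lambda>k. f (int_decode k) x) sums g x) \<and> ((\<lambda>k. f' (int_decode k) x) sums g' x) \<and> (g has_field_derivative g' x) (at x)"
  proof (rule series_and_derivative_comparison_complex[OF S(1)])
    fix x assume "x \<in> S"
    have "\<forall>\<^sub>F n in sequentially. \<forall>y\<in>ball x 1 \<inter> S. cmod (f (int_decode n) y) \<le> cmod (complex_of_real (h n))"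
      using ev
    proof eventually_elim
      case (elim k)
      then show ?case using M(3)[of "int_decode k"] by (auto simp: h_def intro!: order_trans[OF _ abs_ge_self])
    qed
    then show "\<exists>d h. 0 < d \<and> summable h \<and> range h \<subseteq> \<real>\<^sub>\<ge>\<^sub>0 \<and>
        (\<forall>\<^sub>F n in sequentially. \<forall>y\<in>ball x d \<inter> S. cmod (f (int_decode n) y) \<le> cmod (h n))"
      using hs by (intro exI[of _ 1] exI[of _ "\<lambda>k. complex_of_real (h k)"])
        (auto simp: h_def summable_of_real)
  qed (rule der)
  then obtain g g' where g: "\<And>x. x \<in> S \<Longrightarrow> (\<lambda>k. f (int_decode k) x) sums g x"
    "\<And>x. x \<in> S \<Longrightarrow> (\<lambda>k. f' (int_decode k) x) sums g' x"
    "\<And>x. x \<in> S \<Longrightarrow> (g has_field_derivative g' x) (at x)" by blast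
  have geq: "g x = infsum (\<lambda>n. f n x) UNIV" "g' x = infsum (\<lambda>n. f' n x) UNIV" if "x \<in> S" for x
    using sums_unique2[OF g(1)[OF that] dec[OF f'(1)[OF that]]]
      sums_unique2[OF g(2)[OF that] dec[OF f'(2)[OF that]]] by auto
  have "((\<lambda>z. infsum (\<lambda>n. f n z) UNIV) has_field_derivative g' z) (at z)"
    by (rule has_field_derivative_transform_within_open[OF g(3)[OF S(2)] S]) (rule geq(1))
  then show ?thesis by (simp only: geq(2)[OF S(2)])
qed

section \<open>Lattice sums of the hyperbolic cosecant\<close>

lemma sinh_of_real_complex: "sinh (complex_of_real x) = of_real (sinh x)"
  by (simp add: sinh_field_def exp_of_real flip: of_real_minus)

lemma cosh_of_real_complex: "cosh (complex_of_real x) = of_real (cosh x)"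
  by (simp add: cosh_field_def exp_of_real flip: of_real_minus)

lemma sinh_imaginary: "sinh (\<i> * of_real y) = \<i> * of_real (sin y)"
  by (simp add: sinh_conv_sin sin_of_real flip: mult.assoc)

lemma cosh_imaginary: "cosh (\<i> * of_real y) = of_real (cos y)"
  by (simp add: cosh_conv_cos cos_of_real flip: mult.assoc)

lemma sinh_rectangular: "sinh (Complex x y) = Complex (sinh x * cos y) (cosh x * sin y)"
proof -
  have "sinh (Complex x y) = sinh (of_real x + \<i> * of_real y)" by (simp only: Complex_eq)
  also have "\<dots> = Complex (sinh x * cos y) (cosh x * sin y)"
    unfolding sinh_add sinh_of_real_complex cosh_of_real_complex sinh_imaginary cosh_imaginary
    by (simp add: complex_eq_iff)
  finally show ?thesis .
qed

lemma norm_sinh_ge: "\<bar>sinh (Re z)\<bar> \<le> norm (sinh (z :: complex))"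
proof -
  have "\<bar>norm (exp z) - norm (exp (- z))\<bar> \<le> norm (exp z - exp (- z))" by (rule norm_triangle_ineq3)
  then show ?thesis by (simp add: sinh_field_def norm_exp_eq_Re norm_divide)
qed

locale csch_lattice =
  fixes a :: real
  assumes a_pos: "0 < a"
begin

definition csch :: "int \<Rightarrow> complex \<Rightarrow> complex" where
  "csch n z = inverse (sinh (z + of_int n * of_real a))"

definition coth :: "int \<Rightarrow> complex \<Rightarrow> complex" where
  "coth n z = cosh (z + of_int n * of_real a) * csch n z"

text \<open>The strip reaches one period to either side of the imaginary axis: wide enough for the
  paths used later, narrow enough for geometric decay of the terms with |n| \<ge> 2, uniformly in
  z.\<close>

definition reg :: "complex set" where
  "reg = {z. \<bar>Re z\<bar> < a \<and> (\<forall>n. sinh (z + of_int n * of_real a) \<noteq> 0)}"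

text \<open>The classical nome, once \<open>a\<close> is pi K(k')/K(k).\<close>

definition q :: real where "q = exp (- a)"

lemma q: "0 \<le> q" "q < 1" using a_pos by (auto simp: q_def)

lemma q_power: "q ^ n = exp (- (a * n))"
  unfolding q_def using exp_of_nat_mult[of n "- a"] by (simp add: mult.commute)

text \<open>In the strip |Re z + n a| is at least u = (|n| - 1) a \<ge> a, and sinh u \<ge> exp u (1
  - exp (- 2 a)) / 2. The factor exp a undoes the - 1 in u.\<close>

lemma csch_bound:
  assumes "\<bar>Re z\<bar> < a" "2 \<le> \<bar>n\<bar>"
  shows "norm (csch n z) \<le> 2 * exp a / (1 - exp (- 2 * a)) * q ^ nat \<bar>n\<bar>"
proof -
  define u where "u = (of_int \<bar>n\<bar> - 1) * a"
  have u: "a \<le> u" using assms(2) a_pos mult_right_mono[of 1 "of_int \<bar>n\<bar> - 1" a] by (simp add: u_def)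
  have "u \<le> \<bar>of_int n * a\<bar> - \<bar>Re z\<bar>"
    using assms(1) a_pos by (simp add: u_def abs_mult algebra_simps)
  also have "\<dots> \<le> \<bar>Re z + of_int n * a\<bar>" by linarith
  finally have "sinh u \<le> sinh \<bar>Re z + of_int n * a\<bar>" by (simp only: sinh_real_le_iff)
  also have "\<dots> = \<bar>sinh (Re (z + of_int n * of_real a))\<bar>" by simp
  also have "\<dots> \<le> norm (sinh (z + of_int n * of_real a))" by (rule norm_sinh_ge)
  finally have 1: "sinh u \<le> norm (sinh (z + of_int n * of_real a))" .
  have e: "exp (- 2 * a) < 1" using a_pos by simp
  have "exp u * ((1 - exp (- 2 * a)) / 2) \<le> exp u * ((1 - exp (- 2 * u)) / 2)"
    using u by (intro mult_left_mono) auto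
  also have "\<dots> = sinh u"
    by (simp add: sinh_field_def algebra_simps flip: exp_add)
  finally have 2: "exp u * ((1 - exp (- 2 * a)) / 2) \<le> norm (sinh (z + of_int n * of_real a))" using 1 by linarith
  have p: "0 < exp u * ((1 - exp (- 2 * a)) / 2)" using e by simp
  have "norm (csch n z) = 1 / norm (sinh (z + of_int n * of_real a))"
    by (simp add: csch_def norm_inverse divide_inverse)
  also have "\<dots> \<le> 1 / (exp u * ((1 - exp (- 2 * a)) / 2))"
    by (rule frac_le[OF _ _ p 2]) simp_all
  also have "\<dots> = 2 / (1 - exp (- 2 * a)) * exp (- u)"
    by (simp add: exp_minus divide_simps)
  also have "exp (- u) = exp a * q ^ nat \<bar>n\<bar>"
    by (simp add: q_power u_def algebra_simps flip: exp_add)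
  finally show ?thesis by (simp add: mult_ac)
qed

text \<open>The constant may depend on z, so the three terms missing from \<open>csch_bound\<close>
  are absorbed in it. A term at its pole is \<open>inverse 0 = 0\<close>; hence points such as z = 0
  are covered as well.\<close>

lemma csch_bound_all:
  assumes "\<bar>Re z\<bar> < a"
  obtains B where "0 \<le> B" "\<And>n. norm (csch n z) \<le> B * q ^ nat \<bar>n\<bar>"
proof -
  define B0 where "B0 = 2 * exp a / (1 - exp (- 2 * a))"
  define B where "B = B0 + (\<Sum>n\<in>{-1,0,1}. norm (csch n z) / q ^ nat \<bar>n\<bar>)"
  have q0: "0 < q" by (simp add: q_def)
  have B0: "0 \<le> B0" using a_pos by (simp add: B0_def)
  have S: "0 \<le> norm (csch n z) / q ^ nat \<bar>n\<bar>" for n using q0 by simp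
  have "norm (csch n z) \<le> B * q ^ nat \<bar>n\<bar>" for n
  proof (cases "\<bar>n\<bar> \<ge> 2")
    case True
    have "norm (csch n z) \<le> B0 * q ^ nat \<bar>n\<bar>" using csch_bound[OF assms True] by (simp add: B0_def)
    also have "\<dots> \<le> B * q ^ nat \<bar>n\<bar>"
      unfolding B_def using S q0 by (intro mult_right_mono) (auto intro!: sum_nonneg simp del: sum.insert)
    finally show ?thesis .
  next
    case False
    then have "n \<in> {-1,0,1}" by auto
    then have "norm (csch n z) / q ^ nat \<bar>n\<bar> \<le> (\<Sum>n\<in>{-1,0,1}. norm (csch n z) / q ^ nat \<bar>n\<bar>)"
      by (intro member_le_sum S) auto
    then have "norm (csch n z) / q ^ nat \<bar>n\<bar> \<le> B" using B0 by (simp add: B_def)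
    then show ?thesis using q0 by (simp add: field_simps)
  qed
  moreover have "0 \<le> B" unfolding B_def using B0 S by (auto intro!: add_nonneg_nonneg sum_nonneg simp del: sum.insert)
  ultimately show ?thesis using that by blast
qed

lemma csch_mult_summable:
  assumes "\<bar>Re z\<bar> < a" "\<And>n. norm (h n) \<le> M"
  shows "(\<lambda>n. norm (csch n z * h n)) summable_on UNIV" "(\<lambda>n. csch n z * h n) summable_on UNIV"
proof -
  obtain B where B: "0 \<le> B" "\<And>n. norm (csch n z) \<le> B * q ^ nat \<bar>n\<bar>"
    using csch_bound_all[OF assms(1)] by blast
  have "norm (csch n z * h n) \<le> (B * M) * q ^ nat \<bar>n\<bar>" for n
  proof -
    have "norm (csch n z * h n) \<le> (B * q ^ nat \<bar>n\<bar>) * M"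
      unfolding norm_mult using B assms(2) q by (intro mult_mono) auto
    then show ?thesis by (simp add: mult_ac)
  qed
  from summable_on_int_power_bound[OF q this]
  show "(\<lambda>n. norm (csch n z * h n)) summable_on UNIV" "(\<lambda>n. csch n z * h n) summable_on UNIV" .
qed

lemma csch_bounded:
  assumes "\<bar>Re z\<bar> < a"
  obtains B where "0 \<le> B" "\<And>n. norm (csch n z) \<le> B"
proof -
  obtain B where B: "0 \<le> B" "\<And>n. norm (csch n z) \<le> B * q ^ nat \<bar>n\<bar>"
    using csch_bound_all[OF assms(1)] by blast
  have "B * q ^ nat \<bar>n\<bar> \<le> B * 1" for n using B(1) q by (intro mult_left_mono power_le_one) auto
  then show ?thesis using that[of B] B by (metis mult.right_neutral order_trans)
qed

lemma reg_nonzero: "sinh (z + of_int n * of_real a) \<noteq> 0" and reg_Re: "\<bar>Re z\<bar> < a" if "z \<in> reg" for z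
  using that by (auto simp: reg_def)

lemma coth_square: "(coth n z)\<^sup>2 = 1 + (csch n z)\<^sup>2" if "z \<in> reg"
proof -
  define w where "w = z + of_int n * of_real a"
  have "sinh w \<noteq> 0" unfolding w_def by (rule reg_nonzero[OF that])
  moreover have "(cosh w)\<^sup>2 = (sinh w)\<^sup>2 + 1" by (rule cosh_square_eq)
  ultimately show ?thesis
    unfolding coth_def csch_def w_def[symmetric]
    by (simp add: divide_simps power_mult_distrib power_inverse)
qed

lemma norm_coth_le:
  assumes "z \<in> reg" "norm (csch n z) \<le> B"
  shows "norm (coth n z) \<le> 1 + B"
proof (rule power2_le_imp_le)
  have B: "0 \<le> B" using assms(2) norm_ge_zero order_trans by blast
  have "(norm (coth n z))\<^sup>2 = norm (1 + (csch n z)\<^sup>2)"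
    using coth_square[OF assms(1), of n] by (metis norm_power)
  also have "\<dots> \<le> 1 + (norm (csch n z))\<^sup>2" by (rule order_trans[OF norm_triangle_ineq]) (simp add: norm_power)
  also have "\<dots> \<le> 1 + B\<^sup>2" using assms(2) by (intro add_left_mono power_mono) auto
  also have "\<dots> \<le> (1 + B)\<^sup>2" using B by (simp add: power2_sum)
  finally show "(norm (coth n z))\<^sup>2 \<le> (1 + B)\<^sup>2" .
  show "0 \<le> 1 + B" using B by simp
qed

text \<open>An elliptic function with period a and antiperiod i pi, with simple poles at the points
  of the lattice that these span. \<open>H1\<close> and \<open>H2\<close> are its termwise
  derivatives, the latter simplified by coth^2 = 1 + csch^2.\<close>

definition H :: "complex \<Rightarrow> complex" where "H z = (\<Sum>\<^sub>\<infinity>n. csch n z)"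
definition H1 :: "complex \<Rightarrow> complex" where "H1 z = (\<Sum>\<^sub>\<infinity>n. - (csch n z * coth n z))"
definition H2 :: "complex \<Rightarrow> complex" where "H2 z = (\<Sum>\<^sub>\<infinity>n. csch n z + 2 * csch n z ^ 3)"
definition V :: "complex \<Rightarrow> complex" where "V z = (\<Sum>\<^sub>\<infinity>n. (csch n z)\<^sup>2)"
definition V3 :: "complex \<Rightarrow> complex" where "V3 z = (\<Sum>\<^sub>\<infinity>n. csch n z ^ 3)"

lemma csch_summable:
  assumes "\<bar>Re z\<bar> < a"
  shows "(\<lambda>n. norm (csch n z)) summable_on UNIV" "(\<lambda>n. csch n z) summable_on UNIV"
    "(\<lambda>n. norm ((csch n z)\<^sup>2)) summable_on UNIV" "(\<lambda>n. (csch n z)\<^sup>2) summable_on UNIV"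
    "(\<lambda>n. csch n z ^ 3) summable_on UNIV"
proof -
  obtain B where B: "0 \<le> B" "\<And>n. norm (csch n z) \<le> B" using csch_bounded[OF assms] by blast
  show "(\<lambda>n. norm (csch n z)) summable_on UNIV" "(\<lambda>n. csch n z) summable_on UNIV"
    using csch_mult_summable[OF assms, of "\<lambda>_. 1" 1] by auto
  show "(\<lambda>n. norm ((csch n z)\<^sup>2)) summable_on UNIV" "(\<lambda>n. (csch n z)\<^sup>2) summable_on UNIV"
    using csch_mult_summable[OF assms B(2)] by (auto simp: power2_eq_square)
  have "norm (csch n z ^ 2) \<le> B\<^sup>2" for n unfolding norm_power using B by (intro power_mono) auto
  from csch_mult_summable[OF assms this]
  show "(\<lambda>n. csch n z ^ 3) summable_on UNIV" by (auto simp: power2_eq_square power3_eq_cube mult.assoc)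
qed

lemma csch_coth_summable:
  assumes "z \<in> reg"
  shows "(\<lambda>n. csch n z * coth n z) summable_on UNIV"
proof -
  obtain B where "\<And>n. norm (csch n z) \<le> B" using csch_bounded[OF reg_Re[OF assms]] by blast
  then have "norm (coth n z) \<le> 1 + B" for n by (intro norm_coth_le[OF assms])
  then show ?thesis by (intro csch_mult_summable(2)[OF reg_Re[OF assms]])
qed

section \<open>Partial fractions and product formulas\<close>

lemma period_nonzero:
  assumes "d \<noteq> 0"
  shows "sinh (of_int d * of_real a :: complex) \<noteq> 0"
proof -
  have "sinh (of_int d * a) \<noteq> 0" using assms a_pos by simp
  then show ?thesis using sinh_of_real_complex[of "of_int d * a"] by simp
qed

lemma csch_shift:
  assumes "z \<in> reg"
  obtains x D where "csch n z = inverse (sinh x)" "coth n z = cosh x / sinh x"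
    "csch (n + d) z = inverse (sinh (x + D))" "coth (n + d) z = cosh (x + D) / sinh (x + D)"
    "D = of_int d * of_real a" "sinh x \<noteq> 0" "sinh (x + D) \<noteq> 0"
  using that[of "z + of_int n * of_real a" "of_int d * of_real a"]
    reg_nonzero[OF assms, of n] reg_nonzero[OF assms, of "n + d"]
  by (simp add: csch_def coth_def divide_inverse algebra_simps)

lemma csch_csch:
  assumes "z \<in> reg" "d \<noteq> 0"
  shows "csch n z * csch (n + d) z = (coth n z - coth (n + d) z) / sinh (of_int d * of_real a)"
proof -
  obtain x D where x: "csch n z = inverse (sinh x)" "coth n z = cosh x / sinh x"
    "csch (n + d) z = inverse (sinh (x + D))" "coth (n + d) z = cosh (x + D) / sinh (x + D)"
    "D = of_int d * of_real a" "sinh x \<noteq> 0" "sinh (x + D) \<noteq> 0" using csch_shift[OF assms(1)] by blast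
  have D: "sinh D = sinh (x + D) * cosh x - cosh (x + D) * sinh x"
    using sinh_diff[of "x + D" x] by simp
  have "sinh D \<noteq> 0" using period_nonzero[OF assms(2)] x(5) by simp
  moreover have "cosh x / sinh x - cosh (x + D) / sinh (x + D) = sinh D / (sinh x * sinh (x + D))"
    unfolding D using x(6,7) by (simp add: diff_frac_eq mult.commute)
  ultimately show ?thesis unfolding x(1-4) x(5)[symmetric] by (simp add: divide_inverse)
qed

text \<open>A second use of the partial fraction: the mixed product of the csch at n + d with the
  coth at n is linear in csch again, by the addition formula for sinh. Summation over n then meets
  only csch and csch coth.\<close>

lemma csch_csch_square:
  assumes "z \<in> reg" "d \<noteq> 0"
  defines "D \<equiv> of_int d * of_real a :: complex"
  shows "csch n z * (csch (n + d) z)\<^sup>2 =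
    (csch n z - cosh D * csch (n + d) z) / (sinh D)\<^sup>2 - csch (n + d) z * coth (n + d) z / sinh D"
proof -
  obtain x D' where x: "csch n z = inverse (sinh x)" "coth n z = cosh x / sinh x"
    "csch (n + d) z = inverse (sinh (x + D'))" "coth (n + d) z = cosh (x + D') / sinh (x + D')"
    "D' = of_int d * of_real a" "sinh x \<noteq> 0" "sinh (x + D') \<noteq> 0" using csch_shift[OF assms(1)] by blast
  have [simp]: "D' = D" using x(5) by (simp add: D_def)
  have D: "sinh D \<noteq> 0" using period_nonzero[OF assms(2)] D_def by simp
  have "csch n z * (csch (n + d) z)\<^sup>2 = csch (n + d) z * (csch n z * csch (n + d) z)"
    by (simp add: power2_eq_square)
  also have "\<dots> = csch (n + d) z * (coth n z - coth (n + d) z) / sinh D"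
    unfolding csch_csch[OF assms(1,2)] D_def by simp
  also have "csch (n + d) z * coth n z = (csch n z - cosh D * csch (n + d) z) / sinh D"
  proof -
    define S where "S = sinh (x + D)"
    have S: "S \<noteq> 0" using x(7) by (simp add: S_def)
    have "cosh x = (S - cosh D * sinh x) / sinh D"
      using D sinh_add[of x D] by (simp add: S_def field_simps)
    then show ?thesis unfolding x(1-4) \<open>D' = D\<close> S_def[symmetric]
      using x(6) D S by (simp add: field_simps)
  qed
  then have "csch (n + d) z * (coth n z - coth (n + d) z) / sinh D =
     (csch n z - cosh D * csch (n + d) z) / (sinh D)\<^sup>2 - csch (n + d) z * coth (n + d) z / sinh D"
    by (simp add: right_diff_distrib diff_divide_distrib power2_eq_square)
  finally show ?thesis .
qed

lemma coth_limit:
  assumes "z \<in> reg" and s: "s = 1 \<or> s = - 1"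
  shows "(\<lambda>n. coth (s * int n) z) \<longlonglongrightarrow> of_int s"
proof -
  obtain B where B: "0 \<le> B" "\<And>n. norm (csch n z) \<le> B * q ^ nat \<bar>n\<bar>"
    using csch_bound_all[OF reg_Re[OF assms(1)]] by blast
  have lim: "(\<lambda>n. exp a * (B * q ^ n)) \<longlonglongrightarrow> 0"
    using LIMSEQ_power_zero[of q] q by (auto intro!: tendsto_mult_right_zero)
  have "(\<lambda>n. coth (s * int n) z - of_int s) \<longlonglongrightarrow> 0"
  proof (rule Lim_null_comparison[OF _ lim], intro always_eventually allI)
    fix n
    define w where "w = z + of_int (s * int n) * of_real a"
    have nz: "sinh w \<noteq> 0" unfolding w_def by (rule reg_nonzero[OF assms(1)])
    have "cosh w - of_int s * sinh w = exp (- of_int s * w)"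
      using s cosh_minus_sinh[of w] cosh_plus_sinh[of w] by auto
    then have "coth (s * int n) z - of_int s = exp (- of_int s * w) * csch (s * int n) z"
      unfolding coth_def csch_def w_def[symmetric] using nz by (simp add: field_simps)
    also have "norm \<dots> = exp (- of_int s * Re w) * norm (csch (s * int n) z)"
      using s by (auto simp: norm_mult norm_exp_eq_Re)
    also have "\<dots> \<le> exp a * (B * q ^ n)"
    proof (rule mult_mono)
      have "0 \<le> real n * a" using a_pos by simp
      moreover have "- of_int s * Re w = - of_int s * Re z - real n * a" using s by (auto simp: w_def)
      moreover have "- of_int s * Re z \<le> \<bar>Re z\<bar>" using s by auto
      ultimately have "- of_int s * Re w \<le> a" using reg_Re[OF assms(1)] by linarith
      then show "exp (- of_int s * Re w) \<le> exp a" by simp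
      have "nat \<bar>s * int n\<bar> = n" using s by auto
      then show "norm (csch (s * int n) z) \<le> B * q ^ n" using B(2)[of "s * int n"] by simp
    qed auto
    finally show "norm (coth (s * int n) z - of_int s) \<le> exp a * (B * q ^ n)" .
  qed
  then show ?thesis by (simp only: LIM_zero_iff)
qed

lemma coth_telescope:
  assumes "z \<in> reg"
  shows "((\<lambda>n. coth n z - coth (n + d) z) has_sum (- 2 * of_int d)) UNIV"
proof -
  obtain B where B: "\<And>n. norm (csch n z) \<le> B" using csch_bounded[OF reg_Re[OF assms]] by blast
  have "(\<lambda>n. csch n z * csch (n + 1) z) summable_on UNIV"
    by (rule csch_mult_summable[OF reg_Re[OF assms]]) (rule B)
  from summable_on_cmult_left[OF this, of "sinh (of_int 1 * of_real a)"]
  have "(\<lambda>n. coth n z - coth (n + 1) z) summable_on UNIV"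
    using csch_csch[OF assms, of 1] period_nonzero[of 1] by simp
  from has_sum_int_telescope[OF this, of 1 "- 1" d] coth_limit[OF assms, of 1] coth_limit[OF assms, of "- 1"]
  show ?thesis by (simp add: scaleR_conv_of_real mult.commute)
qed

text \<open>Up to sign, these collect the diagonals with nonzero d in H^2 and, apart from the factor
  H, in H V. At d = 0 both summands are 0 through division by zero, which leaves out the main
  diagonal.\<close>

definition C :: complex where "C = (\<Sum>\<^sub>\<infinity>d. 2 * of_int d / sinh (of_int d * of_real a))"
definition C3 :: complex where
  "C3 = (\<Sum>\<^sub>\<infinity>d. (cosh (of_int d * of_real a) - 1) / (sinh (of_int d * of_real a))\<^sup>2)"

lemma has_sum_at_0: "((\<lambda>d. if d = 0 then v else 0) has_sum v) (UNIV :: int set)"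
proof -
  have "((\<lambda>d. if d = 0 then v else 0) has_sum v) {0 :: int}" by (rule has_sum_finiteI) auto
  then show ?thesis by (rule has_sum_cong_neutral[THEN iffD1, rotated 3]) auto
qed

lemma H_square:
  assumes "z \<in> reg"
  shows "(H z)\<^sup>2 = V z - C"
proof -
  note R = reg_Re[OF assms]
  have inner: "((\<lambda>n. csch n z * csch (n + d) z) has_sum
      ((if d = 0 then V z else 0) - 2 * of_int d / sinh (of_int d * of_real a))) UNIV" for d
  proof (cases "d = 0")
    case True
    then show ?thesis using csch_summable(4)[OF R] by (simp add: V_def power2_eq_square)
  next
    case False
    have "((\<lambda>n. (coth n z - coth (n + d) z) * inverse (sinh (of_int d * of_real a))) has_sum
        ((- 2 * of_int d) * inverse (sinh (of_int d * of_real a)))) UNIV"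
      by (rule has_sum_cmult_left[OF coth_telescope[OF assms]])
    then show ?thesis using False by (simp add: csch_csch[OF assms] divide_inverse)
  qed
  from has_sum_int_convolution[OF csch_summable(1)[OF R] csch_summable(1)[OF R] this]
  have "((\<lambda>d. (if d = 0 then V z else 0) - 2 * of_int d / sinh (of_int d * of_real a)) has_sum (H z)\<^sup>2) UNIV"
    by (simp add: H_def power2_eq_square)
  \<comment> \<open>Removing the diagonal d = 0 leaves the series of \<open>C\<close>, so its
    convergence comes together with its value.\<close>
  from has_sum_diff[OF has_sum_at_0[of "V z"] this]
  have "((\<lambda>d. 2 * of_int d / sinh (of_int d * of_real a)) has_sum (V z - (H z)\<^sup>2)) UNIV" by simp
  then show ?thesis by (simp add: C_def infsumI)
qed

text \<open>On a diagonal with nonzero d the sum of csch coth appears with the coefficient - 1/sinh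
  (d a), which is odd in d; adding the reflected series removes it.\<close>

lemma H_V:
  assumes "z \<in> reg"
  shows "H z * V z = V3 z - C3 * H z"
proof -
  note R = reg_Re[OF assms]
  define P where "P = (\<Sum>\<^sub>\<infinity>n. csch n z * coth n z)"
  have sh: "((\<lambda>n. csch n z) has_sum H z) UNIV" "((\<lambda>n. csch n z * coth n z) has_sum P) UNIV"
    using csch_summable(2)[OF R] csch_coth_summable[OF assms] by (simp_all add: H_def P_def)
  have sh': "((\<lambda>n. csch (n + d) z) has_sum H z) UNIV"
     "((\<lambda>n. csch (n + d) z * coth (n + d) z) has_sum P) UNIV" for d
    using sh has_sum_int_shift[of "\<lambda>n. csch n z" d] has_sum_int_shift[of "\<lambda>n. csch n z * coth n z" d] by auto
  have inner: "((\<lambda>n. csch n z * (csch (n + d) z)\<^sup>2) has_sum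
      ((if d = 0 then V3 z else 0) +
       ((H z - cosh (of_int d * of_real a) * H z) / (sinh (of_int d * of_real a))\<^sup>2
         - P / sinh (of_int d * of_real a)))) UNIV" for d
  proof (cases "d = 0")
    case True
    then show ?thesis using csch_summable(5)[OF R] by (simp add: V3_def power2_eq_square power3_eq_cube mult.assoc)
  next
    case False
    define D where "D = of_int d * complex_of_real a"
    have "((\<lambda>n. (csch n z - cosh D * csch (n + d) z) * inverse ((sinh D)\<^sup>2)
        - csch (n + d) z * coth (n + d) z * inverse (sinh D)) has_sum
        ((H z - cosh D * H z) * inverse ((sinh D)\<^sup>2) - P * inverse (sinh D))) UNIV"
      by (intro has_sum_diff has_sum_cmult_left has_sum_cmult_right sh sh')
    then show ?thesis using False by (simp add: csch_csch_square[OF assms] divide_inverse D_def)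
  qed
  from has_sum_int_convolution[OF csch_summable(1)[OF R] csch_summable(3)[OF R] this]
  have 1: "((\<lambda>d. (if d = 0 then V3 z else 0) +
       ((H z - cosh (of_int d * of_real a) * H z) / (sinh (of_int d * of_real a))\<^sup>2
         - P / sinh (of_int d * of_real a))) has_sum (H z * V z)) UNIV"
    by (simp add: H_def V_def)
  from has_sum_diff[OF has_sum_at_0[of "V3 z"] this]
  have 2: "((\<lambda>d. H z * ((cosh (of_int d * of_real a) - 1) / (sinh (of_int d * of_real a))\<^sup>2)
         + P * (1 / sinh (of_int d * of_real a))) has_sum (V3 z - H z * V z)) UNIV"
    by (rule has_sum_cong[THEN iffD1, rotated]) (simp add: diff_divide_distrib algebra_simps)
  define X where "X = V3 z - H z * V z"
  have 3: "((\<lambda>d. H z * ((cosh (of_int d * of_real a) - 1) / (sinh (of_int d * of_real a))\<^sup>2)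
         - P * (1 / sinh (of_int d * of_real a))) has_sum X) UNIV"
  proof -
    have "bij (uminus :: int \<Rightarrow> int)" by (rule bij_uminus)
    from has_sum_reindex_bij_betw[OF this, of "\<lambda>d. H z * ((cosh (of_int d * of_real a) - 1) / (sinh (of_int d * of_real a))\<^sup>2)
         + P * (1 / sinh (of_int d * of_real a))"] 2
    show ?thesis by (simp add: X_def)
  qed
  from has_sum_add[OF 2 3]
  have "((\<lambda>d. 2 * H z * ((cosh (of_int d * of_real a) - 1) / (sinh (of_int d * of_real a))\<^sup>2)) has_sum (2 * X)) UNIV"
    by (simp add: X_def[symmetric] mult.assoc)
  then have "infsum (\<lambda>d. 2 * H z * ((cosh (of_int d * of_real a) - 1) / (sinh (of_int d * of_real a))\<^sup>2)) UNIV = 2 * X"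
    by (rule infsumI)
  moreover have "infsum (\<lambda>d. 2 * H z * ((cosh (of_int d * of_real a) - 1) / (sinh (of_int d * of_real a))\<^sup>2)) UNIV = 2 * H z * C3"
    unfolding C3_def by (rule infsum_cmult_right')
  ultimately have "2 * H z * C3 = 2 * X" by (simp only:)
  then have "X = H z * C3" by simp
  then show ?thesis by (simp add: X_def algebra_simps)
qed

text \<open>Each csch satisfies csch'' = csch + 2 csch^3. Eliminating the sum of cubes by the two
  product formulas gives an equation of the same shape for the lattice sum, with another linear
  coefficient.\<close>

lemma H2_ode:
  assumes "z \<in> reg"
  shows "H2 z = 2 * H z ^ 3 + (1 + 2 * C + 2 * C3) * H z"
proof -
  note R = reg_Re[OF assms]
  have "H2 z = H z + 2 * V3 z"
    unfolding H2_def H_def V3_def using csch_summable[OF R]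
    by (simp add: infsum_add summable_on_cmult_right infsum_cmult_right')
  moreover have "H z * V z = H z ^ 3 + C * H z"
  proof -
    have "H z ^ 3 = H z * (H z)\<^sup>2" by (simp add: power2_eq_square power3_eq_cube)
    then show ?thesis unfolding H_square[OF assms] by (simp add: algebra_simps)
  qed
  moreover have "V3 z = H z * V z + C3 * H z" using H_V[OF assms] by simp
  ultimately show ?thesis by (simp only: algebra_simps mult_2 mult_1)
qed

end

section \<open>The differential equation\<close>

lemma infsum_of_real_multiple:
  fixes f :: "'a \<Rightarrow> complex"
  assumes "r summable_on A" "\<And>n. n \<in> A \<Longrightarrow> f n = c * of_real (r n)"
  shows "infsum f A = c * of_real (infsum r A)"
proof -
  have "((\<lambda>n. c * of_real (r n)) has_sum c * of_real (infsum r A)) A"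
    using assms(1) by (intro has_sum_cmult_right has_sum_of_real) simp
  then have "infsum (\<lambda>n. c * of_real (r n)) A = c * of_real (infsum r A)" by (rule infsumI)
  moreover have "infsum f A = infsum (\<lambda>n. c * of_real (r n)) A" by (rule infsum_cong) (rule assms(2))
  ultimately show ?thesis by simp
qed

lemma inverse_imaginary: "inverse (\<i> * of_real r) = - \<i> * of_real (1 / r)"
  by (cases "r = 0") (simp_all add: field_simps)

lemma norm_sinh_le: "norm (sinh (z :: complex)) \<le> exp \<bar>Re z\<bar>"
proof -
  have "norm (exp z - exp (- z)) \<le> norm (exp z) + norm (exp (- z))" by (rule norm_triangle_ineq4)
  also have "\<dots> \<le> exp \<bar>Re z\<bar> + exp \<bar>Re z\<bar>" unfolding norm_exp_eq_Re by (intro add_mono) auto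
  finally show ?thesis by (simp add: sinh_field_def norm_divide)
qed

context csch_lattice
begin

text \<open>A convex pole-free triangle containing the segments \<open>(0, a/2]\<close> and \<open>[a/2, a/2 + \<i>\<pi>/2]\<close>
  along which the elliptic integrals are taken, and the critical point \<open>\<i>\<pi>/2\<close> of \<open>H\<close>.\<close>
definition Q :: "complex set" where
  "Q = {z. Re z < a \<and> Im z < pi \<and> 0 < pi * Re z + a * Im z}"

lemma open_Q: "open Q"
proof -
  have "Q = {z. Re z < a} \<inter> {z. Im z < pi} \<inter> {z. 0 < pi * Re z + a * Im z}" by (auto simp: Q_def)
  then show ?thesis by (auto intro!: open_Int open_Collect_less continuous_intros)
qed

lemma convex_Q: "convex Q"
proof -
  have "Q = {z. Re z < a} \<inter> {z. Im z < pi} \<inter> {z. inner (Complex pi a) z > 0}"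
    by (auto simp: Q_def inner_complex_def)
  then show ?thesis
    by (simp add: convex_Int convex_halfspace_Re_lt convex_halfspace_Im_lt convex_halfspace_gt)
qed

lemma Q_bounds:
  assumes "z \<in> Q"
  shows "\<bar>Re z\<bar> < a" "\<bar>Im z\<bar> < pi"
proof -
  have "a * Im z < a * pi" "pi * Re z < pi * a" "0 < pi * Re z + a * Im z"
    using assms a_pos by (auto simp: Q_def)
  then have "pi * (- Re z) < pi * a" "a * (- Im z) < a * pi" by (simp_all only: mult_minus_right mult.commute[of a pi])
  then have "- Re z < a" "- Im z < pi"
    using a_pos pi_gt_zero mult_less_cancel_left_pos[of pi "- Re z" a] mult_less_cancel_left_pos[of a "- Im z" pi] by auto
  then show "\<bar>Re z\<bar> < a" "\<bar>Im z\<bar> < pi" using assms by (auto simp: Q_def)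
qed

lemma Q_reg: "Q \<subseteq> reg"
proof
  fix z assume z: "z \<in> Q"
  have "sinh (z + of_int n * of_real a) \<noteq> 0" for n
  proof
    assume 0: "sinh (z + of_int n * of_real a) = 0"
    have "Re z + of_int n * a = 0" using norm_sinh_ge[of "z + of_int n * of_real a"] 0 by simp
    then have Re: "Re z = - of_int n * a" by simp
    then have "\<bar>of_int n\<bar> * a < 1 * a" using Q_bounds(1)[OF z] a_pos by (simp add: abs_mult)
    then have "\<bar>real_of_int n\<bar> < 1" using a_pos mult_less_cancel_right_pos by blast
    then have "n = 0" by linarith
    then have "z = \<i> * of_real (Im z)" "Re z = 0" using Re by (auto simp: complex_eq_iff)
    then have "sin (Im z) = 0" using 0 \<open>n = 0\<close> sinh_imaginary[of "Im z"] by simp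
    then have "Im z = 0" using Q_bounds(2)[OF z] sin_zero_pi_iff by blast
    then show False using z \<open>Re z = 0\<close> by (simp add: Q_def)
  qed
  then show "z \<in> reg" using Q_bounds[OF z] by (simp add: reg_def)
qed

lemma csch_has_derivative:
  assumes "z \<in> reg"
  shows "(csch n has_field_derivative - (csch n z * coth n z)) (at z)"
  unfolding csch_def[abs_def] coth_def
  using reg_nonzero[OF assms, of n]
  by (auto intro!: derivative_eq_intros simp: power2_eq_square)

lemma coth_has_derivative:
  assumes "z \<in> reg"
  shows "(coth n has_field_derivative - (csch n z)\<^sup>2) (at z)"
proof -
  have "((\<lambda>z. cosh (z + of_int n * of_real a)) has_field_derivative sinh (z + of_int n * of_real a)) (at z)"
    by (auto intro!: derivative_eq_intros)
  from DERIV_mult[OF this csch_has_derivative[OF assms, of n]]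
  have "(coth n has_field_derivative
     sinh (z + of_int n * of_real a) * csch n z + - (csch n z * coth n z) * cosh (z + of_int n * of_real a)) (at z)"
    unfolding coth_def[abs_def] by simp
  also have "sinh (z + of_int n * of_real a) * csch n z + - (csch n z * coth n z) * cosh (z + of_int n * of_real a)
      = 1 - (coth n z)\<^sup>2"
    using reg_nonzero[OF assms, of n] by (simp add: csch_def coth_def power2_eq_square)
  finally show ?thesis by (simp add: coth_square[OF assms])
qed

definition B0 :: real where "B0 = 2 * exp a / (1 - exp (- 2 * a))"

lemma B0: "0 \<le> B0" using a_pos by (simp add: B0_def)

text \<open>The three terms left out have poles on the boundary of \<open>Q\<close> and are
  unbounded there; the others admit constants independent of z.\<close>

lemma csch_bound_Q:
  assumes "n \<notin> {-1,0,1}" "z \<in> Q"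
  shows "norm (csch n z) \<le> B0 * q ^ nat \<bar>n\<bar>" "norm (csch n z) \<le> B0" "norm (coth n z) \<le> 1 + B0"
proof -
  have n: "2 \<le> \<bar>n\<bar>" using assms(1) by auto
  show 1: "norm (csch n z) \<le> B0 * q ^ nat \<bar>n\<bar>" unfolding B0_def by (rule csch_bound[OF Q_bounds(1)[OF assms(2)] n])
  have "B0 * q ^ nat \<bar>n\<bar> \<le> B0 * 1" using B0 q by (intro mult_left_mono power_le_one) auto
  with 1 show 2: "norm (csch n z) \<le> B0" by linarith
  show "norm (coth n z) \<le> 1 + B0" using norm_coth_le[OF _ 2] Q_reg assms(2) by blast
qed

lemma summable_q: "(\<lambda>n::int. K * q ^ nat \<bar>n\<bar>) summable_on UNIV"
  by (intro summable_on_cmult_right summable_on_int_power q)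

lemma H_has_derivative:
  assumes "z \<in> Q"
  shows "(H has_field_derivative H1 z) (at z)"
  unfolding H_def[abs_def] H1_def
proof (rule infsum_int_has_derivative[where F = "{-1,0,1}", OF open_Q assms _ summable_q])
  fix z n assume z: "z \<in> Q"
  note r = subsetD[OF Q_reg z]
  show "(csch n has_field_derivative - (csch n z * coth n z)) (at z)" by (rule csch_has_derivative[OF r])
  show "(\<lambda>n. csch n z) summable_on UNIV" by (rule csch_summable(2)[OF reg_Re[OF r]])
  show "(\<lambda>n. - (csch n z * coth n z)) summable_on UNIV"
    unfolding summable_on_uminus by (rule csch_coth_summable[OF r])
qed (simp, rule csch_bound_Q(1))

lemma H1_has_derivative:
  assumes "z \<in> Q"
  shows "(H1 has_field_derivative H2 z) (at z)"
  unfolding H1_def[abs_def] H2_def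
proof (rule infsum_int_has_derivative[where F = "{-1,0,1}", OF open_Q assms _ summable_q])
  fix z n assume z: "z \<in> Q"
  note r = subsetD[OF Q_reg z]
  have "((\<lambda>z. - (csch n z * coth n z)) has_field_derivative
     - (- (csch n z * coth n z) * coth n z + - (csch n z)\<^sup>2 * csch n z)) (at z)"
    by (intro DERIV_minus DERIV_mult csch_has_derivative coth_has_derivative r)
  also have "- (- (csch n z * coth n z) * coth n z + - (csch n z)\<^sup>2 * csch n z) = csch n z * (coth n z)\<^sup>2 + csch n z ^ 3"
    by (simp add: power2_eq_square power3_eq_cube)
  also have "\<dots> = csch n z + 2 * csch n z ^ 3"
    unfolding coth_square[OF r] by (simp add: power2_eq_square power3_eq_cube algebra_simps)
  finally show "((\<lambda>z. - (csch n z * coth n z)) has_field_derivative (csch n z + 2 * csch n z ^ 3)) (at z)" .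
  show "(\<lambda>n. - (csch n z * coth n z)) summable_on UNIV"
    unfolding summable_on_uminus by (rule csch_coth_summable[OF r])
  show "(\<lambda>n. csch n z + 2 * csch n z ^ 3) summable_on UNIV"
    by (intro summable_on_add summable_on_cmult_right csch_summable[OF reg_Re[OF r]])
next
  fix n z assume nz: "n \<notin> {-1,0,1::int}" "z \<in> Q"
  have "norm (csch n z) * norm (coth n z) \<le> (B0 * q ^ nat \<bar>n\<bar>) * (1 + B0)"
    using csch_bound_Q[OF nz] B0 q by (intro mult_mono) auto
  then show "norm (- (csch n z * coth n z)) \<le> (B0 * (1 + B0)) * q ^ nat \<bar>n\<bar>"
    by (simp only: norm_minus_cancel norm_mult mult_ac)
qed simp

lemma half_period_Q: "of_real (a / 2) \<in> Q"
  using a_pos by (simp add: Q_def)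

lemma coth_diff:
  assumes "z \<in> reg" "p \<in> reg"
  shows "coth n z - coth n p = csch n z * csch n p * sinh (p - z)"
proof -
  define x where "x = z + of_int n * of_real a"
  define y where "y = p + of_int n * of_real a"
  have nz: "sinh x \<noteq> 0" "sinh y \<noteq> 0" using assms reg_nonzero by (auto simp: x_def y_def)
  have "p - z = y - x" by (simp add: x_def y_def)
  then have "sinh (p - z) = sinh y * cosh x - cosh y * sinh x" by (simp add: sinh_diff)
  then show ?thesis unfolding coth_def csch_def x_def[symmetric] y_def[symmetric]
    using nz by (simp add: field_simps)
qed

text \<open>A primitive of - V, in the role of a Weierstrass zeta function. The terms coth tend to 1
  and - 1 at the two ends; subtracting their values at a/2 leaves differences that decay
  geometrically, by \<open>coth_diff\<close>.\<close>

definition T :: "complex \<Rightarrow> complex" where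
  "T z = (\<Sum>\<^sub>\<infinity>n. coth n z - coth n (of_real (a / 2)))"

lemma T_has_derivative:
  assumes "z \<in> Q"
  shows "(T has_field_derivative - V z) (at z)"
proof -
  define p where "p = complex_of_real (a / 2)"
  have pQ: "p \<in> Q" using half_period_Q by (simp add: p_def)
  note pr = subsetD[OF Q_reg pQ]
  have "((\<lambda>z. infsum (\<lambda>n. coth n z - coth n p) UNIV) has_field_derivative infsum (\<lambda>n. - (csch n z)\<^sup>2) UNIV) (at z)"
  proof (rule infsum_int_has_derivative[where F = "{-1,0,1}", OF open_Q assms _ summable_q])
    fix z n assume z: "z \<in> Q"
    note r = subsetD[OF Q_reg z]
    show "((\<lambda>z. coth n z - coth n p) has_field_derivative - (csch n z)\<^sup>2) (at z)"
      using DERIV_diff[OF coth_has_derivative[OF r, of n] DERIV_const] by simp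
    obtain B where B: "\<And>n. norm (csch n p) \<le> B" using csch_bounded[OF reg_Re[OF pr]] by blast
    have "(\<lambda>n. csch n z * csch n p) summable_on UNIV"
      by (rule csch_mult_summable(2)[OF reg_Re[OF r]]) (rule B)
    then show "(\<lambda>n. coth n z - coth n p) summable_on UNIV"
      unfolding coth_diff[OF r pr] by (rule summable_on_cmult_left)
    show "(\<lambda>n. - (csch n z)\<^sup>2) summable_on UNIV"
      unfolding summable_on_uminus by (rule csch_summable(4)[OF reg_Re[OF r]])
  next
    fix n z assume nz: "n \<notin> {-1,0,1::int}" "z \<in> Q"
    note r = subsetD[OF Q_reg nz(2)]
    have "\<bar>Re (p - z)\<bar> \<le> 2 * a" using reg_Re[OF r] reg_Re[OF pr] by simp
    then have s: "norm (sinh (p - z)) \<le> exp (2 * a)" by (intro order_trans[OF norm_sinh_le]) simp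
    have "norm (csch n z) * norm (csch n p) * norm (sinh (p - z)) \<le> (B0 * q ^ nat \<bar>n\<bar>) * B0 * exp (2 * a)"
      using csch_bound_Q[OF nz] csch_bound_Q[OF nz(1) pQ] B0 q s by (intro mult_mono) auto
    then show "norm (coth n z - coth n p) \<le> (B0 * B0 * exp (2 * a)) * q ^ nat \<bar>n\<bar>"
      unfolding coth_diff[OF r pr] by (simp only: norm_mult mult_ac)
  qed simp
  then show ?thesis by (simp add: T_def[abs_def] V_def p_def infsum_uminus)
qed

text \<open>In classical terms \<open>al\<close> and \<open>ga\<close> are theta_3(q)^2 and
  theta_2(q)^2. They are the values of i H at \<open>p0\<close> and \<open>p1\<close>;
  \<open>Y2\<close> and \<open>Y3\<close> are those of - V there, and \<open>Y4\<close> is that of V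
  at \<open>p2\<close>.\<close>

definition al :: real where "al = (\<Sum>\<^sub>\<infinity>n::int. 1 / cosh (of_int n * a))"
definition ga :: real where "ga = (\<Sum>\<^sub>\<infinity>n::int. 1 / cosh ((of_int n + 1/2) * a))"
definition Y2 :: real where "Y2 = (\<Sum>\<^sub>\<infinity>n::int. 1 / (cosh (of_int n * a))\<^sup>2)"
definition Y3 :: real where "Y3 = (\<Sum>\<^sub>\<infinity>n::int. 1 / (cosh ((of_int n + 1/2) * a))\<^sup>2)"
definition Y4 :: real where "Y4 = (\<Sum>\<^sub>\<infinity>n::int. 1 / (sinh ((of_int n + 1/2) * a))\<^sup>2)"

text \<open>\<open>p2\<close> is a zero of H; \<open>p0\<close> and \<open>p1\<close>, half an
  antiperiod above 0 and above a/2, are critical points. At all three the terms csch are real or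
  purely imaginary.\<close>

definition p0 :: complex where "p0 = \<i> * of_real (pi / 2)"
definition p1 :: complex where "p1 = of_real (a / 2) + \<i> * of_real (pi / 2)"
definition p2 :: complex where "p2 = of_real (a / 2)"

lemma points_Q: "p0 \<in> Q" "p1 \<in> Q" "p2 \<in> Q"
  using a_pos by (auto simp: Q_def p0_def p1_def p2_def intro!: add_pos_pos)

lemma sinh_quarter: "sinh (of_real y + \<i> * of_real (pi / 2)) = \<i> * of_real (cosh y)"
  unfolding sinh_add sinh_imaginary cosh_imaginary sinh_of_real_complex cosh_of_real_complex by simp

lemma cosh_quarter: "cosh (of_real y + \<i> * of_real (pi / 2)) = \<i> * of_real (sinh y)"
  unfolding cosh_add sinh_imaginary cosh_imaginary sinh_of_real_complex cosh_of_real_complex by simp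

lemma csch_points:
  "csch n p0 = - \<i> * of_real (1 / cosh (of_int n * a))"
  "csch n p1 = - \<i> * of_real (1 / cosh ((of_int n + 1/2) * a))"
  "csch n p2 = of_real (1 / sinh ((of_int n + 1/2) * a))"
proof -
  have "p0 + of_int n * of_real a = of_real (of_int n * a) + \<i> * of_real (pi / 2)" by (simp add: p0_def)
  then show "csch n p0 = - \<i> * of_real (1 / cosh (of_int n * a))"
    unfolding csch_def by (simp only: sinh_quarter inverse_imaginary)
  have "p1 + of_int n * of_real a = of_real ((of_int n + 1/2) * a) + \<i> * of_real (pi / 2)"
    by (simp add: p1_def algebra_simps)
  then show "csch n p1 = - \<i> * of_real (1 / cosh ((of_int n + 1/2) * a))"
    unfolding csch_def by (simp only: sinh_quarter inverse_imaginary)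
  have "p2 + of_int n * of_real a = of_real ((of_int n + 1/2) * a)"
    by (simp add: p2_def algebra_simps)
  then show "csch n p2 = of_real (1 / sinh ((of_int n + 1/2) * a))"
    unfolding csch_def by (simp only: sinh_of_real_complex) (simp add: inverse_eq_divide)
qed

lemma Y_summable:
  "(\<lambda>n::int. 1 / cosh (of_int n * a)) summable_on UNIV"
  "(\<lambda>n::int. 1 / cosh ((of_int n + 1/2) * a)) summable_on UNIV"
  "(\<lambda>n::int. 1 / (cosh (of_int n * a))\<^sup>2) summable_on UNIV"
  "(\<lambda>n::int. 1 / (cosh ((of_int n + 1/2) * a))\<^sup>2) summable_on UNIV"
  "(\<lambda>n::int. 1 / (sinh ((of_int n + 1/2) * a))\<^sup>2) summable_on UNIV"
  using csch_summable(1,3)[OF Q_bounds(1)[OF points_Q(1)]]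
    csch_summable(1,3)[OF Q_bounds(1)[OF points_Q(2)]]
    csch_summable(3)[OF Q_bounds(1)[OF points_Q(3)]]
  unfolding csch_points by (simp_all add: norm_mult norm_power norm_divide power_divide)

lemma H_points: "H p0 = - \<i> * of_real al" "H p1 = - \<i> * of_real ga" "H p2 = 0"
proof -
  show "H p0 = - \<i> * of_real al" unfolding H_def al_def
    by (rule infsum_of_real_multiple[OF Y_summable(1)]) (rule csch_points)
  show "H p1 = - \<i> * of_real ga" unfolding H_def ga_def
    by (rule infsum_of_real_multiple[OF Y_summable(2)]) (rule csch_points)
  show "H p2 = 0" unfolding H_def
  proof (rule infsum_int_antisymmetric[where d = "- 1"])
    fix n :: int
    have "(of_int (- 1 - n) + 1/2) * a = - ((of_int n + 1/2) * a)" by (simp add: algebra_simps)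
    then show "csch (- 1 - n) p2 = - csch n p2" unfolding csch_points by (simp only: sinh_minus) simp
  qed
qed

lemma V_points: "V p0 = - of_real Y2" "V p1 = - of_real Y3" "V p2 = of_real Y4"
proof -
  have "V p0 = (- 1) * of_real Y2" unfolding V_def Y2_def
    by (rule infsum_of_real_multiple[OF Y_summable(3)]) (simp add: csch_points power_mult_distrib power_divide)
  then show "V p0 = - of_real Y2" by simp
  have "V p1 = (- 1) * of_real Y3" unfolding V_def Y3_def
    by (rule infsum_of_real_multiple[OF Y_summable(4)]) (simp add: csch_points power_mult_distrib power_divide)
  then show "V p1 = - of_real Y3" by simp
  have "V p2 = 1 * of_real Y4" unfolding V_def Y4_def
    by (rule infsum_of_real_multiple[OF Y_summable(5)]) (simp add: csch_points power_divide)
  then show "V p2 = of_real Y4" by simp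
qed

lemma C_eq: "C = of_real Y4"
  using H_square[OF subsetD[OF Q_reg points_Q(3)]] by (simp add: H_points V_points)

lemma al_ga_square: "al\<^sup>2 = Y2 + Y4" "ga\<^sup>2 = Y3 + Y4"
proof -
  have "of_real (al\<^sup>2) = (of_real (Y2 + Y4) :: complex)"
    using H_square[OF subsetD[OF Q_reg points_Q(1)]]
    by (simp add: H_points V_points C_eq power_mult_distrib minus_equation_iff[of "_ ^ 2"] add.commute)
  then show "al\<^sup>2 = Y2 + Y4" by (simp only: of_real_eq_iff)
  have "of_real (ga\<^sup>2) = (of_real (Y3 + Y4) :: complex)"
    using H_square[OF subsetD[OF Q_reg points_Q(2)]]
    by (simp add: H_points V_points C_eq power_mult_distrib minus_equation_iff[of "_ ^ 2"] add.commute)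
  then show "ga\<^sup>2 = Y3 + Y4" by (simp only: of_real_eq_iff)
qed

text \<open>For nonzero d the summand is 1/(2 cosh^2 (d a / 2)), so the sum runs over the lattice of
  step a/2, whose even and odd points give \<open>Y2\<close> and \<open>Y3\<close>. The - 1 corrects
  d = 0, where the summand of \<open>C3\<close> is 0 instead of 1/2.\<close>

lemma C3_eq: "C3 = of_real ((Y2 + Y3 - 1) / 2)"
proof -
  define f where "f = (\<lambda>d::int. 1 / (cosh (of_int d * (a / 2)))\<^sup>2)"
  \<comment> \<open>The refined lattice supplies the summability of \<open>f\<close>.\<close>
  interpret half: csch_lattice "a / 2" by unfold_locales (use a_pos in simp)
  have f: "f summable_on UNIV" unfolding f_def by (rule half.Y_summable(3))
  have "infsum f UNIV = infsum (\<lambda>n. f (2 * n)) UNIV + infsum (\<lambda>n. f (2 * n + 1)) UNIV"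
    by (rule infsum_int_even_odd[OF f])
  also have "(\<lambda>n. f (2 * n)) = (\<lambda>n. 1 / (cosh (of_int n * a))\<^sup>2)" by (simp add: f_def)
  also have "(\<lambda>n. f (2 * n + 1)) = (\<lambda>n. 1 / (cosh ((of_int n + 1/2) * a))\<^sup>2)"
  proof
    fix n :: int
    have "of_int (2 * n + 1) * (a / 2) = (of_int n + 1/2) * a" by (simp add: algebra_simps)
    then show "f (2 * n + 1) = 1 / (cosh ((of_int n + 1/2) * a))\<^sup>2" by (simp only: f_def)
  qed
  finally have 1: "infsum f UNIV = Y2 + Y3" by (simp add: Y2_def Y3_def)
  have 2: "((\<lambda>d. f d - (if d = 0 then 1 else 0)) has_sum (Y2 + Y3 - 1)) UNIV"
    using f 1 by (intro has_sum_diff has_sum_at_0) (metis has_sum_infsum)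
  have "C3 = (1/2) * of_real (infsum (\<lambda>d. f d - (if d = 0 then 1 else 0)) UNIV)"
    unfolding C3_def
  proof (rule infsum_of_real_multiple)
    show "(\<lambda>d. f d - (if d = 0 then 1 else 0)) summable_on UNIV" using 2 by (rule has_sum_imp_summable)
    fix d :: int
    show "(cosh (of_int d * of_real a) - 1) / (sinh (of_int d * of_real a :: complex))\<^sup>2 =
        1 / 2 * of_real (f d - (if d = 0 then 1 else 0))"
    proof (cases "d = 0")
      case True then show ?thesis by (simp add: f_def)
    next
      case False
      define t where "t = of_int d * (a / 2)"
      have t: "sinh t \<noteq> 0" using False a_pos by (simp add: t_def)
      have "of_int d * complex_of_real a = of_real (2 * t)" by (simp add: t_def)
      then have "(cosh (of_int d * of_real a) - 1) / (sinh (of_int d * of_real a :: complex))\<^sup>2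
         = of_real ((cosh (2 * t) - 1) / (sinh (2 * t))\<^sup>2)"
        by (simp only: cosh_of_real_complex sinh_of_real_complex) simp
      also have "(cosh (2 * t) - 1) / (sinh (2 * t))\<^sup>2 = 1 / 2 * f d"
      proof -
        have "cosh (2 * t) - 1 = 2 * (sinh t)\<^sup>2" by (simp add: cosh_double cosh_square_eq)
        then show ?thesis unfolding sinh_double f_def t_def[symmetric]
          using t cosh_real_pos[of t] by (simp add: power_mult_distrib divide_simps del: sinh_real_zero_iff)
      qed
      finally show ?thesis using False by simp
    qed
  qed
  also have "infsum (\<lambda>d. f d - (if d = 0 then 1 else 0)) UNIV = Y2 + Y3 - 1" using 2 by (rule infsumI)
  finally show ?thesis by simp
qed

text \<open>The special values identify 1 + 2 C + 2 C3 with al^2 + ga^2, and this is what lets the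
  first integral factor.\<close>

lemma H2_eq:
  assumes "z \<in> Q"
  shows "H2 z = 2 * H z ^ 3 + of_real (al\<^sup>2 + ga\<^sup>2) * H z"
proof -
  have "1 + 2 * C + 2 * C3 = complex_of_real (al\<^sup>2 + ga\<^sup>2)"
    by (simp add: C_eq C3_eq al_ga_square add_divide_distrib diff_divide_distrib)
  then show ?thesis using H2_ode[OF subsetD[OF Q_reg assms]] by (simp only:)
qed

lemma H1_p0: "H1 p0 = 0"
  unfolding H1_def
proof (rule infsum_int_antisymmetric[where d = 0])
  fix n :: int
  have "coth n p0 = \<i> * of_real (sinh (of_int n * a)) * csch n p0" for n
    using cosh_quarter[of "of_int n * a"] unfolding coth_def p0_def by (simp add: add.commute)
  then show "- (csch (0 - n) p0 * coth (0 - n) p0) = - (- (csch n p0 * coth n p0))"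
    by (simp add: csch_points)
qed

text \<open>By the second-order equation H1^2 - H^4 - (al^2 + ga^2) H^2 is constant on the convex
  set \<open>Q\<close>. At the critical point \<open>p0\<close>, where H^2 = - al^2, it equals al^2
  ga^2.\<close>

theorem H1_square:
  assumes "z \<in> Q"
  shows "(H1 z)\<^sup>2 = ((H z)\<^sup>2 + of_real (al\<^sup>2)) * ((H z)\<^sup>2 + of_real (ga\<^sup>2))"
proof -
  define L where "L = complex_of_real (al\<^sup>2 + ga\<^sup>2)"
  define F where "F = (\<lambda>z. (H1 z)\<^sup>2 - (H z) ^ 4 - L * (H z)\<^sup>2)"
  have "(F has_field_derivative 0) (at z within Q)" if z: "z \<in> Q" for z
  proof -
    note d = H_has_derivative[OF z] H1_has_derivative[OF z]
    have "(F has_field_derivative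
       (of_nat 2 * (H2 z * H1 z ^ (2 - Suc 0)) - of_nat 4 * (H1 z * H z ^ (4 - Suc 0))
         - L * (of_nat 2 * (H1 z * H z ^ (2 - Suc 0))))) (at z)"
      unfolding F_def by (intro DERIV_diff DERIV_power DERIV_cmult d)
    also have "(of_nat 2 * (H2 z * H1 z ^ (2 - Suc 0)) - of_nat 4 * (H1 z * H z ^ (4 - Suc 0))
         - L * (of_nat 2 * (H1 z * H z ^ (2 - Suc 0)))) = 0"
      unfolding H2_eq[OF z] L_def[symmetric] by (simp add: algebra_simps)
    finally show ?thesis by (rule has_field_derivative_at_within)
  qed
  then obtain c where c: "\<And>z. z \<in> Q \<Longrightarrow> F z = c"
    using has_field_derivative_zero_constant[OF convex_Q] by metis
  have "F z = F p0" using c assms points_Q by simp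
  also have "F p0 = of_real (al\<^sup>2 * ga\<^sup>2)"
    unfolding F_def H1_p0 H_points L_def by (simp add: power_mult_distrib algebra_simps power2_eq_square power4_eq_xxxx)
  finally have "(H1 z)\<^sup>2 = H z ^ 4 + L * (H z)\<^sup>2 + of_real (al\<^sup>2 * ga\<^sup>2)"
    by (simp add: F_def algebra_simps)
  then show ?thesis by (simp add: L_def algebra_simps power2_eq_square power4_eq_xxxx)
qed

end

section \<open>Periods\<close>

lemma sinh_cnj: "sinh (cnj z) = cnj (sinh z)" and cosh_cnj: "cosh (cnj z) = cnj (cosh z)"
  by (simp_all add: sinh_field_def cosh_field_def exp_cnj flip: complex_cnj_minus)

lemma Im_inverse_sinh: "- Im (inverse (sinh (Complex x y))) = cosh x * sin y / (norm (sinh (Complex x y)))\<^sup>2"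
  by (simp add: sinh_rectangular cmod_def)

section \<open>Symmetries, signs and the vertical segment\<close>

context csch_lattice
begin

lemma csch_symmetries:
  "csch n (cnj z) = cnj (csch n z)" "csch (- n) (- z) = - csch n z" "csch n (z + of_real a) = csch (n + 1) z"
  "coth n (cnj z) = cnj (coth n z)" "coth (- n) (- z) = - coth n z" "coth n (z + of_real a) = coth (n + 1) z"
proof -
  have 1: "cnj z + of_int n * of_real a = cnj (z + of_int n * of_real a)" by simp
  have 2: "- z + of_int (- n) * of_real a = - (z + of_int n * of_real a)" by simp
  have 3: "z + of_real a + of_int n * of_real a = z + of_int (n + 1) * of_real a" by (simp add: algebra_simps)
  show c: "csch n (cnj z) = cnj (csch n z)" "csch (- n) (- z) = - csch n z"
    "csch n (z + of_real a) = csch (n + 1) z"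
    unfolding csch_def 1 2 3 sinh_cnj sinh_minus by simp_all
  show "coth n (cnj z) = cnj (coth n z)" "coth (- n) (- z) = - coth n z" "coth n (z + of_real a) = coth (n + 1) z"
    unfolding coth_def c 1 2 3 cosh_cnj cosh_minus by simp_all
qed

lemma H_symmetries:
  "H (cnj z) = cnj (H z)" "H (- z) = - H z" "H (z + of_real a) = H z"
  "H1 (cnj z) = cnj (H1 z)" "H1 (- z) = H1 z" "H1 (z + of_real a) = H1 z"
proof -
  show "H (cnj z) = cnj (H z)" "H1 (cnj z) = cnj (H1 z)"
    by (simp_all add: H_def H1_def csch_symmetries flip: infsum_cnj)
  have "H (- z) = infsum (\<lambda>n. csch (0 - n) (- z)) UNIV"
    unfolding H_def by (rule infsum_int_reflect[of "\<lambda>n. csch n (- z)" 0, symmetric])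
  then show "H (- z) = - H z" by (simp add: csch_symmetries H_def infsum_uminus)
  have "H1 (- z) = infsum (\<lambda>n. - (csch (0 - n) (- z) * coth (0 - n) (- z))) UNIV"
    unfolding H1_def using infsum_int_reflect[of "\<lambda>n. - (csch n (- z) * coth n (- z))" 0] by simp
  then show "H1 (- z) = H1 z" by (simp add: csch_symmetries H1_def)
  show "H (z + of_real a) = H z"
    unfolding H_def csch_symmetries by (rule infsum_int_shift)
  show "H1 (z + of_real a) = H1 z"
    unfolding H1_def csch_symmetries by (rule infsum_int_shift[of "\<lambda>n. - (csch n z * coth n z)"])
qed

text \<open>On Re z = a/2 conjugation coincides with z -> a - z, under which H changes sign and H1
  does not.\<close>

lemma half_period_line:
  "H (p2 + \<i> * of_real v) = - \<i> * of_real (- Im (H (p2 + \<i> * of_real v)))" "Im (H1 (p2 + \<i> * of_real v)) = 0"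
proof -
  define z where "z = p2 + \<i> * complex_of_real v"
  have z: "cnj z = - z + of_real a" by (simp add: z_def p2_def complex_eq_iff)
  have "cnj (H z) = - H z" using H_symmetries(1,2)[of z] H_symmetries(3)[of "- z"] z by simp
  moreover have "cnj (H1 z) = H1 z" using H_symmetries(4,5)[of z] H_symmetries(6)[of "- z"] z by simp
  ultimately have "Re (H z) = 0" "Im (H1 z) = 0" by (simp_all add: complex_eq_iff)
  then show "H (p2 + \<i> * of_real v) = - \<i> * of_real (- Im (H (p2 + \<i> * of_real v)))"
     "Im (H1 (p2 + \<i> * of_real v)) = 0"
    unfolding z_def[symmetric] by (simp_all add: complex_eq_iff)
qed

lemma real_axis: "H (of_real x) = of_real (Re (H (of_real x)))" "H1 (of_real x) = of_real (Re (H1 (of_real x)))"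
  using H_symmetries(1,4)[of "of_real x"] by (simp_all add: complex_eq_iff)

text \<open>Since sin v > 0, every term of the series of - Im H is positive, and the term n = 0
  alone bounds the sum from below.\<close>

lemma Im_H_ge:
  assumes "\<bar>x\<bar> < a" "0 < v" "v < pi"
  shows "sin v * cosh x / (norm (sinh (Complex x v)))\<^sup>2 \<le> - Im (H (Complex x v))"
proof -
  have s: "(\<lambda>n. csch n (Complex x v)) summable_on UNIV" using assms(1) by (intro csch_summable) simp
  have t: "- Im (csch n (Complex x v)) = cosh (x + of_int n * a) * sin v / (norm (sinh (Complex (x + of_int n * a) v)))\<^sup>2" for n
  proof -
    have "Complex x v + of_int n * of_real a = Complex (x + of_int n * a) v" by (simp add: complex_eq_iff)
    then show ?thesis by (simp only: csch_def Im_inverse_sinh)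
  qed
  have sin: "0 < sin v" using assms by (intro sin_gt_zero) auto
  have nonneg: "0 \<le> - Im (csch n (Complex x v))" for n unfolding t using sin by (intro divide_nonneg_nonneg mult_nonneg_nonneg) auto
  have sI: "(\<lambda>n. - Im (csch n (Complex x v))) summable_on UNIV"
    unfolding summable_on_uminus by (rule summable_on_Im[OF s])
  have "sum (\<lambda>n. - Im (csch n (Complex x v))) {0} \<le> infsum (\<lambda>n. - Im (csch n (Complex x v))) UNIV"
    by (rule finite_sum_le_infsum[OF sI]) (use nonneg in auto)
  also have "\<dots> = - Im (H (Complex x v))" by (simp only: infsum_uminus H_def infsum_Im[OF s])
  finally show ?thesis by (simp add: t mult.commute)
qed

lemma Im_H_pos:
  assumes "\<bar>x\<bar> < a" "0 < v" "v < pi"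
  shows "0 < - Im (H (Complex x v))"
proof -
  have s: "0 < sin v" using assms by (intro sin_gt_zero) auto
  then have "sinh (Complex x v) \<noteq> 0" by (simp add: sinh_rectangular complex_eq_iff)
  then have "0 < sin v * cosh x / (norm (sinh (Complex x v)))\<^sup>2" using s by (intro divide_pos_pos mult_pos_pos) auto
  then show ?thesis using Im_H_ge[OF assms] by linarith
qed

lemma Q_lines:
  "- pi / 2 < v \<Longrightarrow> v < pi \<Longrightarrow> p2 + \<i> * of_real v \<in> Q"
  "0 < x \<Longrightarrow> x < a \<Longrightarrow> of_real x \<in> Q"
proof -
  show "0 < x \<Longrightarrow> x < a \<Longrightarrow> of_real x \<in> Q" using a_pos by (simp add: Q_def)
  show "p2 + \<i> * of_real v \<in> Q" if "- pi / 2 < v" "v < pi"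
  proof -
    have "0 < a * (pi / 2 + v)" using that a_pos by (intro mult_pos_pos) auto
    then show ?thesis using that a_pos by (simp add: Q_def p2_def algebra_simps)
  qed
qed

lemma al_pos: "0 < al" and ga_pos: "0 < ga"
proof -
  have "Complex 0 (pi / 2) = p0" "Complex (a / 2) (pi / 2) = p1"
    by (simp_all add: p0_def p1_def complex_eq_iff)
  then show "0 < al" "0 < ga"
    using Im_H_pos[of 0 "pi / 2"] Im_H_pos[of "a / 2" "pi / 2"] a_pos by (simp_all add: H_points)
qed

lemma Re_H1_neg:
  assumes "0 < x" "x < a"
  shows "Re (H1 (of_real x)) < 0"
proof -
  have r: "of_real x \<in> reg" using Q_lines(2)[OF assms] Q_reg by auto
  have s: "(\<lambda>n. csch n (of_real x) * coth n (of_real x)) summable_on UNIV" by (rule csch_coth_summable[OF r])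
  have t: "Re (csch n (of_real x) * coth n (of_real x)) = cosh (x + of_int n * a) / (sinh (x + of_int n * a))\<^sup>2" for n
  proof -
    have e: "complex_of_real x + of_int n * of_real a = of_real (x + of_int n * a)" by simp
    show ?thesis unfolding csch_def coth_def e sinh_of_real_complex cosh_of_real_complex
      by (simp add: power2_eq_square divide_inverse flip: of_real_inverse)
  qed
  have nn: "0 \<le> Re (csch n (of_real x) * coth n (of_real x))" for n unfolding t by simp
  have "sum (\<lambda>n. Re (csch n (of_real x) * coth n (of_real x))) {0}
      \<le> infsum (\<lambda>n. Re (csch n (of_real x) * coth n (of_real x))) UNIV"
    by (rule finite_sum_le_infsum[OF summable_on_Re[OF s] _ _ nn]) simp_all
  also have "\<dots> = - Re (H1 (of_real x))" by (simp only: H1_def infsum_uminus infsum_Re[OF s]) simp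
  finally have "cosh x / (sinh x)\<^sup>2 \<le> - Re (H1 (of_real x))" by (simp add: t del: times_complex.sel)
  moreover have "0 < cosh x / (sinh x)\<^sup>2" using assms by (intro divide_pos_pos) auto
  ultimately show ?thesis by linarith
qed

text \<open>In classical terms, with \<open>k = ga / al\<close>, \<open>s v = ga * sn (al * v, k)\<close>: this branch of \<open>H\<close> has no
  pole on \<open>[0, \<pi>/2]\<close>, so both kinds of integrals of modulus \<open>k\<close> can be read off it.\<close>

definition s :: "real \<Rightarrow> real" where "s v = - Im (H (p2 + \<i> * of_real v))"
definition s1 :: "real \<Rightarrow> real" where "s1 v = - Re (H1 (p2 + \<i> * of_real v))"

lemma complex_line_has_derivative:
  assumes "(f has_field_derivative f') (at (p + \<i> * of_real v))"
  shows "((\<lambda>v. Re (f (p + \<i> * of_real v))) has_real_derivative - Im f') (at v)"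
    "((\<lambda>v. Im (f (p + \<i> * of_real v))) has_real_derivative Re f') (at v)"
proof -
  have "((\<lambda>v. p + \<i> * complex_of_real v) has_vector_derivative \<i>) (at v)"
    by (auto intro!: derivative_eq_intros)
  from field_vector_diff_chain_at[OF this assms]
  have d: "((\<lambda>v. f (p + \<i> * of_real v)) has_vector_derivative (\<i> * f')) (at v)" by (simp add: o_def)
  show "((\<lambda>v. Re (f (p + \<i> * of_real v))) has_real_derivative - Im f') (at v)"
    using bounded_linear.has_vector_derivative[OF bounded_linear_Re d]
    by (simp add: has_real_derivative_iff_has_vector_derivative)
  show "((\<lambda>v. Im (f (p + \<i> * of_real v))) has_real_derivative Re f') (at v)"
    using bounded_linear.has_vector_derivative[OF bounded_linear_Im d]
    by (simp add: has_real_derivative_iff_has_vector_derivative)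
qed

lemma s_facts:
  assumes "- pi / 2 < v" "v < pi"
  shows "(s has_real_derivative s1 v) (at v)"
    "(s1 has_real_derivative s v * (2 * (s v)\<^sup>2 - (al\<^sup>2 + ga\<^sup>2))) (at v)"
    "(s1 v)\<^sup>2 = (al\<^sup>2 - (s v)\<^sup>2) * (ga\<^sup>2 - (s v)\<^sup>2)"
    "(s v)\<^sup>2 = Y4 - Re (V (p2 + \<i> * of_real v))"
proof -
  define z where "z = p2 + \<i> * complex_of_real v"
  have z: "z \<in> Q" using Q_lines(1)[OF assms] by (simp add: z_def)
  have H: "H z = - \<i> * of_real (s v)" using half_period_line(1)[of v] by (simp only: s_def z_def)
  have H1: "H1 z = - of_real (s1 v)" using half_period_line(2)[of v] by (simp add: s1_def z_def complex_eq_iff)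
  show "(s has_real_derivative s1 v) (at v)"
    using DERIV_minus[OF complex_line_has_derivative(2)[OF H_has_derivative[OF z, unfolded z_def]]]
    by (simp add: s_def[abs_def] s1_def)
  have "H2 z = \<i> * of_real (s v * (2 * (s v)\<^sup>2 - (al\<^sup>2 + ga\<^sup>2)))"
    unfolding H2_eq[OF z] H by (simp add: power_mult_distrib power2_eq_square power3_eq_cube algebra_simps)
  then have "Im (H2 z) = s v * (2 * (s v)\<^sup>2 - (al\<^sup>2 + ga\<^sup>2))" by simp
  then show "(s1 has_real_derivative s v * (2 * (s v)\<^sup>2 - (al\<^sup>2 + ga\<^sup>2))) (at v)"
    using DERIV_minus[OF complex_line_has_derivative(1)[OF H1_has_derivative[OF z, unfolded z_def]]]
    by (simp add: s1_def[abs_def] z_def)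
  have "complex_of_real ((s1 v)\<^sup>2) = of_real ((al\<^sup>2 - (s v)\<^sup>2) * (ga\<^sup>2 - (s v)\<^sup>2))"
    using H1_square[OF z] unfolding H H1 by (simp add: power_mult_distrib)
  then show "(s1 v)\<^sup>2 = (al\<^sup>2 - (s v)\<^sup>2) * (ga\<^sup>2 - (s v)\<^sup>2)" by (simp only: of_real_eq_iff)
  have "- of_real ((s v)\<^sup>2) = V z - of_real Y4"
    using H_square[OF subsetD[OF Q_reg z]] unfolding H C_eq by (simp add: power_mult_distrib)
  then have "Re (- of_real ((s v)\<^sup>2)) = Re (V z - of_real Y4)" by (simp only:)
  then show "(s v)\<^sup>2 = Y4 - Re (V (p2 + \<i> * of_real v))" by (simp add: z_def)
qed

lemma s_ends: "s 0 = 0" "s (pi / 2) = ga"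
proof -
  show "s 0 = 0" by (simp add: s_def H_points)
  have "p2 + \<i> * of_real (pi / 2) = p1" by (simp add: p1_def p2_def)
  then show "s (pi / 2) = ga" unfolding s_def by (simp only: H_points) simp
qed

lemma s_pos: "0 < s v" if "0 < v" "v < pi"
proof -
  have "p2 + \<i> * of_real v = Complex (a / 2) v" by (simp add: p2_def complex_eq_iff)
  then show ?thesis using Im_H_pos[of "a / 2" v] that a_pos by (simp add: s_def)
qed

lemma continuous_on_s: "continuous_on {0..pi/2} s"
proof (rule DERIV_continuous_on)
  fix v assume "v \<in> {0..pi/2}"
  then have "- pi / 2 < v" "v < pi" using pi_gt_zero unfolding atLeastAtMost_iff by linarith+
  then show "(s has_real_derivative s1 v) (at v within {0..pi/2})"
    by (intro has_field_derivative_at_within[OF s_facts(1)])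
qed

text \<open>An indirect comparison: \<open>s\<close> runs continuously from 0 to ga, and s1^2 =
  (al^2 - s^2) (ga^2 - s^2) would be negative at a value strictly between al and ga.\<close>

lemma ga_less_al: "ga < al"
proof (rule ccontr)
  assume "\<not> ga < al"
  then consider "al < ga" | "al = ga" by linarith
  then show False
  proof cases
    case 1
    define m where "m = (al + ga) / 2"
    have m: "al < m" "m < ga" "0 < m" using 1 al_pos by (auto simp: m_def)
    have "\<exists>u\<ge>0. u \<le> pi / 2 \<and> s u = m"
      using s_ends m by (intro IVT' continuous_on_s) auto
    then obtain u where u: "0 \<le> u" "u \<le> pi / 2" "s u = m" by blast
    have "(s1 u)\<^sup>2 = (al\<^sup>2 - m\<^sup>2) * (ga\<^sup>2 - m\<^sup>2)" using s_facts(3)[of u] u pi_gt_zero by simp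
    moreover have "(al\<^sup>2 - m\<^sup>2) * (ga\<^sup>2 - m\<^sup>2) < 0"
      using m al_pos power_strict_mono[of al m 2] power_strict_mono[of m ga 2] by (intro mult_neg_pos) auto
    ultimately show False by (metis not_less zero_le_power2)
  next
    case 2
    \<comment> \<open>Then \<open>s\<close> would reach the equilibrium \<open>al\<close> of \<open>s' = \<plusminus>(al\<^sup>2 - s\<^sup>2)\<close> in finite time.\<close>
    have "bounded (s ` {0..pi/2})"
      by (intro compact_imp_bounded compact_continuous_image continuous_on_s compact_Icc)
    then obtain B where B: "\<bar>s v\<bar> \<le> B" if "v \<in> {0..pi/2}" for v
      unfolding bounded_iff by (metis imageI real_norm_def)
    \<comment> \<open>A Gronwall weight: |s1| = |al - s| |al + s| \<le> (al + B) |al - s|, so with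
      this \<open>c\<close> the function \<open>F\<close> below cannot decrease. Yet it is al^2 at 0
      and 0 at pi/2.\<close>
    define c where "c = 2 * (al + B)"
    define F where "F = (\<lambda>v. (al - s v)\<^sup>2 * exp (c * v))"
    have "F 0 \<le> F (pi / 2)"
    proof (rule DERIV_nonneg_imp_nondecreasing[of 0 "pi / 2" F])
      fix v assume v: "0 \<le> v" "v \<le> pi / 2"
      then have v': "- pi / 2 < v" "v < pi" using pi_gt_zero by linarith+
      define r where "r = al - s v"
      have "(F has_real_derivative 2 * r * - s1 v * exp (c * v) + exp (c * v) * c * r\<^sup>2) (at v)"
        unfolding F_def r_def by (auto intro!: derivative_eq_intros s_facts(1)[OF v'])
      moreover have "0 \<le> 2 * r * - s1 v * exp (c * v) + exp (c * v) * c * r\<^sup>2"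
      proof -
        have "(s1 v)\<^sup>2 = (r * (al + s v))\<^sup>2"
          using s_facts(3)[OF v'] 2 by (simp add: r_def power2_eq_square algebra_simps)
        then have "\<bar>s1 v\<bar> = \<bar>r\<bar> * \<bar>al + s v\<bar>" by (metis power2_eq_iff abs_mult abs_minus_cancel)
        also have "\<dots> \<le> \<bar>r\<bar> * (al + B)" using B[of v] v al_pos by (intro mult_left_mono) auto
        finally have "\<bar>r\<bar> * \<bar>s1 v\<bar> \<le> \<bar>r\<bar> * (\<bar>r\<bar> * (al + B))" by (intro mult_left_mono) auto
        moreover have "r * s1 v \<le> \<bar>r\<bar> * \<bar>s1 v\<bar>" by (simp flip: abs_mult)
        moreover have "\<bar>r\<bar> * (\<bar>r\<bar> * (al + B)) = (al + B) * r\<^sup>2" by (simp add: power2_eq_square)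
        ultimately have "2 * (r * s1 v) \<le> 2 * ((al + B) * r\<^sup>2)" by linarith
        then have "0 \<le> exp (c * v) * (2 * ((al + B) * r\<^sup>2) - 2 * (r * s1 v))"
          by (intro mult_nonneg_nonneg) auto
        then show ?thesis by (simp add: c_def algebra_simps)
      qed
      ultimately show "\<exists>y. DERIV F v :> y \<and> 0 \<le> y" by blast
    qed simp
    then show False using 2 al_pos by (simp add: F_def s_ends)
  qed
qed

text \<open>Otherwise \<open>s\<close> takes a value strictly between ga and al on its way up, where
  s1^2 would be negative.\<close>

lemma s_le: "s v \<le> ga" if "0 \<le> v" "v \<le> pi / 2"
proof (rule ccontr)
  assume "\<not> s v \<le> ga"
  then have gt: "ga < s v" by simp
  define m where "m = (ga + min al (s v)) / 2"
  have m: "ga < m" "m < al" "m < s v" using gt ga_less_al by (auto simp: m_def)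
  have "continuous_on {0..v} s" by (rule continuous_on_subset[OF continuous_on_s]) (use that in auto)
  then have "\<exists>u\<ge>0. u \<le> v \<and> s u = m"
    using s_ends(1) m ga_pos that by (intro IVT') auto
  then obtain u where u: "0 \<le> u" "u \<le> v" "s u = m" by blast
  have "(s1 u)\<^sup>2 = (al\<^sup>2 - m\<^sup>2) * (ga\<^sup>2 - m\<^sup>2)" using s_facts(3)[of u] u that pi_gt_zero by simp
  moreover have "(al\<^sup>2 - m\<^sup>2) * (ga\<^sup>2 - m\<^sup>2) < 0"
    using m ga_pos power_strict_mono[of ga m 2] power_strict_mono[of m al 2] by (intro mult_pos_neg) auto
  ultimately show False by (metis not_less zero_le_power2)
qed

text \<open>The first-order equation leaves the sign of \<open>s1\<close> open. As 0 < s \<le> ga <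
  al, the second-order equation makes \<open>s1\<close> strictly decreasing, and it ends at 0 for v
  = pi/2.\<close>

lemma s1_pos: "0 < s1 v" if "0 < v" "v < pi / 2"
proof -
  have "s1 (pi / 2) = 0" using s_facts(3)[of "pi / 2"] s_ends(2) pi_gt_zero by simp
  moreover have "s1 (pi / 2) < s1 v"
  proof (rule DERIV_neg_imp_decreasing_open[OF that(2)])
    show "\<exists>y. DERIV s1 u :> y \<and> y < 0" if "v < u" "u < pi / 2" for u
    proof -
      have u: "0 < u" "u < pi" using that \<open>0 < v\<close> pi_gt_zero by auto
      have "(s u)\<^sup>2 \<le> ga\<^sup>2" using s_le[of u] s_pos[OF u] that u by (intro power_mono) auto
      moreover have "ga\<^sup>2 < al\<^sup>2" using ga_less_al ga_pos by (intro power_strict_mono) auto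
      ultimately have "2 * (s u)\<^sup>2 - (al\<^sup>2 + ga\<^sup>2) < 0" by linarith
      then have "s u * (2 * (s u)\<^sup>2 - (al\<^sup>2 + ga\<^sup>2)) < 0" using s_pos[OF u] by (intro mult_pos_neg)
      then show ?thesis using s_facts(2)[of u] u pi_gt_zero by (intro exI conjI) auto
    qed
    show "continuous_on {v..pi/2} s1"
    proof (rule DERIV_continuous_on)
      fix u assume "u \<in> {v..pi/2}"
      then show "(s1 has_real_derivative s u * (2 * (s u)\<^sup>2 - (al\<^sup>2 + ga\<^sup>2))) (at u within {v..pi/2})"
        using pi_gt_zero that by (intro has_field_derivative_at_within[OF s_facts(2)]) auto
    qed
  qed
  ultimately show ?thesis by simp
qed

lemma s1_eq:
  assumes "0 < v" "v < pi / 2" and t: "t = s v / ga" and k: "k = ga / al"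
  shows "s1 v = al * ga * sqrt ((1 - t\<^sup>2) * (1 - k\<^sup>2 * t\<^sup>2))" "0 < 1 - t\<^sup>2" "0 < 1 - k\<^sup>2 * t\<^sup>2"
proof -
  have st: "s v = ga * t" using t ga_pos by simp
  have kt: "k\<^sup>2 * t\<^sup>2 = (s v / al)\<^sup>2" using ga_pos by (simp add: k t power_divide)
  have sl: "s v < ga"
  proof -
    have "s v < s (pi / 2)"
    proof (rule DERIV_pos_imp_increasing_open[OF assms(2)])
      show "\<exists>y. DERIV s u :> y \<and> y > 0" if "v < u" "u < pi / 2" for u
        using s_facts(1)[of u] s1_pos[of u] that assms(1) pi_gt_zero by (intro exI[of _ "s1 u"]) auto
      show "continuous_on {v..pi/2} s" by (rule continuous_on_subset[OF continuous_on_s]) (use assms in auto)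
    qed
    then show ?thesis by (simp add: s_ends)
  qed
  have sp: "0 < s v" using s_pos assms pi_gt_zero by auto
  show 1: "0 < 1 - t\<^sup>2" using sl sp ga_pos by (simp add: t abs_square_less_1)
  show 2: "0 < 1 - k\<^sup>2 * t\<^sup>2" unfolding kt using sl sp ga_less_al ga_pos by (simp add: abs_square_less_1)
  have "(s1 v)\<^sup>2 = (al\<^sup>2 - (s v)\<^sup>2) * (ga\<^sup>2 - (s v)\<^sup>2)"
    using s_facts(3)[of v] assms pi_gt_zero by auto
  also have "\<dots> = (al * ga)\<^sup>2 * ((1 - t\<^sup>2) * (1 - k\<^sup>2 * t\<^sup>2))"
  proof -
    have "al\<^sup>2 - (s v)\<^sup>2 = al\<^sup>2 * (1 - (s v / al)\<^sup>2)" "ga\<^sup>2 - (s v)\<^sup>2 = ga\<^sup>2 * (1 - t\<^sup>2)"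
      using al_pos ga_pos by (simp_all add: t power_divide right_diff_distrib)
    then show ?thesis unfolding kt by (simp add: power_mult_distrib mult_ac)
  qed
  finally have "sqrt ((s1 v)\<^sup>2) = sqrt ((al * ga)\<^sup>2 * ((1 - t\<^sup>2) * (1 - k\<^sup>2 * t\<^sup>2)))" by (simp only:)
  then show "s1 v = al * ga * sqrt ((1 - t\<^sup>2) * (1 - k\<^sup>2 * t\<^sup>2))"
    using s1_pos[OF assms(1,2)] al_pos ga_pos by (simp add: real_sqrt_mult abs_mult)
qed

text \<open>Under t = s v / ga the integrand becomes the constant al on [0, pi/2].\<close>

theorem elliptic_K_eq: "elliptic_K (ga / al) = al * (pi / 2)"
proof -
  define k where "k = ga / al"
  have "integral {0..1} (\<lambda>t. 1 / sqrt ((1 - t\<^sup>2) * (1 - k\<^sup>2 * t\<^sup>2))) = integral {0..pi/2} (\<lambda>_. al)"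
  proof (rule integral_substitution_unit_interval[where \<phi> = "\<lambda>v. s v / ga" and \<phi>' = "\<lambda>v. s1 v / ga"])
    show "continuous_on {0..pi/2} (\<lambda>v. s v / ga)"
      using ga_pos by (intro continuous_intros continuous_on_s) auto
    fix v assume v: "0 < v" "v < pi / 2"
    show "((\<lambda>v. s v / ga) has_real_derivative s1 v / ga) (at v)"
      using v pi_gt_zero by (intro DERIV_cdivide s_facts(1)) auto
    show "0 < s1 v / ga" using s1_pos[OF v] ga_pos by simp
    show "s1 v / ga * (1 / sqrt ((1 - (s v / ga)\<^sup>2) * (1 - k\<^sup>2 * (s v / ga)\<^sup>2))) = al"
      using s1_eq[OF v refl k_def] ga_pos by (simp add: mult_pos_pos)
  qed (use s_ends ga_pos al_pos pi_gt_zero in auto)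
  then show ?thesis by (simp add: elliptic_K_def k_def mult.commute)
qed

text \<open>At \<open>p1\<close> the terms coth become tanh, at \<open>p2\<close> they stay coth, of
  half-odd multiples of a; both are odd under n -> - 1 - n. Vanishing at both ends of the segment
  keeps T out of the value of E.\<close>

lemma T_points: "T p2 = 0" "T p1 = 0"
proof -
  show "T p2 = 0" by (simp add: T_def p2_def)
  have ii: "(\<i> * of_real r) * (- \<i> * of_real r') = of_real (r * r')" for r r' :: real
    by (simp add: complex_eq_iff)
  have c1: "coth n p1 = of_real (tanh ((of_int n + 1/2) * a))"
    and c2: "coth n p2 = of_real (cosh ((of_int n + 1/2) * a) / sinh ((of_int n + 1/2) * a))" for n
  proof -
    have "p1 + of_int n * of_real a = of_real ((of_int n + 1/2) * a) + \<i> * of_real (pi / 2)"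
      by (simp add: p1_def algebra_simps)
    then show "coth n p1 = of_real (tanh ((of_int n + 1/2) * a))"
      unfolding coth_def csch_points by (simp only: cosh_quarter ii) (simp add: tanh_def)
    have "p2 + of_int n * of_real a = of_real ((of_int n + 1/2) * a)"
      by (simp add: p2_def algebra_simps)
    then show "coth n p2 = of_real (cosh ((of_int n + 1/2) * a) / sinh ((of_int n + 1/2) * a))"
      unfolding coth_def csch_points by (simp only: cosh_of_real_complex) simp
  qed
  show "T p1 = 0" unfolding T_def p2_def[symmetric]
  proof (rule infsum_int_antisymmetric[where d = "- 1"])
    fix n :: int
    have e: "(of_int (- 1 - n) + 1/2) * a = - ((of_int n + 1/2) * a)" by (simp add: algebra_simps)
    show "coth (- 1 - n) p1 - coth (- 1 - n) p2 = - (coth n p1 - coth n p2)"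
      unfolding c1 c2 e tanh_minus sinh_minus cosh_minus by simp
  qed
qed

text \<open>The substitution used for K turns the integrand into al - s^2/al. On this segment s^2 =
  Y4 - Re V, and T has derivative - V and vanishes at both ends, so the integral of s^2 is Y4
  pi/2.\<close>

theorem elliptic_E_eq: "elliptic_E (ga / al) = al * (pi / 2) - Y4 * (pi / 2) / al"
proof -
  define k where "k = ga / al"
  define G where "G = (\<lambda>v. al - (s v)\<^sup>2 / al)"
  have "integral {0..1} (\<lambda>t. sqrt ((1 - k\<^sup>2 * t\<^sup>2) / (1 - t\<^sup>2))) = integral {0..pi/2} G"
  proof (rule integral_substitution_unit_interval[where \<phi> = "\<lambda>v. s v / ga" and \<phi>' = "\<lambda>v. s1 v / ga"])
    show "continuous_on {0..pi/2} (\<lambda>v. s v / ga)"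
      using ga_pos by (intro continuous_intros continuous_on_s) auto
    show "continuous_on {0..pi/2} G"
      unfolding G_def using al_pos by (intro continuous_intros continuous_on_s) auto
    fix v assume v: "0 < v" "v < pi / 2"
    show "((\<lambda>v. s v / ga) has_real_derivative s1 v / ga) (at v)"
      using v pi_gt_zero by (intro DERIV_cdivide s_facts(1)) auto
    show "0 < s1 v / ga" using s1_pos[OF v] ga_pos by simp
    note e = s1_eq[OF v refl k_def]
    have G: "G v = al * (1 - k\<^sup>2 * (s v / ga)\<^sup>2)"
      using al_pos ga_pos by (simp add: G_def k_def power_divide field_simps power2_eq_square)
    show "0 \<le> G v" unfolding G using e(3) al_pos by simp
    have "sqrt (1 - k\<^sup>2 * (s v / ga)\<^sup>2) * sqrt (1 - k\<^sup>2 * (s v / ga)\<^sup>2) = 1 - k\<^sup>2 * (s v / ga)\<^sup>2"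
      using e(3) by simp
    then show "s1 v / ga * sqrt ((1 - k\<^sup>2 * (s v / ga)\<^sup>2) / (1 - (s v / ga)\<^sup>2)) = G v"
      unfolding e(1) G using e(2) ga_pos by (simp add: real_sqrt_mult real_sqrt_divide)
  qed (use s_ends ga_pos pi_gt_zero in auto)
  moreover have "integral {0..pi/2} G = al * (pi / 2) - Y4 * (pi / 2) / al"
  proof -
    define F where "F = (\<lambda>v. al * v - (Y4 * v + Im (T (p2 + \<i> * of_real v))) / al)"
    have "(G has_integral (F (pi / 2) - F 0)) {0..pi/2}"
    proof (rule fundamental_theorem_of_calculus)
      fix v assume v: "v \<in> {0..pi/2}"
      then have v': "- pi / 2 < v" "v < pi" using pi_gt_zero unfolding atLeastAtMost_iff by linarith+
      have "((\<lambda>v. Im (T (p2 + \<i> * of_real v))) has_real_derivative Re (- V (p2 + \<i> * of_real v))) (at v)"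
        by (rule complex_line_has_derivative(2)[OF T_has_derivative[OF Q_lines(1)[OF v']]])
      then have "(F has_real_derivative al * 1 - (Y4 * 1 + Re (- V (p2 + \<i> * of_real v))) / al) (at v)"
        unfolding F_def by (intro DERIV_diff DERIV_add DERIV_cdivide DERIV_cmult DERIV_ident)
      also have "al * 1 - (Y4 * 1 + Re (- V (p2 + \<i> * of_real v))) / al = G v"
        using s_facts(4)[OF v'] by (simp add: G_def)
      finally show "(F has_vector_derivative G v) (at v within {0..pi/2})"
        by (simp add: has_real_derivative_iff_has_vector_derivative has_vector_derivative_at_within)
    qed simp
    then have "integral {0..pi/2} G = F (pi / 2) - F 0" by (rule integral_unique)
    moreover have "p2 + \<i> * of_real (pi / 2) = p1" by (simp add: p1_def p2_def)
    then have "T (p2 + \<i> * of_real (pi / 2)) = 0" by (simp only: T_points)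
    ultimately show ?thesis by (simp add: F_def T_points)
  qed
  ultimately show ?thesis by (simp add: elliptic_E_def k_def)
qed

end

section \<open>The real segment and the complementary period\<close>

context csch_lattice
begin

text \<open>In classical terms \<open>h x = al * cs (al * x, k')\<close>, a branch that is monotone for a trivial reason.\<close>

definition h :: "real \<Rightarrow> real" where "h x = Re (H (of_real x))"
definition h1 :: "real \<Rightarrow> real" where "h1 x = Re (H1 (of_real x))"

lemma h_facts:
  assumes "0 < x" "x < a"
  shows "(h has_real_derivative h1 x) (at x)" "h1 x < 0"
    "(h1 x)\<^sup>2 = ((h x)\<^sup>2 + al\<^sup>2) * ((h x)\<^sup>2 + ga\<^sup>2)"
proof -
  have Q: "of_real x \<in> Q" by (rule Q_lines(2)[OF assms])
  have "(of_real has_vector_derivative (1::complex)) (at x)"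
    by (auto intro!: derivative_eq_intros)
  from field_vector_diff_chain_at[OF this H_has_derivative[OF Q]]
  have d: "((\<lambda>x. H (of_real x)) has_vector_derivative H1 (of_real x)) (at x)" by (simp add: o_def)
  show "(h has_real_derivative h1 x) (at x)"
    using bounded_linear.has_vector_derivative[OF bounded_linear_Re d]
    by (simp add: has_real_derivative_iff_has_vector_derivative h_def[abs_def] h1_def)
  show "h1 x < 0" unfolding h1_def by (rule Re_H1_neg[OF assms])
  have H: "H (of_real x) = of_real (h x)" "H1 (of_real x) = of_real (h1 x)"
    using real_axis unfolding h_def h1_def by metis+
  have "complex_of_real ((h1 x)\<^sup>2) = of_real (((h x)\<^sup>2 + al\<^sup>2) * ((h x)\<^sup>2 + ga\<^sup>2))"
    using H1_square[OF Q] unfolding H by simp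
  then show "(h1 x)\<^sup>2 = ((h x)\<^sup>2 + al\<^sup>2) * ((h x)\<^sup>2 + ga\<^sup>2)" by (simp only: of_real_eq_iff)
qed

lemma h_half: "h (a / 2) = 0"
  using H_points(3) by (simp add: h_def p2_def)

lemma h_decreasing: "h y < h x" if "0 < x" "x < y" "y < a"
proof (rule DERIV_neg_imp_decreasing[OF that(2)])
  show "\<exists>d. DERIV h u :> d \<and> d < 0" if "x \<le> u" "u \<le> y" for u
    using h_facts(1,2)[of u] that \<open>0 < x\<close> \<open>y < a\<close> by (intro exI[of _ "h1 u"]) auto
qed

text \<open>Pairing n with - n - 1 gives 1/sinh (x + n a) - 1/sinh ((n + 1) a - x), nonnegative for
  x \<le> a/2; the pair n = 0 alone yields the bound. It drives \<open>h\<close> to infinity at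
  0.\<close>

lemma h_ge:
  assumes "0 < x" "x \<le> a / 2"
  shows "1 / sinh x - 1 / sinh (a / 2) \<le> h x"
proof -
  have s: "(\<lambda>n. csch n (of_real x)) summable_on UNIV" using assms a_pos by (intro csch_summable) auto
  have t: "Re (csch n (of_real x)) = 1 / sinh (x + of_int n * a)" for n
  proof -
    have e: "complex_of_real x + of_int n * of_real a = of_real (x + of_int n * a)" by simp
    show ?thesis unfolding csch_def e sinh_of_real_complex by (simp add: inverse_eq_divide flip: of_real_inverse)
  qed
  have "(\<lambda>n. Re (csch (int n) (of_real x)) + Re (csch (- int n - 1) (of_real x))) sums
      infsum (\<lambda>n. Re (csch n (of_real x))) UNIV"
    by (rule sums_int_pairs[OF summable_on_Re[OF s]])
  then have S: "(\<lambda>n. Re (csch (int n) (of_real x)) + Re (csch (- int n - 1) (of_real x))) sums h x"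
    by (simp add: h_def H_def infsum_Re[OF s])
  have e: "Re (csch (int n) (of_real x)) + Re (csch (- int n - 1) (of_real x))
    = 1 / sinh (x + real n * a) - 1 / sinh ((real n + 1) * a - x)" for n
  proof -
    have "x + of_int (- int n - 1) * a = - ((real n + 1) * a - x)" by (simp add: algebra_simps)
    then show ?thesis unfolding t by (simp only: sinh_minus) simp
  qed
  have nonneg: "0 \<le> 1 / sinh (x + real n * a) - 1 / sinh ((real n + 1) * a - x)" for n
  proof -
    have "0 \<le> real n * a" using a_pos by simp
    then have "0 < x + real n * a" "x + real n * a \<le> (real n + 1) * a - x"
      using assms unfolding distrib_right by linarith+
    then show ?thesis by (simp add: frac_le)
  qed
  have "(\<Sum>n<1. Re (csch (int n) (of_real x)) + Re (csch (- int n - 1) (of_real x))) \<le> h x"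
    unfolding sums_unique[OF S]
    by (rule sum_le_suminf[OF sums_summable[OF S]]) (simp_all only: e nonneg finite_lessThan)
  then have "1 / sinh x - 1 / sinh (a - x) \<le> h x" by (simp add: e[of 0, simplified])
  moreover have "1 / sinh (a - x) \<le> 1 / sinh (a / 2)"
    using assms a_pos by (intro divide_left_mono mult_pos_pos) auto
  ultimately show ?thesis by linarith
qed

lemma h_at_top: "filterlim h at_top (at_right 0)"
proof (rule filterlim_at_top_mono)
  have "filterlim sinh (at_right 0) (at_right (0::real))"
    unfolding filterlim_at
  proof
    show "(sinh \<longlongrightarrow> 0) (at_right (0::real))" using tendsto_sinh[OF tendsto_ident_at, of 0] by simp
    show "\<forall>\<^sub>F x in at_right 0. sinh x \<in> {0<..} \<and> sinh x \<noteq> (0::real)"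
      using eventually_at_right_less[of "0::real"] by eventually_elim auto
  qed
  from filterlim_compose[OF filterlim_inverse_at_top_right this]
  have "filterlim (\<lambda>x. - (1 / sinh (a / 2)) + inverse (sinh x)) at_top (at_right (0::real))"
    by (rule filterlim_tendsto_add_at_top[OF tendsto_const])
  then show "filterlim (\<lambda>x. 1 / sinh x - 1 / sinh (a / 2)) at_top (at_right 0)"
    by (simp add: inverse_eq_divide)
  show "\<forall>\<^sub>F x in at_right 0. 1 / sinh x - 1 / sinh (a / 2) \<le> h x"
    using eventually_at_right_real[of 0 "a / 2"] a_pos by (auto elim!: eventually_mono intro!: h_ge)
qed

text \<open>The substitution is t = al / sqrt (h^2 + al^2), classically sn (al x, k'). It rises from
  0 at the pole of \<open>h\<close> to 1 at its zero a/2 and makes the integrand the constant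
  al.\<close>

theorem elliptic_K_complementary_eq: "elliptic_K (sqrt (1 - (ga / al)\<^sup>2)) = al * (a / 2)"
proof -
  define k where "k = sqrt (1 - (ga / al)\<^sup>2)"
  have k2: "k\<^sup>2 = 1 - (ga / al)\<^sup>2"
    unfolding k_def using ga_pos ga_less_al by (simp add: abs_square_le_1)
  \<comment> \<open>At the pole the limit 0 is put in by hand; \<open>h 0\<close> is a default value
    for which the quotient would be 1.\<close>
  define \<phi> where "\<phi> = (\<lambda>x. if x = 0 then 0 else al / sqrt ((h x)\<^sup>2 + al\<^sup>2))"
  define \<phi>' where "\<phi>' = (\<lambda>x. - (al * h x * h1 x) / ((h x)\<^sup>2 + al\<^sup>2) / sqrt ((h x)\<^sup>2 + al\<^sup>2))"
  have pos: "0 < (h x)\<^sup>2 + al\<^sup>2" for x using al_pos by (simp add: add_nonneg_pos)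
  have d: "(\<phi> has_real_derivative \<phi>' x) (at x)" if x: "0 < x" "x < a" for x
  proof -
    define R where "R = sqrt ((h x)\<^sup>2 + al\<^sup>2)"
    have R: "R > 0" "R * R = (h x)\<^sup>2 + al\<^sup>2" using pos[of x] by (auto simp: R_def)
    have "((\<lambda>x. (h x)\<^sup>2 + al\<^sup>2) has_real_derivative 2 * h x * h1 x) (at x)"
      using DERIV_add[OF DERIV_power[OF h_facts(1)[OF x], of 2] DERIV_const[of "al\<^sup>2"]] by (simp add: mult_ac)
    from DERIV_chain2[OF DERIV_real_sqrt[OF pos] this]
    have "((\<lambda>x. sqrt ((h x)\<^sup>2 + al\<^sup>2)) has_real_derivative h x * h1 x / R) (at x)"
      by (rule DERIV_cong) (unfold R_def[symmetric], use R(1) in \<open>simp add: field_simps\<close>)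
    from DERIV_divide[OF DERIV_const this, of al] less_imp_neq[OF R(1), symmetric]
    have "((\<lambda>x. al / sqrt ((h x)\<^sup>2 + al\<^sup>2)) has_real_derivative - (al * (h x * h1 x / R)) / (R * R)) (at x)"
      by (simp add: R_def)
    also have "- (al * (h x * h1 x / R)) / (R * R) = \<phi>' x"
      unfolding R(2) by (simp add: \<phi>'_def R_def mult_ac)
    finally have 1: "((\<lambda>x. al / sqrt ((h x)\<^sup>2 + al\<^sup>2)) has_real_derivative \<phi>' x) (at x)" .
    show ?thesis
      by (rule has_field_derivative_transform_within_open[OF 1, of "{0<..}"]) (use x in \<open>auto simp: \<phi>_def\<close>)
  qed
  have "integral {0..1} (\<lambda>t. 1 / sqrt ((1 - t\<^sup>2) * (1 - k\<^sup>2 * t\<^sup>2))) = integral {0..a/2} (\<lambda>_. al)"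
  proof (rule integral_substitution_unit_interval[where \<phi> = \<phi> and \<phi>' = \<phi>'])
    show "continuous_on {0..a/2} \<phi>"
      unfolding continuous_on_eq_continuous_within
    proof
      fix x assume x: "x \<in> {0..a/2}"
      show "continuous (at x within {0..a/2}) \<phi>"
      proof (cases "x = 0")
        case False
        then have "0 < x" "x < a" using x a_pos by auto
        then show ?thesis using d DERIV_continuous continuous_at_imp_continuous_at_within by blast
      next
        case True
        have "filterlim (\<lambda>x. al\<^sup>2 + (h x)\<^sup>2) at_top (at_right 0)"
          using h_at_top by (intro filterlim_tendsto_add_at_top[OF tendsto_const] filterlim_pow_at_top) auto
        from filterlim_compose[OF sqrt_at_top this]
        have "filterlim (\<lambda>x. sqrt (al\<^sup>2 + (h x)\<^sup>2)) at_infinity (at_right 0)"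
          by (rule filterlim_at_top_imp_at_infinity)
        from tendsto_divide_0[OF tendsto_const this]
        have "((\<lambda>x. al / sqrt (al\<^sup>2 + (h x)\<^sup>2)) \<longlongrightarrow> 0) (at_right 0)" .
        moreover have "\<forall>\<^sub>F x in at_right 0. al / sqrt (al\<^sup>2 + (h x)\<^sup>2) = \<phi> x"
          using eventually_at_right_less[of "0::real"] by eventually_elim (simp add: \<phi>_def add.commute)
        ultimately have "(\<phi> \<longlongrightarrow> 0) (at_right 0)" by (rule Lim_transform_eventually)
        then have "(\<phi> \<longlongrightarrow> 0) (at 0 within {0..a/2})"
          using a_pos at_within_Icc_at_right[of 0 "a / 2"] by simp
        then show ?thesis using True by (simp add: continuous_within \<phi>_def)
      qed
    qed
    show "\<phi> 0 = 0" "\<phi> (a / 2) = 1" using al_pos a_pos by (simp_all add: \<phi>_def h_half)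
    show "continuous_on {0..a/2} (\<lambda>_. al)" by (rule continuous_on_const)
    fix x assume x: "0 < x" "x < a / 2"
    then have xa: "x < a" by simp
    show "(\<phi> has_real_derivative \<phi>' x) (at x)" using d[OF x(1) xa] .
    have hp: "0 < h x" using h_decreasing[of x "a / 2"] x h_half by simp
    note h1 = h_facts(2,3)[OF x(1) xa]
    show "0 < \<phi>' x" unfolding \<phi>'_def
      using hp h1(1) pos[of x] al_pos by (intro divide_pos_pos) (auto simp: mult_less_0_iff)
    show "0 \<le> al" using al_pos by simp
    define R where "R = sqrt ((h x)\<^sup>2 + al\<^sup>2)"
    define S where "S = sqrt ((h x)\<^sup>2 + ga\<^sup>2)"
    have R: "R > 0" "R\<^sup>2 = (h x)\<^sup>2 + al\<^sup>2" using pos[of x] by (auto simp: R_def)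
    have S: "S > 0" "S\<^sup>2 = (h x)\<^sup>2 + ga\<^sup>2" using ga_pos by (auto simp: S_def add_nonneg_pos)
    have "(h1 x)\<^sup>2 = (R * S)\<^sup>2" using h1(2) R S by (simp add: power_mult_distrib)
    then have "h1 x = R * S \<or> h1 x = - (R * S)" by (simp only: power2_eq_iff)
    moreover have "0 < R * S" using R(1) S(1) by simp
    ultimately have h1e: "h1 x = - (R * S)" using h1(1) by linarith
    have t: "\<phi> x = al / R" using x by (simp add: \<phi>_def R_def)
    have 1: "1 - (\<phi> x)\<^sup>2 = (h x / R)\<^sup>2"
      unfolding t power_divide R(2) using pos[of x] al_pos by (simp add: divide_simps)
    have 2: "1 - k\<^sup>2 * (\<phi> x)\<^sup>2 = (S / R)\<^sup>2"
    proof -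
      have "(1 - (ga / al)\<^sup>2) * (al / R)\<^sup>2 = (al\<^sup>2 - ga\<^sup>2) / R\<^sup>2"
        using al_pos by (simp add: power_divide left_diff_distrib diff_divide_distrib)
      moreover have "S\<^sup>2 = R\<^sup>2 - (al\<^sup>2 - ga\<^sup>2)" using R(2) S(2) by simp
      ultimately show ?thesis
        unfolding k2 t power_divide[of S] using R(1) by (simp only: diff_divide_distrib) simp
    qed
    have "sqrt ((1 - (\<phi> x)\<^sup>2) * (1 - k\<^sup>2 * (\<phi> x)\<^sup>2)) = h x / R * (S / R)"
      unfolding 1 2 using R S hp by (simp add: real_sqrt_mult)
    moreover have "\<phi>' x = al * h x * S / (R * R)"
      unfolding \<phi>'_def R_def[symmetric] unfolding R(2)[symmetric] h1e
      using R(1) by (simp add: power2_eq_square)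
    ultimately show "\<phi>' x * (1 / sqrt ((1 - (\<phi> x)\<^sup>2) * (1 - k\<^sup>2 * (\<phi> x)\<^sup>2))) = al"
      using R S hp by simp
  qed (use a_pos in simp)
  then show ?thesis using a_pos by (simp add: elliptic_K_def k_def mult.commute)
qed

definition Y1 :: real where "Y1 = (\<Sum>\<^sub>\<infinity>n::int. 1 / (sinh (of_int n * a))\<^sup>2)"

text \<open>The terms are the squares of csch at z = 0; the pole n = 0 gives 0 on both sides by
  division by zero.\<close>

lemma Y1_summable: "(\<lambda>n::int. 1 / (sinh (of_int n * a))\<^sup>2) summable_on UNIV"
proof -
  have "csch n 0 = of_real (1 / sinh (of_int n * a))" for n
  proof -
    have "0 + of_int n * of_real a = complex_of_real (of_int n * a)" by simp
    then show ?thesis unfolding csch_def by (simp only: sinh_of_real_complex) (simp add: inverse_eq_divide)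
  qed
  then show ?thesis using csch_summable(3)[of 0] a_pos by (simp add: norm_power norm_divide power_divide)
qed

text \<open>By \<open>1/sinh\<^sup>2 y - 1/cosh\<^sup>2 y = 4/sinh\<^sup>2 2y\<close>; the summand \<open>n = 0\<close> of \<open>Y1\<close> is the junk value \<open>0\<close>.\<close>
lemma Y1_eq: "3 * Y1 = Y4 - Y2 - Y3 + 1"
proof -
  define f where "f = (\<lambda>n::int. 1 / (sinh (of_int n * a))\<^sup>2)"
  have double: "4 / (sinh (2 * y))\<^sup>2 = 1 / (sinh y)\<^sup>2 - 1 / (cosh y)\<^sup>2" if "y \<noteq> 0" for y :: real
  proof -
    have "sinh y \<noteq> 0" using that by simp
    moreover have "(cosh y)\<^sup>2 - (sinh y)\<^sup>2 = 1" by (rule hyperbolic_pythagoras)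
    ultimately show ?thesis
      using cosh_real_pos[of y] unfolding sinh_double by (simp add: power_mult_distrib divide_simps del: sinh_real_zero_iff)
  qed
  have "Y1 = infsum (\<lambda>n. f (2 * n)) UNIV + infsum (\<lambda>n. f (2 * n + 1)) UNIV"
    unfolding Y1_def f_def by (rule infsum_int_even_odd[OF Y1_summable])
  moreover have "((\<lambda>n. 4 * f (2 * n)) has_sum (Y1 - Y2 + 1)) UNIV"
  proof (rule has_sum_cong[THEN iffD1])
    show "((\<lambda>n. f n - 1 / (cosh (of_int n * a))\<^sup>2 + (if n = 0 then 1 else 0)) has_sum (Y1 - Y2 + 1)) UNIV"
      unfolding f_def Y1_def Y2_def
      by (intro has_sum_add has_sum_diff has_sum_at_0 has_sum_infsum Y1_summable Y_summable)
    show "f n - 1 / (cosh (of_int n * a))\<^sup>2 + (if n = 0 then 1 else 0) = 4 * f (2 * n)" for n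
      using double[of "of_int n * a"] a_pos by (cases "n = 0") (simp_all add: f_def mult.assoc)
  qed
  moreover have "((\<lambda>n. 4 * f (2 * n + 1)) has_sum (Y4 - Y3)) UNIV"
  proof (rule has_sum_cong[THEN iffD1])
    show "((\<lambda>n. 1 / (sinh ((of_int n + 1/2) * a))\<^sup>2 - 1 / (cosh ((of_int n + 1/2) * a))\<^sup>2) has_sum (Y4 - Y3)) (UNIV :: int set)"
      unfolding Y4_def Y3_def by (intro has_sum_diff has_sum_infsum Y_summable)
    show "1 / (sinh ((of_int n + 1/2) * a))\<^sup>2 - 1 / (cosh ((of_int n + 1/2) * a))\<^sup>2 = 4 * f (2 * n + 1)" for n :: int
    proof -
      have "(of_int n + 1/2) * a \<noteq> 0" using half_odd_nonzero[of n] a_pos by simp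
      from double[OF this] show ?thesis by (simp add: f_def algebra_simps)
    qed
  qed
  ultimately have "4 * Y1 = (Y1 - Y2 + 1) + (Y4 - Y3)"
    using infsumI infsum_cmult_right'[of 4 "\<lambda>n. f (2 * n)" UNIV] infsum_cmult_right'[of 4 "\<lambda>n. f (2 * n + 1)" UNIV]
    by (metis distrib_left)
  then show ?thesis by simp
qed

end

text \<open>The lattice with this \<open>a\<close> has the modulus ga/al of period ratio a/pi, so k
  = ga/al by injectivity. The rest is linear in the sums: pi al = 2 K, pi ga = 2 k K and pi^2 Y4 = 4
  K (K - E), with Y3 = ga^2 - Y4 and \<open>Y1\<close> from the duplication formula.\<close>

lemma lattice_sums_elliptic:
  assumes "0 < k" "k < 1"
  defines "K \<equiv> elliptic_K k" and "E \<equiv> elliptic_E k" and "a \<equiv> pi * period_ratio k"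
  shows "a > 0"
    "pi\<^sup>2 / 3 - pi\<^sup>2 * csch_lattice.Y1 a = 4 / 3 * K * (3 * E + (k\<^sup>2 - 2) * K)"
    "pi\<^sup>2 * csch_lattice.Y3 a = 4 * K\<^sup>2 * k\<^sup>2 - 4 * K * (K - E)"
proof -
  note cm = complementary_modulus[OF assms(1,2)]
  show a: "a > 0"
    using elliptic_K_pos[OF assms(1,2)] elliptic_K_pos[OF cm(1,2)] by (simp add: a_def period_ratio_def)
  interpret csch_lattice a by unfold_locales (rule a)
  have l: "0 < ga / al" "ga / al < 1" using ga_pos al_pos ga_less_al by auto
  have "period_ratio (ga / al) = a / pi"
    unfolding period_ratio_def elliptic_K_eq elliptic_K_complementary_eq using al_pos by simp
  then have "k = ga / al" using period_ratio_inject[OF assms(1,2) l] by (simp add: a_def)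
  then have ga: "ga = k * al" and K: "K = al * (pi / 2)" and E: "E = al * (pi / 2) - Y4 * (pi / 2) / al"
    using al_pos elliptic_K_eq elliptic_E_eq by (simp_all add: K_def E_def)
  have al2: "al = 2 * K / pi" using K pi_gt_zero by (simp add: field_simps)
  have alE: "al * E = pi / 2 * (al\<^sup>2 - Y4)"
    unfolding E using al_pos by (simp add: field_simps power2_eq_square)
  have K2: "2 * K = al * pi" using K by simp
  have "2 * K * E = pi * (al * E)" unfolding K2 by (simp only: mult_ac)
  then have "2 * K * E = pi * (pi / 2 * (al\<^sup>2 - Y4))" unfolding alE .
  then have "4 * K * E = al\<^sup>2 * pi\<^sup>2 - Y4 * pi\<^sup>2" by (simp add: power2_eq_square right_diff_distrib mult_ac)
  moreover have "al\<^sup>2 * pi\<^sup>2 = 4 * K * K" unfolding al2 by (simp add: power_divide power2_eq_square)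
  ultimately have Y4: "Y4 * pi\<^sup>2 = 4 * K * (K - E)" by (simp add: right_diff_distrib)
  have alpi: "al\<^sup>2 * pi\<^sup>2 = 4 * K\<^sup>2" unfolding al2 by (simp add: power_divide power_mult_distrib)
  have gapi: "ga\<^sup>2 * pi\<^sup>2 = 4 * K\<^sup>2 * k\<^sup>2" using alpi by (simp add: ga power_mult_distrib mult_ac)
  have Y3: "Y3 = ga\<^sup>2 - Y4" and Y2: "Y2 = al\<^sup>2 - Y4" using al_ga_square by auto
  show "pi\<^sup>2 * Y3 = 4 * K\<^sup>2 * k\<^sup>2 - 4 * K * (K - E)"
    unfolding Y3 using Y4 gapi by (simp add: algebra_simps)
  have Y1: "3 * Y1 = 3 * Y4 - al\<^sup>2 - ga\<^sup>2 + 1" using Y1_eq Y2 Y3 by simp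
  have "3 * (pi\<^sup>2 * Y1) = pi\<^sup>2 * (3 * Y1)" by simp
  also have "\<dots> = 3 * (Y4 * pi\<^sup>2) - al\<^sup>2 * pi\<^sup>2 - ga\<^sup>2 * pi\<^sup>2 + pi\<^sup>2"
    unfolding Y1 by (simp add: algebra_simps)
  finally have "3 * (pi\<^sup>2 * Y1) = 3 * (4 * K * (K - E)) - 4 * K\<^sup>2 - 4 * K\<^sup>2 * k\<^sup>2 + pi\<^sup>2"
    unfolding Y4 alpi gapi .
  then show "pi\<^sup>2 / 3 - pi\<^sup>2 * Y1 = 4 / 3 * K * (3 * E + (k\<^sup>2 - 2) * K)"
    by (simp add: field_simps power2_eq_square)
qed

section \<open>Termwise differentiation in the lattice parameter\<close>

lemma infsum_of_real_complex:
  fixes f :: "'a \<Rightarrow> real"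
  assumes "f summable_on A"
  shows "(\<Sum>\<^sub>\<infinity>n\<in>A. complex_of_real (f n)) = of_real (infsum f A)"
  using infsum_of_real_multiple[OF assms, of "\<lambda>n. complex_of_real (f n)" 1] by simp

text \<open>The real series is continued to the half-plane Re z > a/2, where holomorphy lets a
  majorant of the terms justify termwise differentiation.\<close>

lemma real_series_has_derivative:
  fixes f f' :: "int \<Rightarrow> complex \<Rightarrow> complex" and g g' :: "int \<Rightarrow> real \<Rightarrow> real"
  assumes a: "0 < a"
    and der: "\<And>n z. a / 2 < Re z \<Longrightarrow> (f n has_field_derivative f' n z) (at z)"
    and M: "M summable_on UNIV" "\<And>n z. a / 2 < Re z \<Longrightarrow> norm (f n z) \<le> M n"
    and f': "\<And>z. a / 2 < Re z \<Longrightarrow> (\<lambda>n. f' n z) summable_on UNIV"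
    and g: "\<And>n x. 0 < x \<Longrightarrow> f n (of_real x) = of_real (g n x)" "\<And>n x. 0 < x \<Longrightarrow> f' n (of_real x) = of_real (g' n x)"
  shows "((\<lambda>x. infsum (\<lambda>n. g n x) UNIV) has_real_derivative infsum (\<lambda>n. g' n a) UNIV) (at a)"
    "(\<lambda>n. g' n a) summable_on UNIV"
proof -
  have a2: "a / 2 < Re (of_real a)" using a by simp
  define F where "F = (\<lambda>z. infsum (\<lambda>n. f n z) UNIV)"
  define F' where "F' = infsum (\<lambda>n. f' n (of_real a)) UNIV"
  have fs: "(\<lambda>n. f n z) summable_on UNIV" if "a / 2 < Re z" for z
    by (rule abs_summable_summable, rule summable_on_comparison_test[OF M(1)]) (use M(2) that in auto)
  have "(F has_field_derivative F') (at (of_real a))"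
    unfolding F_def F'_def
  proof (rule infsum_int_has_derivative[where F = "{}" and S = "{z. a / 2 < Re z}"])
    show "open {z. a / 2 < Re z}" by (rule open_halfspace_Re_gt)
  qed (use assms a2 fs in auto)
  have "(of_real has_vector_derivative (1::complex)) (at a)"
    by (auto intro!: derivative_eq_intros)
  from field_vector_diff_chain_at[OF this \<open>(F has_field_derivative F') (at (of_real a))\<close>]
  have "((\<lambda>x. F (of_real x)) has_vector_derivative F') (at a)" by (simp add: o_def)
  from bounded_linear.has_vector_derivative[OF bounded_linear_Re this]
  have 1: "((\<lambda>x. Re (F (of_real x))) has_real_derivative Re F') (at a)"
    by (simp add: has_real_derivative_iff_has_vector_derivative)
  have sg: "(\<lambda>n. g n x) summable_on UNIV" if "a / 2 < x" for x
    using summable_on_Re[OF fs[of "of_real x"]] that a by (simp add: g)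
  show sg': "(\<lambda>n. g' n a) summable_on UNIV"
    using summable_on_Re[OF f'[OF a2]] a by (simp add: g)
  have F: "Re (F (of_real x)) = infsum (\<lambda>n. g n x) UNIV" if "x \<in> {a/2<..}" for x
    using that a by (simp add: F_def g infsum_of_real_complex sg)
  have F': "Re F' = infsum (\<lambda>n. g' n a) UNIV"
    using a by (simp add: F'_def g infsum_of_real_complex sg')
  show "((\<lambda>x. infsum (\<lambda>n. g n x) UNIV) has_real_derivative infsum (\<lambda>n. g' n a) UNIV) (at a)"
    unfolding F'[symmetric]
    by (rule has_field_derivative_transform_within_open[OF 1, of "{a/2<..}"]) (use a F in auto)
qed

lemma norm_cosh_ge: "\<bar>sinh (Re z)\<bar> \<le> norm (cosh (z :: complex))"
proof -
  have "\<bar>norm (exp z) - norm (exp (- z))\<bar> \<le> norm (exp z + exp (- z))"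
    using norm_triangle_ineq3[of "exp z" "- exp (- z)"] by simp
  then show ?thesis by (simp add: cosh_field_def sinh_field_def norm_exp_eq_Re norm_divide)
qed

lemma abs_le_abs_sinh: "\<bar>t\<bar> \<le> \<bar>sinh t\<bar>" for t :: real
  using real_le_abs_sinh[of t] by (simp add: sinh_field_def exp_minus)

lemma abs_sinh_mono: "\<bar>x\<bar> \<le> \<bar>y\<bar> \<Longrightarrow> \<bar>sinh x\<bar> \<le> \<bar>sinh y\<bar>" for x y :: real
  by (simp flip: sinh_real_abs)

lemma norm_cosh_le_sinh: "norm (cosh z) \<le> norm (sinh z) + 1" for z :: complex
proof (rule power2_le_imp_le)
  have "(norm (cosh z))\<^sup>2 = norm ((sinh z)\<^sup>2 + 1)" by (metis cosh_square_eq norm_power)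
  also have "\<dots> \<le> (norm (sinh z))\<^sup>2 + 1" by (rule order_trans[OF norm_triangle_ineq]) (simp add: norm_power)
  also have "\<dots> \<le> (norm (sinh z) + 1)\<^sup>2" by (simp add: power2_sum)
  finally show "(norm (cosh z))\<^sup>2 \<le> (norm (sinh z) + 1)\<^sup>2" .
qed simp

text \<open>Differentiating csch^2 (c a) in a brings down a factor c. Halving the argument pays for
  it: |t| \<le> |sinh t| absorbs the factor, and a csch^2 series of half the argument is left as
  majorant.\<close>

lemma weighted_csch_cube_le:
  fixes t :: real
  shows "\<bar>t\<bar> * (\<bar>sinh (2 * t)\<bar> + 1) / \<bar>sinh (2 * t)\<bar> ^ 3 \<le> 1 / (sinh t)\<^sup>2"
proof (cases "t = 0")
  case False
  define S where "S = \<bar>sinh t\<bar>"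
  define c where "c = cosh t"
  have c: "1 \<le> c" by (simp add: c_def cosh_real_ge_1)
  have S: "0 < S" "\<bar>t\<bar> \<le> S" using False abs_le_abs_sinh[of t] by (auto simp: S_def)
  have c2: "c\<^sup>2 = S\<^sup>2 + 1" by (simp add: c_def S_def cosh_square_eq)
  have d: "\<bar>sinh (2 * t)\<bar> = 2 * S * c" by (simp add: sinh_double abs_mult S_def c_def)
  have "2 * S * c \<le> S\<^sup>2 + c\<^sup>2" using sum_squares_bound[of S c] by simp
  then have "2 * S * c + 1 \<le> 2 * c\<^sup>2" using c2 by simp
  also have "\<dots> \<le> 8 * c ^ 3"
    using c mult_right_mono[of 1 c "c\<^sup>2"] by (simp add: power2_eq_square power3_eq_cube)
  finally have "\<bar>t\<bar> * (2 * S * c + 1) \<le> S * (8 * c ^ 3)" using S c by (intro mult_mono) auto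
  then have "\<bar>t\<bar> * (2 * S * c + 1) / (2 * S * c) ^ 3 \<le> S * (8 * c ^ 3) / (2 * S * c) ^ 3"
    using S c by (intro divide_right_mono) auto
  also have "\<dots> = 1 / S\<^sup>2" using S c by (simp add: power_mult_distrib power2_eq_square power3_eq_cube)
  finally show ?thesis unfolding d by (simp add: S_def)
qed simp

text \<open>\<open>N\<close> stands for |sinh| or |cosh| at c z with Re z > a/2, and
  \<open>D\<close> for the other of the two. With t = c a/4 one has 2 |c| = 8 |t|/a, and (N + 1)/N^3
  decreases in N, so N may be lowered to |sinh (2 t)|, where \<open>weighted_csch_cube_le\<close>
  applies.\<close>

lemma lattice_derivative_bound:
  fixes c a N D :: real
  assumes a: "0 < a" and c: "c \<noteq> 0" and N: "\<bar>sinh (c * (a / 2))\<bar> \<le> N" and D: "0 \<le> D" "D \<le> N + 1"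
  shows "2 * \<bar>c\<bar> * D / N ^ 3 \<le> 8 / a * (1 / (sinh (c * (a / 4)))\<^sup>2)"
proof -
  define t where "t = c * (a / 4)"
  define u where "u = \<bar>sinh (2 * t)\<bar>"
  have e: "2 * t = c * (a / 2)" by (simp add: t_def)
  have u: "0 < u" "u \<le> N" unfolding u_def e using N a c by auto
  have dec: "(N + 1) / N ^ 3 \<le> (u + 1) / u ^ 3"
  proof -
    have "1 / N ^ 2 + 1 / N ^ 3 \<le> 1 / u ^ 2 + 1 / u ^ 3"
      using u by (intro add_mono frac_le power_mono) auto
    moreover have "(v + 1) / v ^ 3 = 1 / v ^ 2 + 1 / v ^ 3" if "v > 0" for v :: real
      using that by (simp add: field_simps power2_eq_square power3_eq_cube)
    ultimately show ?thesis using u by simp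
  qed
  have "2 * \<bar>c\<bar> * D / N ^ 3 \<le> 2 * \<bar>c\<bar> * (N + 1) / N ^ 3"
    using D u by (intro divide_right_mono mult_left_mono) auto
  also have "\<dots> = 8 / a * (\<bar>t\<bar> * ((N + 1) / N ^ 3))"
    using a by (simp add: t_def abs_mult)
  also have "\<dots> \<le> 8 / a * (\<bar>t\<bar> * ((u + 1) / u ^ 3))"
    using dec a by (intro mult_left_mono) auto
  also have "\<dots> \<le> 8 / a * (1 / (sinh t)\<^sup>2)"
    using weighted_csch_cube_le[of t] a by (intro mult_left_mono) (auto simp: u_def)
  finally show ?thesis by (simp add: t_def)
qed

lemma norm_sinh_le_cosh: "norm (sinh z) \<le> norm (cosh z) + 1" for z :: complex
proof (rule power2_le_imp_le)
  have "(norm (sinh z))\<^sup>2 = norm ((cosh z)\<^sup>2 - 1)" by (metis sinh_square_eq norm_power)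
  also have "\<dots> \<le> (norm (cosh z))\<^sup>2 + 1" by (rule order_trans[OF norm_triangle_ineq4]) (simp add: norm_power)
  also have "\<dots> \<le> (norm (cosh z) + 1)\<^sup>2" by (simp add: power2_sum)
  finally show "(norm (sinh z))\<^sup>2 \<le> (norm (cosh z) + 1)\<^sup>2" .
qed simp

lemma sinh_Re_scaled_le:
  fixes c r :: real
  assumes "0 < r" "r < Re z"
  shows "\<bar>sinh (c * r)\<bar> \<le> norm (sinh (of_real c * z))" "\<bar>sinh (c * r)\<bar> \<le> norm (cosh (of_real c * z))"
proof -
  have "\<bar>sinh (c * r)\<bar> \<le> \<bar>sinh (Re (of_real c * z))\<bar>"
    using assms by (intro abs_sinh_mono) (auto simp: abs_mult intro!: mult_left_mono)
  then show "\<bar>sinh (c * r)\<bar> \<le> norm (sinh (of_real c * z))" "\<bar>sinh (c * r)\<bar> \<le> norm (cosh (of_real c * z))"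
    using norm_sinh_ge[of "of_real c * z"] norm_cosh_ge[of "of_real c * z"] by linarith+
qed

text \<open>One statement serves csch^2 (S = sinh, D = cosh) and sech^2 (S = cosh, D = sinh), as
  |sinh| of the real part bounds both from below. The condition \<open>zero\<close> makes a term
  with c n = 0 vanish by division by zero, as its majorant does.\<close>

lemma reciprocal_square_series_has_derivative:
  fixes c :: "int \<Rightarrow> real" and S D :: "complex \<Rightarrow> complex" and S' D' :: "real \<Rightarrow> real"
  assumes a: "0 < a"
    and der_S: "\<And>z. (S has_field_derivative D z) (at z)"
    and lower: "\<And>b z r. 0 < r \<Longrightarrow> r < Re z \<Longrightarrow> \<bar>sinh (b * r)\<bar> \<le> norm (S (of_real b * z))"
    and upper: "\<And>z. norm (D z) \<le> norm (S z) + 1"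
    and real: "\<And>x. S (of_real x) = of_real (S' x)" "\<And>x. D (of_real x) = of_real (D' x)"
    and zero: "\<And>n. c n = 0 \<Longrightarrow> S 0 = 0"
    and summable: "\<And>r. 0 < r \<Longrightarrow> (\<lambda>n. 1 / (sinh (c n * r))\<^sup>2) summable_on UNIV"
  shows "((\<lambda>x. \<Sum>\<^sub>\<infinity>n. 1 / (S' (c n * x))\<^sup>2) has_real_derivative
      (\<Sum>\<^sub>\<infinity>n. - 2 * c n * D' (c n * a) / S' (c n * a) ^ 3)) (at a)"
    "(\<lambda>n. - 2 * c n * D' (c n * a) / S' (c n * a) ^ 3) summable_on UNIV"
proof -
  define f where "f = (\<lambda>n z. 1 / (S (of_real (c n) * z))\<^sup>2)"
  define f' where "f' = (\<lambda>n z. - 2 * of_real (c n) * D (of_real (c n) * z) / S (of_real (c n) * z) ^ 3)"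
  have low: "\<bar>sinh (c n * (a / 2))\<bar> \<le> norm (S (of_real (c n) * z))" if "a / 2 < Re z" for n z
    using lower[of "a / 2" z "c n"] that a by simp
  have pos: "0 < \<bar>sinh (c n * (a / 2))\<bar>" if "c n \<noteq> 0" for n using that a by simp
  have der: "(f n has_field_derivative f' n z) (at z)" if z: "a / 2 < Re z" for n z
  proof (cases "c n = 0")
    case False
    have "S (of_real (c n) * z) \<noteq> 0" using low[OF z, of n] pos[OF False] by auto
    then show ?thesis unfolding f_def f'_def
      by (auto intro!: derivative_eq_intros DERIV_chain2[OF der_S]
          simp: power2_eq_square power3_eq_cube divide_simps)
  qed (simp add: f_def f'_def)
  have M: "norm (f n z) \<le> 1 / (sinh (c n * (a / 2)))\<^sup>2" if z: "a / 2 < Re z" for n z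
  proof (cases "c n = 0")
    case False
    then have "1 / norm (S (of_real (c n) * z)) ^ 2 \<le> 1 / \<bar>sinh (c n * (a / 2))\<bar> ^ 2"
      using low[OF z, of n] pos by (intro frac_le power_mono) simp_all
    then show ?thesis by (simp only: f_def norm_divide norm_power norm_one power2_abs)
  qed (simp add: f_def zero)
  have f's: "(\<lambda>n. f' n z) summable_on UNIV" if z: "a / 2 < Re z" for z
  proof (rule abs_summable_summable, rule summable_on_comparison_test)
    show "(\<lambda>n. 8 / a * (1 / (sinh (c n * (a / 4)))\<^sup>2)) summable_on UNIV"
      using a by (intro summable_on_cmult_right summable) simp
    fix n
    show "norm (f' n z) \<le> 8 / a * (1 / (sinh (c n * (a / 4)))\<^sup>2)"
    proof (cases "c n = 0")
      case False
      have "norm (f' n z) = 2 * \<bar>c n\<bar> * norm (D (of_real (c n) * z)) / norm (S (of_real (c n) * z)) ^ 3"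
        by (simp add: f'_def norm_divide norm_mult norm_power)
      also have "\<dots> \<le> 8 / a * (1 / (sinh (c n * (a / 4)))\<^sup>2)"
        by (rule lattice_derivative_bound[OF a False low[OF z]]) (use upper in auto)
      finally show ?thesis .
    qed (simp add: f'_def)
  qed simp
  have g: "f n (of_real x) = of_real (1 / (S' (c n * x))\<^sup>2)"
    "f' n (of_real x) = of_real (- 2 * c n * D' (c n * x) / S' (c n * x) ^ 3)" for n x
  proof -
    have "of_real (c n) * complex_of_real x = of_real (c n * x)" by simp
    then show "f n (of_real x) = of_real (1 / (S' (c n * x))\<^sup>2)"
      "f' n (of_real x) = of_real (- 2 * c n * D' (c n * x) / S' (c n * x) ^ 3)"
      unfolding f_def f'_def by (simp_all only: real) simp_all
  qed
  show "((\<lambda>x. \<Sum>\<^sub>\<infinity>n. 1 / (S' (c n * x))\<^sup>2) has_real_derivative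
      (\<Sum>\<^sub>\<infinity>n. - 2 * c n * D' (c n * a) / S' (c n * a) ^ 3)) (at a)"
    "(\<lambda>n. - 2 * c n * D' (c n * a) / S' (c n * a) ^ 3) summable_on UNIV"
    by (rule real_series_has_derivative[OF a der summable M f's g]; use a in simp)+
qed

definition dcsch2 :: "real \<Rightarrow> real \<Rightarrow> real" where
  "dcsch2 c a = - 2 * c * cosh (c * a) / sinh (c * a) ^ 3"

definition dsech2 :: "real \<Rightarrow> real \<Rightarrow> real" where
  "dsech2 c a = - 2 * c * sinh (c * a) / cosh (c * a) ^ 3"

definition dY1 :: "real \<Rightarrow> real" where
  "dY1 a = (\<Sum>\<^sub>\<infinity>n::int. dcsch2 (of_int n) a)"

definition dY3 :: "real \<Rightarrow> real" where
  "dY3 a = (\<Sum>\<^sub>\<infinity>n::int. dsech2 (of_int n + 1/2) a)"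

lemma Y_derivatives:
  assumes a: "0 < a"
  shows "(csch_lattice.Y1 has_real_derivative dY1 a) (at a)"
    "(\<lambda>n::int. dcsch2 (of_int n) a) summable_on UNIV"
    "(csch_lattice.Y3 has_real_derivative dY3 a) (at a)"
    "(\<lambda>n::int. dsech2 (of_int n + 1/2) a) summable_on UNIV"
proof -
  have L: "csch_lattice r" if "0 < r" for r by unfold_locales (rule that)
  note R1 = reciprocal_square_series_has_derivative[OF a has_field_derivative_sinh[OF DERIV_ident, simplified]
      sinh_Re_scaled_le(1) norm_cosh_le_sinh sinh_of_real_complex cosh_of_real_complex _
      csch_lattice.Y1_summable[OF L]]
  \<comment> \<open>The sech terms at half-odd points are majorised by the csch terms there, whose
    series is that of \<open>Y4\<close>.\<close>
  note R3 = reciprocal_square_series_has_derivative[OF a has_field_derivative_cosh[OF DERIV_ident, simplified]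
      sinh_Re_scaled_le(2) norm_sinh_le_cosh cosh_of_real_complex sinh_of_real_complex _
      csch_lattice.Y_summable(5)[OF L]]
  show "(\<lambda>n::int. dcsch2 (of_int n) a) summable_on UNIV"
    unfolding dcsch2_def using R1(2) by simp
  show "(\<lambda>n::int. dsech2 (of_int n + 1/2) a) summable_on UNIV"
    unfolding dsech2_def using R3(2) half_odd_nonzero by simp
  have eq: "csch_lattice.Y1 x = (\<Sum>\<^sub>\<infinity>n::int. 1 / (sinh (of_int n * x))\<^sup>2)"
    "csch_lattice.Y3 x = (\<Sum>\<^sub>\<infinity>n::int. 1 / (cosh ((of_int n + 1/2) * x))\<^sup>2)" if "x \<in> {0<..}" for x
    using csch_lattice.Y1_def[OF L] csch_lattice.Y3_def[OF L] that by auto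
  show "(csch_lattice.Y1 has_real_derivative dY1 a) (at a)" unfolding dY1_def dcsch2_def
    by (rule has_field_derivative_transform_within_open[of _ _ _ "{0<..}"]) (use a R1(1) eq in auto)
  show "(csch_lattice.Y3 has_real_derivative dY3 a) (at a)" unfolding dY3_def dsech2_def
    by (rule has_field_derivative_transform_within_open[of _ _ _ "{0<..}"]) (use a R3(1) half_odd_nonzero eq in auto)
qed

section \<open>Eisenstein summation\<close>

lemma sin_pi_nonzero: "sin (of_real pi * z) \<noteq> 0" if "z \<notin> \<int>" for z :: complex
  using that by (simp add: sin_eq_0) (metis Ints_of_int mult_cancel_left mult.commute of_real_eq_0_iff pi_neq_zero)

text \<open>This is the logarithmic derivative of the reflection formula of Gamma. Its first and
  second derivatives will evaluate the inner sums, because polygamma functions are one-sided sums of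
  powers of 1/(z + k).\<close>

lemma Digamma_reflection:
  fixes z :: complex
  assumes "z \<notin> \<int>"
  shows "Digamma z - Digamma (1 - z) = - of_real pi * cos (of_real pi * z) / sin (of_real pi * z)"
proof -
  define s where "s = sin (of_real pi * z)"
  have s: "s \<noteq> 0" unfolding s_def by (rule sin_pi_nonzero[OF assms])
  have nz: "z \<notin> \<int>\<^sub>\<le>\<^sub>0" "1 - z \<notin> \<int>\<^sub>\<le>\<^sub>0"
    using assms nonpos_Ints_Int Ints_diff[of 1 "1 - z"] by auto
  have "((\<lambda>z. Gamma z * Gamma (1 - z)) has_field_derivative
      Gamma z * Gamma (1 - z) * (Digamma z - Digamma (1 - z))) (at z)"
    using nz by (auto intro!: derivative_eq_intros simp: algebra_simps)
  moreover have "((\<lambda>z. Gamma z * Gamma (1 - z)) has_field_derivative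
      - (of_real pi * (of_real pi * cos (of_real pi * z))) / (s * s)) (at z)"
    unfolding Gamma_reflection_complex using s unfolding s_def
    by (auto intro!: derivative_eq_intros)
  ultimately have "of_real pi / s * (Digamma z - Digamma (1 - z)) =
      - (of_real pi * (of_real pi * cos (of_real pi * z))) / (s * s)"
    unfolding s_def Gamma_reflection_complex[of z, symmetric] by (rule DERIV_unique)
  moreover have "Digamma z - Digamma (1 - z) = s / of_real pi * (of_real pi / s * (Digamma z - Digamma (1 - z)))"
    using s by simp
  ultimately have "Digamma z - Digamma (1 - z) = s / of_real pi * (- (of_real pi * (of_real pi * cos (of_real pi * z))) / (s * s))"
    by (simp only:)
  then show ?thesis unfolding s_def[symmetric] using s by simp
qed

lemma open_not_Ints: "open (- \<int> :: complex set)"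
  using closed_Ints[where ?'a = complex] by (simp add: open_Compl)

lemma Polygamma_reflections:
  fixes z :: complex
  assumes "z \<notin> \<int>"
  shows "Polygamma 1 z + Polygamma 1 (1 - z) = of_real pi ^ 2 / sin (of_real pi * z) ^ 2"
    "Polygamma 2 z - Polygamma 2 (1 - z) = - 2 * of_real pi ^ 3 * cos (of_real pi * z) / sin (of_real pi * z) ^ 3"
proof -
  have nz: "z \<notin> \<int>\<^sub>\<le>\<^sub>0" "1 - z \<notin> \<int>\<^sub>\<le>\<^sub>0" if "z \<notin> \<int>" for z :: complex
    using that nonpos_Ints_Int Ints_diff[of 1 "1 - z"] by auto
  have 1: "Polygamma 1 z + Polygamma 1 (1 - z) = of_real pi ^ 2 / sin (of_real pi * z) ^ 2"
    if z: "z \<notin> \<int>" for z :: complex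
  proof -
    note s = sin_pi_nonzero[OF z]
    have "((\<lambda>z. Digamma z - Digamma (1 - z)) has_field_derivative Polygamma 1 z + Polygamma 1 (1 - z)) (at z)"
      using nz[OF z] by (auto intro!: derivative_eq_intros)
    moreover have "((\<lambda>z. Digamma z - Digamma (1 - z)) has_field_derivative
       of_real pi ^ 2 / sin (of_real pi * z) ^ 2) (at z)"
    proof (rule has_field_derivative_transform_within_open[OF _ open_not_Ints])
      have "((\<lambda>z. - of_real pi * cos (of_real pi * z) / sin (of_real pi * z)) has_field_derivative
        of_real pi ^ 2 * (sin (of_real pi * z) ^ 2 + cos (of_real pi * z) ^ 2) / sin (of_real pi * z) ^ 2) (at z)"
      proof -
        define S where "S = sin (of_real pi * z)"
        define c where "c = cos (of_real pi * z)"
        have "((\<lambda>z. - of_real pi * cos (of_real pi * z)) has_field_derivative of_real pi * (of_real pi * S)) (at z)"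
          "((\<lambda>z. sin (of_real pi * z)) has_field_derivative of_real pi * c) (at z)"
          by (auto intro!: derivative_eq_intros simp: S_def c_def)
        from DERIV_divide[OF this s] have "((\<lambda>z. - of_real pi * cos (of_real pi * z) / sin (of_real pi * z)) has_field_derivative
          (of_real pi * (of_real pi * S) * S - (- of_real pi * c) * (of_real pi * c)) / (S * S)) (at z)"
          by (simp only: S_def c_def)
        also have "(of_real pi * (of_real pi * S) * S - (- of_real pi * c) * (of_real pi * c)) / (S * S)
           = of_real pi ^ 2 * (S ^ 2 + c ^ 2) / S ^ 2"
          by (simp add: power2_eq_square algebra_simps)
        finally show ?thesis unfolding S_def c_def .
      qed
      then show "((\<lambda>z. - of_real pi * cos (of_real pi * z) / sin (of_real pi * z)) has_field_derivative
        of_real pi ^ 2 / sin (of_real pi * z) ^ 2) (at z)" by simp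
    qed (use z Digamma_reflection in auto)
    ultimately show ?thesis by (rule DERIV_unique)
  qed
  show "Polygamma 1 z + Polygamma 1 (1 - z) = of_real pi ^ 2 / sin (of_real pi * z) ^ 2" by (rule 1[OF assms])
  note s = sin_pi_nonzero[OF assms]
  have "((\<lambda>z. Polygamma 1 z + Polygamma 1 (1 - z)) has_field_derivative Polygamma 2 z - Polygamma 2 (1 - z)) (at z)"
    using nz[OF assms] by (auto intro!: derivative_eq_intros simp: numeral_2_eq_2)
  moreover have "((\<lambda>z. Polygamma 1 z + Polygamma 1 (1 - z)) has_field_derivative
     - 2 * of_real pi ^ 3 * cos (of_real pi * z) / sin (of_real pi * z) ^ 3) (at z)"
  proof (rule has_field_derivative_transform_within_open[OF _ open_not_Ints])
    show "((\<lambda>z. of_real pi ^ 2 / sin (of_real pi * z) ^ 2) has_field_derivative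
       - 2 * of_real pi ^ 3 * cos (of_real pi * z) / sin (of_real pi * z) ^ 3) (at z)"
      using s by (auto intro!: derivative_eq_intros simp: divide_simps power2_eq_square power3_eq_cube)
  qed (use assms 1 in auto)
  ultimately show "Polygamma 2 z - Polygamma 2 (1 - z) = - 2 * of_real pi ^ 3 * cos (of_real pi * z) / sin (of_real pi * z) ^ 3"
    by (rule DERIV_unique)
qed

lemma sum_int_symmetric:
  fixes f :: "int \<Rightarrow> 'a :: comm_monoid_add"
  shows "(\<Sum>m = - int M..int M. f m) = (\<Sum>k<Suc M. f (int k)) + (\<Sum>k<M. f (- int k - 1))"
proof (induction M)
  case (Suc M)
  have "{- int (Suc M)..int (Suc M)} = insert (int (Suc M)) (insert (- int M - 1) {- int M..int M})" by auto
  then have "(\<Sum>m = - int (Suc M)..int (Suc M). f m) = f (int (Suc M)) + (f (- int M - 1) + (\<Sum>m = - int M..int M. f m))"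
    by simp
  then show ?case unfolding Suc.IH by (simp add: add_ac)
qed simp

lemma tendsto_sum_int_symmetric:
  fixes f :: "int \<Rightarrow> 'a :: real_normed_vector"
  assumes "(\<lambda>k. f (int k)) sums A" "(\<lambda>k. f (- int k - 1)) sums B"
  shows "(\<lambda>M. \<Sum>m = - int M..int M. f m) \<longlonglongrightarrow> A + B"
  unfolding sum_int_symmetric
  using assms by (intro tendsto_add LIMSEQ_Suc) (simp_all add: sums_def)

lemma infsum_tendsto_sum_int_symmetric:
  fixes f :: "int \<Rightarrow> 'a :: banach"
  assumes "f summable_on UNIV"
  shows "(\<lambda>M. \<Sum>m = - int M..int M. f m) \<longlonglongrightarrow> infsum f UNIV"
proof -
  have "(f has_sum infsum f UNIV) UNIV" using assms by simp
  then have "(sum f \<longlongrightarrow> infsum f UNIV) (finite_subsets_at_top UNIV)" by (simp add: has_sum_def)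
  moreover have "filterlim (\<lambda>M. {- int M..int M}) (finite_subsets_at_top UNIV) sequentially"
    unfolding filterlim_finite_subsets_at_top
  proof (intro allI impI)
    fix X :: "int set" assume X: "finite X \<and> X \<subseteq> UNIV"
    define N where "N = nat (\<Sum>x\<in>X. \<bar>x\<bar>)"
    have N: "\<bar>x\<bar> \<le> int N" if "x \<in> X" for x
      using member_le_sum[OF that, of abs] X by (simp add: N_def)
    show "\<forall>\<^sub>F M in sequentially. finite {- int M..int M} \<and> X \<subseteq> {- int M..int M} \<and> {- int M..int M} \<subseteq> UNIV"
      using eventually_ge_at_top[of N]
    proof eventually_elim
      case (elim M)
      have "x \<in> {- int M..int M}" if "x \<in> X" for x using N[OF that] elim by auto
      then show ?case by auto
    qed
  qed
  ultimately show ?thesis by (rule filterlim_compose)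
qed

text \<open>The half m \<ge> 0 of the symmetric sum is a polygamma value at z. For m = - k - 1 the
  base is - ((1 - z) + k), so the other half is one at 1 - z, with a sign for odd powers.\<close>

lemma inner_sums:
  fixes z :: complex
  assumes "z \<notin> \<int>"
  shows "(\<lambda>M. \<Sum>m = - int M..int M. 1 / (of_int m + z) ^ 2) \<longlonglongrightarrow> of_real pi ^ 2 / sin (of_real pi * z) ^ 2"
    "(\<lambda>M. \<Sum>m = - int M..int M. 1 / (of_int m + z) ^ 3) \<longlonglongrightarrow>
       of_real pi ^ 3 * cos (of_real pi * z) / sin (of_real pi * z) ^ 3"
proof -
  have nz: "z \<noteq> 0" "1 - z \<noteq> 0" using assms by auto
  have e: "complex_of_int (- int k - 1) + z = - ((1 - z) + of_nat k)" for k by simp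
  have A: "(\<lambda>k. 1 / (of_int (int k) + z) ^ 2) sums Polygamma 1 z"
    using Polygamma_LIMSEQ[OF nz(1), of 1] by (simp add: inverse_eq_divide add.commute numeral_2_eq_2)
  have B: "(\<lambda>k. 1 / (of_int (- int k - 1) + z) ^ 2) sums Polygamma 1 (1 - z)"
  proof -
    have "(\<lambda>k. 1 / (1 - z + of_nat k) ^ 2) sums Polygamma 1 (1 - z)"
      using Polygamma_LIMSEQ[OF nz(2), of 1] by (simp add: inverse_eq_divide numeral_2_eq_2)
    then show ?thesis unfolding e power2_minus .
  qed
  show "(\<lambda>M. \<Sum>m = - int M..int M. 1 / (of_int m + z) ^ 2) \<longlonglongrightarrow> of_real pi ^ 2 / sin (of_real pi * z) ^ 2"
    using tendsto_sum_int_symmetric[OF A B] unfolding Polygamma_reflections(1)[OF assms] .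
  have A: "(\<lambda>k. 1 / (of_int (int k) + z) ^ 3) sums (- Polygamma 2 z / 2)"
    using Polygamma_LIMSEQ[OF nz(1), of 2] by (simp add: inverse_eq_divide add.commute numeral_3_eq_3 fact_2)
  have "(\<lambda>k. inverse ((1 - z + of_nat k) ^ 3)) sums (- Polygamma 2 (1 - z) / 2)"
    using Polygamma_LIMSEQ[OF nz(2), of 2] by (simp add: numeral_3_eq_3 fact_2)
  note neg = sums_minus[OF this]
  have eq: "1 / (- w) ^ 3 = - inverse (w ^ 3)" for w :: complex
    by (simp add: power3_eq_cube inverse_eq_divide)
  have B: "(\<lambda>k. 1 / (of_int (- int k - 1) + z) ^ 3) sums (Polygamma 2 (1 - z) / 2)"
    unfolding e eq using neg by (simp only: minus_divide_left minus_minus)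
  have "- Polygamma 2 z / 2 + Polygamma 2 (1 - z) / 2 = - (Polygamma 2 z - Polygamma 2 (1 - z)) / 2"
    by (simp add: diff_divide_distrib)
  also have "\<dots> = of_real pi ^ 3 * cos (of_real pi * z) / sin (of_real pi * z) ^ 3"
    unfolding Polygamma_reflections(2)[OF assms] by simp
  finally show "(\<lambda>M. \<Sum>m = - int M..int M. 1 / (of_int m + z) ^ 3) \<longlonglongrightarrow>
       of_real pi ^ 3 * cos (of_real pi * z) / sin (of_real pi * z) ^ 3"
    using tendsto_sum_int_symmetric[OF A B] by simp
qed

text \<open>The value of the inner limit for \<open>n \<noteq> 0\<close>; the junk value for \<open>n = 0\<close> is \<open>0\<close>.\<close>
definition lattice_row :: "complex \<Rightarrow> int \<Rightarrow> complex" where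
  "lattice_row \<tau> n = of_real pi ^ 2 / sin (of_real pi * (of_int n * \<tau>)) ^ 2
     - 2 * \<i> * of_int n * of_real (Im \<tau>) * (of_real pi ^ 3 * cos (of_real pi * (of_int n * \<tau>)) / sin (of_real pi * (of_int n * \<tau>)) ^ 3)"

text \<open>The row n = 0 is 2 zeta(2) = pi^2/3. The other rows are summable in any order, so the
  symmetric outer limit is their \<open>infsum\<close>, which runs over all integers thanks to the
  default value of \<open>lattice_row\<close> at 0.\<close>

lemma T2_eq_rows:
  assumes \<tau>: "Im \<tau> \<noteq> 0" and s: "lattice_row \<tau> summable_on UNIV"
  shows "T2 \<tau> = of_real (Im \<tau>) * (of_real (pi\<^sup>2 / 3) + infsum (lattice_row \<tau>) UNIV)"
proof -
  define f where "f = (\<lambda>m n. if (m, n) = (0 :: int, 0 :: int) then 0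
        else (of_int m + of_int n * cnj \<tau>) / (of_int m + of_int n * \<tau>) ^ 3)"
  have rowlim: "(\<lambda>M. \<Sum>m = - int M..int M. f m n) \<longlonglongrightarrow> lattice_row \<tau> n" if n: "n \<noteq> 0" for n
  proof -
    define z where "z = of_int n * \<tau>"
    have Im: "Im z \<noteq> 0" using n \<tau> by (simp add: z_def)
    then have z: "z \<notin> \<int>" by (auto elim!: Ints_cases)
    have c: "of_int n * cnj \<tau> = z - 2 * \<i> * of_int n * of_real (Im \<tau>)"
      by (simp add: z_def complex_eq_iff)
    have t: "f m n = 1 / (of_int m + z) ^ 2 - 2 * \<i> * of_int n * of_real (Im \<tau>) * (1 / (of_int m + z) ^ 3)" for m
    proof -
      have "of_int m + z \<noteq> 0" using Im by (auto simp: complex_eq_iff)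
      then show ?thesis using n unfolding f_def z_def[symmetric] c
        by (simp add: power2_eq_square power3_eq_cube divide_simps)
    qed
    show ?thesis unfolding t sum_subtractf sum_distrib_left[symmetric] lattice_row_def z_def[symmetric]
      by (intro tendsto_diff tendsto_mult tendsto_const inner_sums z)
  qed
  have zerolim: "(\<lambda>M. \<Sum>m = - int M..int M. f m 0) \<longlonglongrightarrow> of_real (pi\<^sup>2 / 3)"
  proof -
    have "(\<lambda>n. complex_of_real (1 / (real n + 1)\<^sup>2)) sums of_real (pi\<^sup>2 / 6)"
      using sums_of_real[OF inverse_squares_sums, where 'a = complex] by (simp add: add.commute)
    then have S: "(\<lambda>n. 1 / (of_nat n + 1 :: complex)\<^sup>2) sums of_real (pi\<^sup>2 / 6)" by simp
    \<comment> \<open>This includes m = 0: the omitted term agrees with division by zero.\<close>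
    have f0: "f m 0 = 1 / (of_int m)\<^sup>2" for m by (simp add: f_def power2_eq_square power3_eq_cube)
    have "(\<lambda>k. f (- int k - 1) 0) sums of_real (pi\<^sup>2 / 6)"
    proof -
      have "complex_of_int (- int k - 1) = - (of_nat k + 1)" for k by simp
      then show ?thesis using S unfolding f0 by (simp only: power2_minus)
    qed
    moreover have "(\<lambda>k. f (int k) 0) sums of_real (pi\<^sup>2 / 6)"
    proof -
      have "(\<lambda>k. f (int (Suc k)) 0) sums of_real (pi\<^sup>2 / 6)" using S unfolding f0 by (simp add: add.commute)
      then have "(\<lambda>k. f (int k) 0) sums (of_real (pi\<^sup>2 / 6) + f (int 0) 0)" by (subst (asm) sums_Suc_iff)
      then show ?thesis by (simp add: f0)
    qed
    ultimately have "(\<lambda>M. \<Sum>m = - int M..int M. f m 0) \<longlonglongrightarrow> of_real (pi\<^sup>2 / 6) + of_real (pi\<^sup>2 / 6)"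
      by (intro tendsto_sum_int_symmetric)
    then show ?thesis by simp
  qed
  have row0: "lattice_row \<tau> 0 = 0" by (simp add: lattice_row_def)
  have inner: "lim (\<lambda>M. \<Sum>m = - int M..int M. f m n) = lattice_row \<tau> n + (if n = 0 then of_real (pi\<^sup>2 / 3) else 0)" for n
    using limI[OF rowlim[of n]] limI[OF zerolim] row0 by (cases "n = 0") auto
  have "(\<lambda>N. (\<Sum>n = - int N..int N. lattice_row \<tau> n) + of_real (pi\<^sup>2 / 3)) \<longlonglongrightarrow> infsum (lattice_row \<tau>) UNIV + of_real (pi\<^sup>2 / 3)"
    by (intro tendsto_add tendsto_const infsum_tendsto_sum_int_symmetric s)
  moreover have "(\<Sum>n = - int N..int N. lim (\<lambda>M. \<Sum>m = - int M..int M. f m n))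
     = (\<Sum>n = - int N..int N. lattice_row \<tau> n) + of_real (pi\<^sup>2 / 3)" for N
    unfolding inner sum.distrib by simp
  ultimately have "eisenstein_sum f = infsum (lattice_row \<tau>) UNIV + of_real (pi\<^sup>2 / 3)"
    unfolding eisenstein_sum_def by (simp add: limI)
  then show ?thesis unfolding T2_def f_def[symmetric] by (simp add: add.commute)
qed

section \<open>Rows as hyperbolic terms\<close>

lemma has_sum_Y1:
  assumes "0 < a"
  shows "((\<lambda>n::int. - pi\<^sup>2 * (1 / (sinh (of_int n * a))\<^sup>2 + a * dcsch2 (of_int n) a))
     has_sum (- pi\<^sup>2 * (csch_lattice.Y1 a + a * dY1 a))) UNIV"
proof -
  interpret csch_lattice a by unfold_locales (rule assms)
  show ?thesis unfolding Y1_def dY1_def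
    by (intro has_sum_cmult_right has_sum_add has_sum_infsum Y1_summable Y_derivatives(2) assms)
qed

lemma has_sum_Y3:
  assumes "0 < a"
  shows "((\<lambda>n::int. pi\<^sup>2 * (1 / (cosh ((of_int n + 1/2) * a))\<^sup>2 + a * dsech2 (of_int n + 1/2) a))
     has_sum (pi\<^sup>2 * (csch_lattice.Y3 a + a * dY3 a))) UNIV"
proof -
  interpret csch_lattice a by unfold_locales (rule assms)
  show ?thesis unfolding Y3_def dY3_def
    by (intro has_sum_cmult_right has_sum_add has_sum_infsum Y_summable Y_derivatives(4) assms)
qed

text \<open>The combination is the derivative of a / sinh^2 (c a) at a = pi x, an even function of
  a. It lets negative x be treated with the positive lattice parameter a = pi |x|.\<close>

lemma csch_terms_even:
  "1 / (sinh (c * (pi * x)))\<^sup>2 + pi * x * dcsch2 c (pi * x) =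
   1 / (sinh (c * (pi * \<bar>x\<bar>)))\<^sup>2 + pi * \<bar>x\<bar> * dcsch2 c (pi * \<bar>x\<bar>)"
  by (cases "0 \<le> x") (simp_all add: dcsch2_def power2_eq_square power3_eq_cube)

lemma sech_terms_even:
  "1 / (cosh (c * (pi * x)))\<^sup>2 + pi * x * dsech2 c (pi * x) =
   1 / (cosh (c * (pi * \<bar>x\<bar>)))\<^sup>2 + pi * \<bar>x\<bar> * dsech2 c (pi * \<bar>x\<bar>)"
  by (cases "0 \<le> x") (simp_all add: dsech2_def)

text \<open>Meant for integral n Re \<tau>: then pi n \<tau> is i y up to a multiple of pi, and the
  resulting sign \<sigma> cancels, since it enters as \<sigma>^2 or \<sigma>/\<sigma>^3. The number
  \<open>c\<close> is the height n Im \<tau> of the row in units of x.\<close>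

lemma row_of_sinh:
  fixes c x :: real
  defines "y \<equiv> c * (pi * x)"
  assumes "sin (of_real pi * (of_int n * \<tau>)) = \<sigma> * \<i> * of_real (sinh y)"
    "cos (of_real pi * (of_int n * \<tau>)) = \<sigma> * of_real (cosh y)" "\<sigma>\<^sup>2 = 1"
    and c: "of_int n * Im \<tau> = c * x"
  shows "lattice_row \<tau> n =
    of_real (- pi\<^sup>2 * (1 / (sinh (c * (pi * \<bar>x\<bar>)))\<^sup>2 + pi * \<bar>x\<bar> * dcsch2 c (pi * \<bar>x\<bar>)))"
proof -
  have e3: "\<sigma> ^ 3 = \<sigma>" "\<sigma> \<noteq> 0" using assms(4) by (auto simp: power2_eq_square power3_eq_cube)
  have f1: "of_real pi ^ 2 / (\<sigma> * \<i> * of_real (sinh y)) ^ 2 = - (of_real pi ^ 2 * (1 / of_real (sinh y) ^ 2))"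
    using assms(4) by (simp add: power_mult_distrib)
  have f2: "of_real pi ^ 3 * (\<sigma> * of_real (cosh y)) / (\<sigma> * \<i> * of_real (sinh y)) ^ 3 =
      of_real pi ^ 3 * (\<i> * of_real (cosh y)) / of_real (sinh y) ^ 3"
    unfolding power_mult_distrib e3(1) using e3(2)
    by (cases "sinh y = 0") (simp_all add: power3_eq_cube field_simps)
  have "lattice_row \<tau> n = of_real (- pi\<^sup>2 * (1 / (sinh y)\<^sup>2 + pi * (- 2 * (of_int n * Im \<tau>) * cosh y / sinh y ^ 3)))"
    unfolding lattice_row_def assms(2,3) f1 f2
    by (simp add: algebra_simps power2_eq_square power3_eq_cube)
  also have "pi * (- 2 * (of_int n * Im \<tau>) * cosh y / sinh y ^ 3) = pi * x * dcsch2 c (pi * x)"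
    unfolding c by (simp add: dcsch2_def y_def)
  finally show ?thesis unfolding y_def csch_terms_even[of c x] .
qed

text \<open>Meant for half-odd n Re \<tau>, where sine and cosine exchange their roles.\<close>

lemma row_of_cosh:
  fixes c x :: real
  defines "y \<equiv> c * (pi * x)"
  assumes "sin (of_real pi * (of_int n * \<tau>)) = \<sigma> * of_real (cosh y)"
    "cos (of_real pi * (of_int n * \<tau>)) = - \<sigma> * \<i> * of_real (sinh y)" "\<sigma>\<^sup>2 = 1"
    and c: "of_int n * Im \<tau> = c * x"
  shows "lattice_row \<tau> n =
    of_real (pi\<^sup>2 * (1 / (cosh (c * (pi * \<bar>x\<bar>)))\<^sup>2 + pi * \<bar>x\<bar> * dsech2 c (pi * \<bar>x\<bar>)))"
proof -
  have e3: "\<sigma> ^ 3 = \<sigma>" "\<sigma> \<noteq> 0" using assms(4) by (auto simp: power2_eq_square power3_eq_cube)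
  have f1: "of_real pi ^ 2 / (\<sigma> * of_real (cosh y)) ^ 2 = of_real pi ^ 2 * (1 / of_real (cosh y) ^ 2)"
    using assms(4) by (simp add: power_mult_distrib)
  have f2: "of_real pi ^ 3 * (- \<sigma> * \<i> * of_real (sinh y)) / (\<sigma> * of_real (cosh y)) ^ 3 =
      of_real pi ^ 3 * (- \<i> * of_real (sinh y)) / of_real (cosh y) ^ 3"
    unfolding power_mult_distrib e3(1) using e3(2) by simp
  have "lattice_row \<tau> n = of_real (pi\<^sup>2 * (1 / (cosh y)\<^sup>2 + pi * (- 2 * (of_int n * Im \<tau>) * sinh y / cosh y ^ 3)))"
    unfolding lattice_row_def assms(2,3) f1 f2
    by (simp add: algebra_simps power2_eq_square power3_eq_cube)
  also have "pi * (- 2 * (of_int n * Im \<tau>) * sinh y / cosh y ^ 3) = pi * x * dsech2 c (pi * x)"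
    unfolding c by (simp add: dsech2_def y_def)
  finally show ?thesis unfolding y_def sech_terms_even[of c x] .
qed

lemma sin_cos_imaginary:
  "sin (\<i> * of_real y) = \<i> * of_real (sinh y)" "cos (\<i> * of_real y) = of_real (cosh y)"
  by (simp_all add: sin_conv_sinh cos_conv_cosh sinh_of_real_complex cosh_of_real_complex flip: mult.assoc)

lemma T2_imaginary:
  assumes "x \<noteq> 0" and a_def: "a = pi * \<bar>x\<bar>"
  shows "T2 (\<i> * of_real x) = of_real (x * (pi\<^sup>2 / 3 - pi\<^sup>2 * (csch_lattice.Y1 a + a * dY1 a)))"
proof -
  define \<tau> where "\<tau> = \<i> * complex_of_real x"
  have a: "0 < a" using assms by simp
  have r: "lattice_row \<tau> n = of_real (- pi\<^sup>2 * (1 / (sinh (of_int n * a))\<^sup>2 + a * dcsch2 (of_int n) a))" for n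
  proof -
    have e: "of_real pi * (of_int n * \<tau>) = \<i> * of_real (of_int n * (pi * x))" by (simp add: \<tau>_def)
    show ?thesis unfolding a_def
      by (rule row_of_sinh[of _ _ 1]) (simp_all only: e sin_cos_imaginary, simp_all add: \<tau>_def)
  qed
  have S: "(lattice_row \<tau> has_sum of_real (- pi\<^sup>2 * (csch_lattice.Y1 a + a * dY1 a))) UNIV"
    unfolding r by (rule has_sum_of_real[OF has_sum_Y1[OF a]])
  show ?thesis
    using T2_eq_rows[of \<tau>, OF _ has_sum_imp_summable[OF S]] assms(1)
    unfolding infsumI[OF S] by (simp add: \<tau>_def)
qed

text \<open>The even rows of (+-1 + i x)/2 are the rows of i x; the odd ones, with half-odd real
  part, contribute the sech sums.\<close>

lemma T2_half:
  assumes "x \<noteq> 0" and a_def: "a = pi * \<bar>x\<bar>" and s: "s \<in> {1, - 1 :: complex}"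
  shows "T2 ((s + \<i> * of_real x) / 2) = of_real (x / 2 * (pi\<^sup>2 / 3
     - pi\<^sup>2 * (csch_lattice.Y1 a + a * dY1 a) + pi\<^sup>2 * (csch_lattice.Y3 a + a * dY3 a)))"
proof -
  define \<tau> where "\<tau> = (s + \<i> * complex_of_real x) / 2"
  have Im: "Im \<tau> = x / 2" using s by (auto simp: \<tau>_def)
  have a: "0 < a" using assms by simp
  obtain r where r: "s = of_real r" "r = 1 \<or> r = - 1" using s by (metis insertE of_real_1 of_real_minus singletonD)
  have even: "lattice_row \<tau> (2 * n) = of_real (- pi\<^sup>2 * (1 / (sinh (of_int n * a))\<^sup>2 + a * dcsch2 (of_int n) a))" for n
  proof -
    define \<theta> where "\<theta> = r * (of_int n * pi)"
    have e: "of_real pi * (of_int (2 * n) * \<tau>) = of_real \<theta> + \<i> * of_real (of_int n * (pi * x))"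
      by (simp add: \<tau>_def \<theta>_def r(1) algebra_simps add_divide_distrib)
    have sn: "sin \<theta> = 0" "(cos \<theta>)\<^sup>2 = 1"
      using r(2) sin_zero_iff_int2[of "of_int n * pi"] sin_cos_squared_add[of "of_int n * pi"] by (auto simp: \<theta>_def)
    define \<sigma> where "\<sigma> = complex_of_real (cos \<theta>)"
    have "\<sigma>\<^sup>2 = 1" using sn(2) unfolding \<sigma>_def of_real_power[symmetric] by (simp only: of_real_1)
    moreover have "sin (of_real pi * (of_int (2 * n) * \<tau>)) = \<sigma> * \<i> * of_real (sinh (of_int n * (pi * x)))"
      "cos (of_real pi * (of_int (2 * n) * \<tau>)) = \<sigma> * of_real (cosh (of_int n * (pi * x)))"
      unfolding e sin_add cos_add sin_of_real cos_of_real sn(1) sin_cos_imaginary \<sigma>_def[symmetric] by simp_all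
    moreover have "of_int (2 * n) * Im \<tau> = of_int n * x" by (simp add: Im)
    ultimately show ?thesis unfolding a_def using row_of_sinh by blast
  qed
  have odd: "lattice_row \<tau> (2 * n + 1) =
      of_real (pi\<^sup>2 * (1 / (cosh ((of_int n + 1/2) * a))\<^sup>2 + a * dsech2 (of_int n + 1/2) a))" for n
  proof -
    define c where "c = (of_int n + 1/2 :: real)"
    define \<theta> where "\<theta> = r * (c * pi)"
    have e: "of_real pi * (of_int (2 * n + 1) * \<tau>) = of_real \<theta> + \<i> * of_real (c * (pi * x))"
      by (simp add: \<tau>_def \<theta>_def c_def r(1) algebra_simps add_divide_distrib)
    have "cos (c * pi) = 0"
    proof -
      have "c * pi = of_int n * pi + pi / 2" by (simp add: c_def algebra_simps)
      moreover have "sin (of_int n * pi) = 0" using sin_zero_iff_int2 by blast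
      ultimately show ?thesis by (simp add: cos_add)
    qed
    then have sn: "cos \<theta> = 0" "(sin \<theta>)\<^sup>2 = 1"
      using r(2) sin_cos_squared_add[of "c * pi"] by (auto simp: \<theta>_def)
    define \<sigma> where "\<sigma> = complex_of_real (sin \<theta>)"
    have "\<sigma>\<^sup>2 = 1" using sn(2) unfolding \<sigma>_def of_real_power[symmetric] by (simp only: of_real_1)
    moreover have "sin (of_real pi * (of_int (2 * n + 1) * \<tau>)) = \<sigma> * of_real (cosh (c * (pi * x)))"
      "cos (of_real pi * (of_int (2 * n + 1) * \<tau>)) = - \<sigma> * \<i> * of_real (sinh (c * (pi * x)))"
      unfolding e sin_add cos_add sin_of_real cos_of_real sn(1) sin_cos_imaginary \<sigma>_def[symmetric] by simp_all
    moreover have "of_int (2 * n + 1) * Im \<tau> = c * x" by (simp add: Im c_def field_simps)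
    ultimately show ?thesis unfolding a_def c_def[symmetric] using row_of_cosh by blast
  qed
  have S1: "((\<lambda>n. lattice_row \<tau> (2 * n)) has_sum of_real (- pi\<^sup>2 * (csch_lattice.Y1 a + a * dY1 a))) UNIV"
    unfolding even by (rule has_sum_of_real[OF has_sum_Y1[OF a]])
  have S3: "((\<lambda>n. lattice_row \<tau> (2 * n + 1)) has_sum of_real (pi\<^sup>2 * (csch_lattice.Y3 a + a * dY3 a))) UNIV"
    unfolding odd by (rule has_sum_of_real[OF has_sum_Y3[OF a]])
  note S = has_sum_int_even_odd[OF S1 S3]
  show ?thesis
    using T2_eq_rows[of \<tau>, OF _ has_sum_imp_summable[OF S]] assms(1)
    unfolding infsumI[OF S] Im by (simp add: \<tau>_def[symmetric] algebra_simps)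
qed

text \<open>At the argument r = K(k')/K(k) one has dk/dr = - 2 k (1 - k^2) K(k)^2 / pi, and
  multiplication by r turns K(k)^2 into K(k') K(k). This is the origin of (2/pi) K(k') K(k) in the
  final formulas.\<close>

lemma derivative_along_period_ratio:
  assumes k: "0 < k" "k < 1"
    and G: "(G has_real_derivative G') (at (period_ratio k))"
    and eq: "\<And>l. 0 < l \<Longrightarrow> l < 1 \<Longrightarrow> G (period_ratio l) = R l"
    and R: "(R has_real_derivative R') (at k)"
  shows "period_ratio k * G' = - (2 / pi * elliptic_K (sqrt (1 - k\<^sup>2)) * elliptic_K k * (k * (1 - k\<^sup>2) * R'))"
proof -
  define K where "K = elliptic_K k"
  define M where "M = 1 - k\<^sup>2"
  have K: "0 < K" and M: "0 < M"
    using elliptic_K_pos[OF k] k by (auto simp: K_def M_def abs_square_less_1)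
  have "((\<lambda>l. G (period_ratio l)) has_real_derivative G' * - (pi / (2 * k * M * K\<^sup>2))) (at k)"
    unfolding K_def M_def by (rule DERIV_chain2[OF G period_ratio_has_derivative[OF k]])
  moreover have "((\<lambda>l. G (period_ratio l)) has_real_derivative R') (at k)"
    by (rule has_field_derivative_transform_within_open[OF R, of "{0<..<1}"]) (use k eq in auto)
  ultimately have "R' = G' * - (pi / (2 * k * M * K\<^sup>2))" by (rule DERIV_unique[symmetric])
  then have "R' * (2 * k * M * K\<^sup>2) = - G' * pi"
    using K M k by simp
  then have G': "G' = - (R' * (2 * k * M * K\<^sup>2)) / pi" by (simp add: field_simps)
  have "elliptic_K (sqrt (1 - k\<^sup>2)) / K * G' = - (2 / pi * elliptic_K (sqrt (1 - k\<^sup>2)) * K * (k * M * R'))"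
    unfolding G' using K by (simp add: power2_eq_square)
  then show ?thesis by (simp add: period_ratio_def K_def M_def)
qed

text \<open>Both evaluations have this shape, with (c, d, e) = (3, 1, 2) on the imaginary axis and
  (6, 4, 5) for real part +-1/2. The denominator k (1 - k^2) is kept apart because the chain rule
  multiplies by it.\<close>

lemma elliptic_combination_has_derivative:
  assumes "0 < k" "k < 1"
  defines "K \<equiv> elliptic_K k" and "E \<equiv> elliptic_E k"
  shows "((\<lambda>l. 4 / 3 * elliptic_K l * (c * elliptic_E l + (d * l\<^sup>2 - e) * elliptic_K l)) has_real_derivative
     4 / 3 * ((E - (1 - k\<^sup>2) * K) * (c * E + (d * k\<^sup>2 - e) * K)
       + K * (c * (1 - k\<^sup>2) * (E - K) + 2 * d * k\<^sup>2 * (1 - k\<^sup>2) * K + (d * k\<^sup>2 - e) * (E - (1 - k\<^sup>2) * K)))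
     / (k * (1 - k\<^sup>2))) (at k)"
proof -
  define M where "M = 1 - k\<^sup>2"
  have M: "0 < M" using assms by (auto simp: M_def abs_square_less_1)
  define DK where "DK = (E - M * K) / (k * M)"
  define DE where "DE = (E - K) / k"
  have dK: "(elliptic_K has_real_derivative DK) (at k)" and dE: "(elliptic_E has_real_derivative DE) (at k)"
    using elliptic_K_has_derivative[OF assms(1,2)] elliptic_E_has_derivative[OF assms(1,2)]
    by (simp_all add: DK_def DE_def K_def E_def M_def)
  have dp: "((\<lambda>l. d * l\<^sup>2 - e) has_real_derivative d * (2 * k)) (at k)"
    by (auto intro!: derivative_eq_intros)
  have "((\<lambda>l. 4 / 3 * elliptic_K l * (c * elliptic_E l + (d * l\<^sup>2 - e) * elliptic_K l)) has_real_derivative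
     4 / 3 * K * (c * DE + ((d * k\<^sup>2 - e) * DK + d * (2 * k) * K))
       + 4 / 3 * DK * (c * E + (d * k\<^sup>2 - e) * K)) (at k)"
    unfolding K_def E_def by (intro DERIV_mult' DERIV_cmult DERIV_add dK dE dp)
  then show ?thesis
  proof (rule DERIV_cong)
    show "4 / 3 * K * (c * DE + ((d * k\<^sup>2 - e) * DK + d * (2 * k) * K)) + 4 / 3 * DK * (c * E + (d * k\<^sup>2 - e) * K)
      = 4 / 3 * ((E - (1 - k\<^sup>2) * K) * (c * E + (d * k\<^sup>2 - e) * K)
       + K * (c * (1 - k\<^sup>2) * (E - K) + 2 * d * k\<^sup>2 * (1 - k\<^sup>2) * K + (d * k\<^sup>2 - e) * (E - (1 - k\<^sup>2) * K)))
     / (k * (1 - k\<^sup>2))"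
    proof -
      define p where "p = d * k\<^sup>2 - e"
      have "k * M * (4 / 3 * K * (c * DE + (p * DK + d * (2 * k) * K)) + 4 / 3 * DK * (c * E + p * K))
        = 4 / 3 * K * (c * M * (k * DE) + (p * (k * M * DK) + d * 2 * k\<^sup>2 * M * K)) + 4 / 3 * (k * M * DK) * (c * E + p * K)"
        by (simp add: algebra_simps power2_eq_square)
      also have "k * DE = E - K" using assms(1) by (simp add: DE_def)
      also have "k * M * DK = E - M * K" using assms(1) M by (simp add: DK_def)
      also have "4 / 3 * K * (c * M * (E - K) + (p * (E - M * K) + d * 2 * k\<^sup>2 * M * K)) + 4 / 3 * (E - M * K) * (c * E + p * K) =
          4 / 3 * ((E - M * K) * (c * E + p * K) + K * (c * M * (E - K) + 2 * d * k\<^sup>2 * M * K + p * (E - M * K)))"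
      proof -
        have "q * K * (c * M * (E - K) + (p * X + d * 2 * k\<^sup>2 * M * K)) + q * X * (c * E + p * K) =
          q * (X * (c * E + p * K) + K * (c * M * (E - K) + 2 * d * k\<^sup>2 * M * K + p * X))" for q X
          by (simp add: algebra_simps)
        then show ?thesis .
      qed
      finally show ?thesis
        unfolding M_def[symmetric] p_def[symmetric]
        using assms(1) M by (simp add: eq_divide_eq mult.commute)
    qed
  qed
qed

theorem theorem3:
  fixes x k k' :: real
  assumes "x \<noteq> 0"
    and "0 < k" and "k < 1"
    and "k' = sqrt (1 - k\<^sup>2)"
    and "\<bar>x\<bar> = elliptic_K k' / elliptic_K k"
  shows "T2 (\<i> * of_real x) = of_real
      (4 / 3 * sgn x * elliptic_K k' *
        ((1 - 2 / pi * elliptic_K k' * elliptic_E k) *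
           (3 * elliptic_E k + (k\<^sup>2 - 2) * elliptic_K k)
         - 2 / pi * elliptic_K k' * elliptic_K k *
           ((1 - k\<^sup>2) * (elliptic_K k - elliptic_E k) - elliptic_E k)))
    \<and> (\<forall>s \<in> {1, -1}. T2 ((s + \<i> * of_real x) / 2) = of_real
      (2 / 3 * sgn x * elliptic_K k' *
        ((6 * elliptic_E k + elliptic_K k * (4 * k\<^sup>2 - 5)) *
           (1 - 2 / pi * elliptic_K k' * (elliptic_E k + elliptic_K k * (k\<^sup>2 - 1)))
         - 2 / pi * elliptic_K k' * elliptic_K k *
           ((1 - 2 * k\<^sup>2) * elliptic_E k + (4 * k\<^sup>2 - 1) * (1 - k\<^sup>2) * elliptic_K k))))"
proof -
  note k = assms(2,3)
  define K where "K = elliptic_K k"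
  define E where "E = elliptic_E k"
  define K' where "K' = elliptic_K k'"
  define M where "M = 1 - k\<^sup>2"
  have K: "0 < K" and M: "0 < M" using elliptic_K_pos[OF k] k by (auto simp: K_def M_def abs_square_less_1)
  have \<rho>: "period_ratio k = \<bar>x\<bar>" using assms(4,5) by (simp add: period_ratio_def)
  \<comment> \<open>This converts the factor |x| K of the lattice sums into the prefactor K(k') of
    the result.\<close>
  have xK: "\<bar>x\<bar> * K = K'" using assms(5) K by (simp add: K_def K'_def)
  have sx: "sgn x * \<bar>x\<bar> = x" by (rule sgn_mult_abs)
  define a where "a = pi * \<bar>x\<bar>"
  have a: "0 < a" using assms(1) by (simp add: a_def)
  \<comment> \<open>With the Eisenstein-summed series G_2, these are r -> G_2(i r) and r -> G_2((+-1
    + i r)/2).\<close>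
  define G1 where "G1 = (\<lambda>r. pi\<^sup>2 / 3 - pi\<^sup>2 * csch_lattice.Y1 (pi * r))"
  define G3 where "G3 = (\<lambda>r. pi\<^sup>2 / 3 - pi\<^sup>2 * csch_lattice.Y1 (pi * r) + pi\<^sup>2 * csch_lattice.Y3 (pi * r))"
  define R1 where "R1 = (\<lambda>l. 4 / 3 * elliptic_K l * (3 * elliptic_E l + (1 * l\<^sup>2 - 2) * elliptic_K l))"
  define R3 where "R3 = (\<lambda>l. 4 / 3 * elliptic_K l * (6 * elliptic_E l + (4 * l\<^sup>2 - 5) * elliptic_K l))"
  have eq1: "G1 (period_ratio l) = R1 l" and eq3: "G3 (period_ratio l) = R3 l" if "0 < l" "l < 1" for l
    using lattice_sums_elliptic[OF that]
    by (simp_all add: G1_def G3_def R1_def R3_def algebra_simps power2_eq_square)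
  have dmul: "((\<lambda>r. pi * r) has_real_derivative pi) (at \<bar>x\<bar>)" by (auto intro!: derivative_eq_intros)
  have y1: "((\<lambda>r. csch_lattice.Y1 (pi * r)) has_real_derivative dY1 a * pi) (at \<bar>x\<bar>)"
    by (rule DERIV_chain2[OF _ dmul]) (use Y_derivatives(1)[OF a] in \<open>simp add: a_def\<close>)
  have y3: "((\<lambda>r. csch_lattice.Y3 (pi * r)) has_real_derivative dY3 a * pi) (at \<bar>x\<bar>)"
    by (rule DERIV_chain2[OF _ dmul]) (use Y_derivatives(3)[OF a] in \<open>simp add: a_def\<close>)
  have g1: "(G1 has_real_derivative (0 - pi\<^sup>2 * (dY1 a * pi))) (at (period_ratio k))"
    unfolding \<rho> G1_def by (intro DERIV_diff DERIV_const DERIV_cmult y1)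
  have g3: "(G3 has_real_derivative (0 - pi\<^sup>2 * (dY1 a * pi) + pi\<^sup>2 * (dY3 a * pi))) (at (period_ratio k))"
    unfolding \<rho> G3_def by (intro DERIV_add DERIV_diff DERIV_const DERIV_cmult y1 y3)
  note r1 = elliptic_combination_has_derivative[OF k, of 3 1 2, folded R1_def K_def E_def M_def]
  note r3 = elliptic_combination_has_derivative[OF k, of 6 4 5, folded R3_def K_def E_def M_def]
  note d1 = derivative_along_period_ratio[OF k g1 eq1 r1, folded assms(4) K_def K'_def M_def]
  note d3 = derivative_along_period_ratio[OF k g3 eq3 r3, folded assms(4) K_def K'_def M_def]
  have cancel: "k * M * (z / (k * M)) = z" for z using k M by simp
  have k2: "k\<^sup>2 = 1 - M" by (simp add: M_def)
  \<comment> \<open>The derivative is arranged so that the bracket 3 E + (k^2 - 2) K of the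
    undifferentiated value reappears as a factor of E; the two then merge into the product with 1 -
    (2/pi) K' E. The next identity \<open>e3\<close> does the same with E - M K in place of
    E.\<close>
  have e1: "- (pi\<^sup>2 * (a * dY1 a)) = - (2 / pi * K' * K * (4 / 3 * (E * (3 * E + (k\<^sup>2 - 2) * K) + K * (M * (K - E) - E))))"
  proof -
    have "- (pi\<^sup>2 * (a * dY1 a)) = period_ratio k * (0 - pi\<^sup>2 * (dY1 a * pi))" by (simp add: \<rho> a_def)
    also note d1
    also note cancel
    also have "(4 / 3 * ((E - M * K) * (3 * E + (1 * k\<^sup>2 - 2) * K)
       + K * (3 * M * (E - K) + 2 * 1 * k\<^sup>2 * M * K + (1 * k\<^sup>2 - 2) * (E - M * K))))
      = 4 / 3 * (E * (3 * E + (k\<^sup>2 - 2) * K) + K * (M * (K - E) - E))"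
      unfolding k2 by (simp add: algebra_simps)
    finally show ?thesis .
  qed
  have e3: "- (pi\<^sup>2 * (a * dY1 a)) + pi\<^sup>2 * (a * dY3 a) =
     - (2 / pi * K' * K * (4 / 3 * ((E - M * K) * (6 * E + (4 * k\<^sup>2 - 5) * K) + K * ((1 - 2 * k\<^sup>2) * E + (4 * k\<^sup>2 - 1) * M * K))))"
  proof -
    have "- (pi\<^sup>2 * (a * dY1 a)) + pi\<^sup>2 * (a * dY3 a)
      = period_ratio k * (0 - pi\<^sup>2 * (dY1 a * pi) + pi\<^sup>2 * (dY3 a * pi))" by (simp add: \<rho> a_def algebra_simps)
    also note d3
    also note cancel
    also have "(4 / 3 * ((E - M * K) * (6 * E + (4 * k\<^sup>2 - 5) * K)
       + K * (6 * M * (E - K) + 2 * 4 * k\<^sup>2 * M * K + (4 * k\<^sup>2 - 5) * (E - M * K))))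
      = 4 / 3 * ((E - M * K) * (6 * E + (4 * k\<^sup>2 - 5) * K) + K * ((1 - 2 * k\<^sup>2) * E + (4 * k\<^sup>2 - 1) * M * K))"
      unfolding k2 by (simp add: algebra_simps)
    finally show ?thesis .
  qed
  define S1 where "S1 = 3 * E + (k\<^sup>2 - 2) * K"
  define S3 where "S3 = 6 * E + (4 * k\<^sup>2 - 5) * K"
  have v1: "pi\<^sup>2 / 3 - pi\<^sup>2 * csch_lattice.Y1 a = 4 / 3 * K * S1"
    using eq1[OF k] by (simp add: \<rho> G1_def R1_def a_def K_def E_def S1_def)
  have v3: "pi\<^sup>2 / 3 - pi\<^sup>2 * csch_lattice.Y1 a + pi\<^sup>2 * csch_lattice.Y3 a = 4 / 3 * K * S3"
    using eq3[OF k] by (simp add: \<rho> G3_def R3_def a_def K_def E_def S3_def)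
  have r1: "S1 - u * (E * S1 + K * N) = (1 - u * E) * S1 - u * K * N"
    and r3: "S3 - u * (X * S3 + K * N) = S3 * (1 - u * X) - u * K * N" for u X N
    by (simp_all add: algebra_simps)
  have r4: "p * q / 2 * (4 / 3 * K * S + - (u * K' * K * (4 / 3 * Z))) = 2 / 3 * p * (q * K) * (S - u * K' * Z)"
    for p q S u Z by (simp add: field_simps)
  have "x * (pi\<^sup>2 / 3 - pi\<^sup>2 * (csch_lattice.Y1 a + a * dY1 a)) =
      sgn x * \<bar>x\<bar> * ((pi\<^sup>2 / 3 - pi\<^sup>2 * csch_lattice.Y1 a) + - (pi\<^sup>2 * (a * dY1 a)))"
    unfolding sx by (simp add: algebra_simps)
  also have "\<dots> = 4 / 3 * sgn x * (\<bar>x\<bar> * K) * (S1 - 2 / pi * K' * (E * S1 + K * (M * (K - E) - E)))"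
    unfolding v1 e1 S1_def[symmetric] by (simp add: right_diff_distrib mult_ac)
  also have "\<dots> = 4 / 3 * sgn x * K' * ((1 - 2 / pi * K' * E) * S1 - 2 / pi * K' * K * (M * (K - E) - E))"
    unfolding xK r1 ..
  finally have 1: "x * (pi\<^sup>2 / 3 - pi\<^sup>2 * (csch_lattice.Y1 a + a * dY1 a)) =
    4 / 3 * sgn x * K' * ((1 - 2 / pi * K' * E) * S1 - 2 / pi * K' * K * (M * (K - E) - E))" .
  have "x / 2 * (pi\<^sup>2 / 3 - pi\<^sup>2 * (csch_lattice.Y1 a + a * dY1 a) + pi\<^sup>2 * (csch_lattice.Y3 a + a * dY3 a)) =
      sgn x * \<bar>x\<bar> / 2 * ((pi\<^sup>2 / 3 - pi\<^sup>2 * csch_lattice.Y1 a + pi\<^sup>2 * csch_lattice.Y3 a)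
        + (- (pi\<^sup>2 * (a * dY1 a)) + pi\<^sup>2 * (a * dY3 a)))"
    unfolding sx by (simp add: algebra_simps)
  also have "\<dots> = 2 / 3 * sgn x * (\<bar>x\<bar> * K) *
      (S3 - 2 / pi * K' * ((E - M * K) * S3 + K * ((1 - 2 * k\<^sup>2) * E + (4 * k\<^sup>2 - 1) * M * K)))"
    unfolding v3 e3 S3_def[symmetric] by (rule r4)
  also have "\<dots> = 2 / 3 * sgn x * K' * (S3 * (1 - 2 / pi * K' * (E - M * K))
      - 2 / pi * K' * K * ((1 - 2 * k\<^sup>2) * E + (4 * k\<^sup>2 - 1) * M * K))"
    unfolding xK r3 ..
  also have "S3 = 6 * E + K * (4 * k\<^sup>2 - 5)" by (simp add: S3_def mult.commute)
  also have "E - M * K = E + K * (k\<^sup>2 - 1)" by (simp add: M_def algebra_simps)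
  finally have 3: "x / 2 * (pi\<^sup>2 / 3 - pi\<^sup>2 * (csch_lattice.Y1 a + a * dY1 a) + pi\<^sup>2 * (csch_lattice.Y3 a + a * dY3 a)) =
    2 / 3 * sgn x * K' * ((6 * E + K * (4 * k\<^sup>2 - 5)) * (1 - 2 / pi * K' * (E + K * (k\<^sup>2 - 1)))
      - 2 / pi * K' * K * ((1 - 2 * k\<^sup>2) * E + (4 * k\<^sup>2 - 1) * M * K))" .
  show ?thesis
    using T2_imaginary[OF assms(1) a_def] T2_half[OF assms(1) a_def]
    unfolding 1 3 S1_def M_def K_def E_def K'_def by blast
qed

end
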